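(* Let $\mathbb{K}$ be an infinite field, $m,n\ge2$ integers, and $q\in\mathbb{K}$ nonzero and not a root of unity. For every $t\in[mn]$ there is a $\mathbb{K}$-algebra isomorphism $R^{(t)}\simeq A^{(t)}$ which, for each $(i,j)\in[m]\times[n]$, maps the standard generator of $R^{(t)}$ with coordinate $(i,j)$ to the generator of $A^{(t)}$ with coordinate $(i,j)$.
   Context: Notation: $[k]=\{1,\dots,k\}$; coordinates $(i,j)\in[m]\times[n]$ are ordered lexicographically. For $t\in[mn]$ let $(r,s)$ denote the $t$-th smallest coordinate. The algebra $R^{(t)}$: the $\mathbb{K}$-algebra with generators $x_{i,j}$, $(i,j)\in[m]\times[n]$, subject to the relations that for every $2\times2$ submatrix $\begin{bmatrix}a&b\\c&d\end{bmatrix}$ of $[x_{i,j}]$: $ab=qba$, $cd=qdc$, $ac=qca$, $bd=qdb$, $bc=cb$, and, if $d=x_{k,\ell}$, $ad=da$ when $(k,\ell)>(r,s)$, while $ad=da+(q-q^{-1})bc$ when $(k,\ell)\le(r,s)$. (For $t=1$ this is quantum affine space, for $t=mn$ it is the algebra of quantum matrices $\mathcal{O}_q(\mathcal{M}_{m,n}(\mathbb{K}))$.) Quantum torus: $\mathcal{O}_q((\mathbb{K}^\times)^{m\times n})$ is the $\mathbb{K}$-algebra generated by $t_{i,j}^{\pm1}$, $(i,j)\in[m]\times[n]$, with, for every $2\times2$ submatrix $\begin{bmatrix}a&b\\c&d\end{bmatrix}$ of $[t_{i,j}]$: $ab=qba$, $cd=qdc$, $ac=qca$, $bd=qdb$,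 $bc=cb$, $ad=da$. The directed graph $G_\emptyset^{m\times n}$ has vertices: all coordinates $(i,j)\in[m]\times[n]$ (white vertices), row vertices $1,\dots,m$ and column vertices $1,\dots,n$. Edges and weights: $(i,j)\to(i,j-1)$ (horizontal) with weight $t_{i,j}^{-1}t_{i,j-1}$; $(i,j)\to(i+1,j)$ (vertical) with weight $1$; row vertex $i\to(i,n)$ (horizontal) with weight $t_{i,n}$; $(m,j)\to$ column vertex $j$ (vertical) with weight $1$. The weight $w(P)$ of a directed path is the product of its edge weights in the order of the path. A ⅃-turn (backwards-L turn) of a path is a white vertex entered by a vertical edge and left by a horizontal edge. $\Gamma_\emptyset^{(t)}(i,j)$ is the set of directed paths from row vertex $i$ to column vertex $j$ in which no vertex larger than $(r,s)$ is a ⅃-turn. $A^{(t)}$ is the subalgebra of the quantum torus generated by the elements $\sum_{P\in\Gamma_\emptyset^{(t)}(i,j)}w(P)$, $(i,j)\in[m]\times[n]$; this element is called the generator of $A^{(t)}$ with coordinate $(i,j)$. *)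

theory Defs
  imports "HOL-Algebra.QuotRing" "HOL-Algebra.Subrings" "HOL-Algebra.Module" "HOL-Library.Poly_Mapping"
begin

text \<open>
  Words over an alphabet. The monoid is written additively, because this is what the convolution
  product of \<^theory>\<open>HOL-Library.Poly_Mapping\<close> expects; it is not commutative. With this,
  \<open>'x free_monoid \<Rightarrow>\<^sub>0 'k\<close> is the free associative unital \<open>'k\<close>-algebra on the type \<open>'x\<close>.
\<close>

datatype 'x free_monoid = Word (letters: "'x list")

instantiation free_monoid :: (type) monoid_add
begin

definition zero_free_monoid :: "'a free_monoid" where
  "0 = Word []"

definition plus_free_monoid :: "'a free_monoid \<Rightarrow> 'a free_monoid \<Rightarrow> 'a free_monoid" where
  "u + v = Word (letters u @ letters v)"

instance
  by standard (auto simp: zero_free_monoid_def plus_free_monoid_def)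

end

type_synonym ('x, 'k) free_algebra = "'x free_monoid \<Rightarrow>\<^sub>0 'k"

definition letter :: "'x \<Rightarrow> ('x, 'k::zero_neq_one) free_algebra" where
  "letter x = Poly_Mapping.single (Word [x]) 1"

definition scalar :: "'k \<Rightarrow> ('x, 'k::zero) free_algebra" where
  "scalar c = Poly_Mapping.single 0 c"

text \<open>
  Algebras over the field \<open>'k\<close> (a type) are represented by records of type
  \<open>('k, 'a) module\<close>: a not necessarily commutative ring together with a scalar multiplication.
\<close>

definition free_alg :: "'x set \<Rightarrow> ('k::field, ('x, 'k) free_algebra) module" where
  "free_alg X =
    \<lparr>carrier = {p. \<forall>w \<in> Poly_Mapping.keys p. set (letters w) \<subseteq> X},
     mult = (*), one = 1, zero = 0, add = (+),
     smult = (\<lambda>c p. scalar c * p)\<rparr>"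

text \<open>The scalar multiplication on cosets follows the pattern of \<^const>\<open>rcoset_mult\<close>.\<close>

definition quot_alg :: "('k, 'a) module \<Rightarrow> 'a set \<Rightarrow> ('k, 'a set) module" where
  "quot_alg A I =
    ring.extend (A Quot I) (module.fields (\<lambda>c C. \<Union>a\<in>C. I +>\<^bsub>A\<^esub> (c \<odot>\<^bsub>A\<^esub> a)))"

text \<open>
  A relation \<open>u = v\<close> is the pair \<open>(u, v)\<close>; \<^const>\<open>genideal\<close> is the generated two-sided ideal.
\<close>

definition rel_ideal ::
  "'x set \<Rightarrow> (('x, 'k::field) free_algebra \<times> ('x, 'k) free_algebra) set
    \<Rightarrow> ('x, 'k) free_algebra set" where
  "rel_ideal X S = Idl\<^bsub>free_alg X\<^esub> ((\<lambda>(u, v). u - v) ` S)"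

definition presented_alg ::
  "'x set \<Rightarrow> (('x, 'k::field) free_algebra \<times> ('x, 'k) free_algebra) set
    \<Rightarrow> ('k, ('x, 'k) free_algebra set) module" where
  "presented_alg X S = quot_alg (free_alg X) (rel_ideal X S)"

definition presented_gen ::
  "'x set \<Rightarrow> (('x, 'k::field) free_algebra \<times> ('x, 'k) free_algebra) set
    \<Rightarrow> 'x \<Rightarrow> ('x, 'k) free_algebra set" where
  "presented_gen X S x = rel_ideal X S +>\<^bsub>free_alg X\<^esub> letter x"

lemma ring_free_alg: "ring (free_alg X :: ('k::field, ('x, 'k) free_algebra) module)"
proof (rule ringI)
  let ?F = "free_alg X :: ('k, ('x, 'k) free_algebra) module"
  have neg: "- p \<in> carrier ?F" if "p \<in> carrier ?F" for p
    using that by (simp add: free_alg_def)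
  have add: "p + r \<in> carrier ?F" if "p \<in> carrier ?F" "r \<in> carrier ?F" for p r
    using that Poly_Mapping.keys_add[of p r] by (auto simp: free_alg_def)
  have mult: "p * r \<in> carrier ?F" if "p \<in> carrier ?F" "r \<in> carrier ?F" for p r
    using that keys_mult[of p r] by (fastforce simp: free_alg_def plus_free_monoid_def)
  have unit: "1 \<in> carrier ?F"
    by (simp add: free_alg_def zero_free_monoid_def flip: single_one)
  have sel: "x \<oplus>\<^bsub>?F\<^esub> y = x + y" "x \<otimes>\<^bsub>?F\<^esub> y = x * y" "\<zero>\<^bsub>?F\<^esub> = 0" "\<one>\<^bsub>?F\<^esub> = 1" for x y
    by (simp_all add: free_alg_def)
  show "abelian_group ?F"
  proof (rule abelian_groupI, unfold sel)
    show "0 \<in> carrier ?F"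
      by (simp add: free_alg_def)
    show "\<exists>r\<in>carrier ?F. r + p = 0" if "p \<in> carrier ?F" for p
      using neg[OF that] by (intro bexI[of _ "- p"]) simp
  qed (use add in \<open>simp_all add: ac_simps\<close>)
  show "Group.monoid ?F"
    by (rule monoidI, unfold sel) (use mult unit in \<open>simp_all add: mult.assoc\<close>)
qed (simp_all add: free_alg_def distrib_left distrib_right)

definition subalgebra_of :: "'a set \<Rightarrow> ('k, 'a) module \<Rightarrow> bool" where
  "subalgebra_of B A \<longleftrightarrow> subring B A \<and> (\<forall>c. \<forall>b\<in>B. c \<odot>\<^bsub>A\<^esub> b \<in> B)"

definition gen_subalg :: "('k, 'a) module \<Rightarrow> 'a set \<Rightarrow> ('k, 'a) module" where
  "gen_subalg A S = A\<lparr>carrier := \<Inter>{B. subalgebra_of B A \<and> S \<subseteq> B}\<rparr>"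

definition alg_iso :: "('k, 'a) module \<Rightarrow> ('k, 'b) module \<Rightarrow> ('a \<Rightarrow> 'b) set" where
  "alg_iso A B =
    {h \<in> ring_iso A B. \<forall>c. \<forall>a \<in> carrier A. h (c \<odot>\<^bsub>A\<^esub> a) = c \<odot>\<^bsub>B\<^esub> h a}"

type_synonym coord = "nat \<times> nat"

definition coords :: "nat \<Rightarrow> nat \<Rightarrow> coord set" where
  "coords m n = {1..m} \<times> {1..n}"

definition coord_less :: "coord \<Rightarrow> coord \<Rightarrow> bool" where
  "coord_less a b \<longleftrightarrow> (a, b) \<in> less_than <*lex*> less_than"

definition nth_coord :: "nat \<Rightarrow> nat \<Rightarrow> nat \<Rightarrow> coord" where
  "nth_coord m n t =
    (THE a. a \<in> coords m n \<and> Suc (card {b \<in> coords m n. coord_less b a}) = t)"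

text \<open>
  The relations imposed by all \<open>2 \<times> 2\<close> submatrices \<open>[a b; c d]\<close> of the matrix \<open>x\<close>.
  The predicate \<open>P\<close> selects the positions of \<open>d\<close> for which \<open>a d = d a + (q - q\<^sup>-\<^sup>1) b c\<close>;
  for the other positions \<open>a\<close> and \<open>d\<close> commute.
\<close>

definition q_relations ::
  "nat \<Rightarrow> nat \<Rightarrow> 'k::field \<Rightarrow> (coord \<Rightarrow> bool) \<Rightarrow> (coord \<Rightarrow> ('x, 'k) free_algebra)
    \<Rightarrow> (('x, 'k) free_algebra \<times> ('x, 'k) free_algebra) set" where
  "q_relations m n q P x =
    (\<Union>(i, j, k, l) \<in> {(i, j, k, l). 1 \<le> i \<and> i < k \<and> k \<le> m \<and> 1 \<le> j \<and> j < l \<and> l \<le> n}.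
      let a = x (i, j); b = x (i, l); c = x (k, j); d = x (k, l) in
        {(a * b, scalar q * (b * a)),
         (c * d, scalar q * (d * c)),
         (a * c, scalar q * (c * a)),
         (b * d, scalar q * (d * b)),
         (b * c, c * b),
         (a * d, if P (k, l) then d * a + scalar (q - inverse q) * (b * c) else d * a)})"

definition R_rels ::
  "nat \<Rightarrow> nat \<Rightarrow> 'k::field \<Rightarrow> nat \<Rightarrow> ((coord, 'k) free_algebra \<times> (coord, 'k) free_algebra) set" where
  "R_rels m n q t = q_relations m n q (\<lambda>p. \<not> coord_less (nth_coord m n t) p) letter"

definition R_alg ::
  "nat \<Rightarrow> nat \<Rightarrow> 'k::field \<Rightarrow> nat \<Rightarrow> ('k, (coord, 'k) free_algebra set) module" where
  "R_alg m n q t = presented_alg (coords m n) (R_rels m n q t)"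

definition R_gen ::
  "nat \<Rightarrow> nat \<Rightarrow> 'k::field \<Rightarrow> nat \<Rightarrow> coord \<Rightarrow> (coord, 'k) free_algebra set" where
  "R_gen m n q t = presented_gen (coords m n) (R_rels m n q t)"

datatype torus_letter = T coord | T_inv coord

definition torus_letters :: "nat \<Rightarrow> nat \<Rightarrow> torus_letter set" where
  "torus_letters m n = T ` coords m n \<union> T_inv ` coords m n"

definition torus_rels ::
  "nat \<Rightarrow> nat \<Rightarrow> 'k::field
    \<Rightarrow> ((torus_letter, 'k) free_algebra \<times> (torus_letter, 'k) free_algebra) set" where
  "torus_rels m n q =
    (\<Union>a \<in> coords m n. {(letter (T a) * letter (T_inv a), 1), (letter (T_inv a) * letter (T a), 1)})
    \<union> q_relations m n q (\<lambda>_. False) (\<lambda>a. letter (T a))"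

definition torus_alg ::
  "nat \<Rightarrow> nat \<Rightarrow> 'k::field \<Rightarrow> ('k, (torus_letter, 'k) free_algebra set) module" where
  "torus_alg m n q = presented_alg (torus_letters m n) (torus_rels m n q)"

definition torus_gen ::
  "nat \<Rightarrow> nat \<Rightarrow> 'k::field \<Rightarrow> torus_letter \<Rightarrow> (torus_letter, 'k) free_algebra set" where
  "torus_gen m n q = presented_gen (torus_letters m n) (torus_rels m n q)"

datatype vertex = White coord | Row nat | Col nat

inductive h_edge :: "nat \<Rightarrow> nat \<Rightarrow> vertex \<Rightarrow> vertex \<Rightarrow> bool" for m n where
  "(i, j) \<in> coords m n \<Longrightarrow> (i, Suc j) \<in> coords m n \<Longrightarrow> h_edge m n (White (i, Suc j)) (White (i, j))"
| "i \<in> {1..m} \<Longrightarrow> h_edge m n (Row i) (White (i, n))"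

inductive v_edge :: "nat \<Rightarrow> nat \<Rightarrow> vertex \<Rightarrow> vertex \<Rightarrow> bool" for m n where
  "(i, j) \<in> coords m n \<Longrightarrow> (Suc i, j) \<in> coords m n \<Longrightarrow> v_edge m n (White (i, j)) (White (Suc i, j))"
| "j \<in> {1..n} \<Longrightarrow> v_edge m n (White (m, j)) (Col j)"

text \<open>There are no parallel edges, so a path is determined by its list of vertices.\<close>

definition dipaths :: "nat \<Rightarrow> nat \<Rightarrow> vertex \<Rightarrow> vertex \<Rightarrow> vertex list set" where
  "dipaths m n u v =
    {p. p \<noteq> [] \<and> hd p = u \<and> last p = v \<and> distinct p
      \<and> successively (\<lambda>x y. h_edge m n x y \<or> v_edge m n x y) p}"

definition back_turn :: "nat \<Rightarrow> nat \<Rightarrow> vertex list \<Rightarrow> coord \<Rightarrow> bool" where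
  "back_turn m n p a \<longleftrightarrow>
    (\<exists>xs u v ys. p = xs @ [u, White a, v] @ ys \<and> v_edge m n u (White a) \<and> h_edge m n (White a) v)"

definition Gamma :: "nat \<Rightarrow> nat \<Rightarrow> nat \<Rightarrow> coord \<Rightarrow> vertex list set" where
  "Gamma m n t = (\<lambda>(i, j).
    {p \<in> dipaths m n (Row i) (Col j). \<forall>a. back_turn m n p a \<longrightarrow> \<not> coord_less (nth_coord m n t) a})"

text \<open>
  Intended for edges only: an edge between white vertices is horizontal iff it stays in its row.
  Vertical edges have weight one.
\<close>

definition edge_weight ::
  "nat \<Rightarrow> nat \<Rightarrow> 'k::field \<Rightarrow> vertex \<Rightarrow> vertex \<Rightarrow> (torus_letter, 'k) free_algebra set" where
  "edge_weight m n q u v =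
    (case (u, v) of
      (White (i, j), White (k, l)) \<Rightarrow>
        if i = k
        then torus_gen m n q (T_inv (i, j)) \<otimes>\<^bsub>torus_alg m n q\<^esub> torus_gen m n q (T (k, l))
        else \<one>\<^bsub>torus_alg m n q\<^esub>
    | (Row i, White a) \<Rightarrow> torus_gen m n q (T a)
    | _ \<Rightarrow> \<one>\<^bsub>torus_alg m n q\<^esub>)"

definition path_weight ::
  "nat \<Rightarrow> nat \<Rightarrow> 'k::field \<Rightarrow> vertex list \<Rightarrow> (torus_letter, 'k) free_algebra set" where
  "path_weight m n q p =
    foldr (\<lambda>(u, v) w. edge_weight m n q u v \<otimes>\<^bsub>torus_alg m n q\<^esub> w)
      (zip p (tl p)) \<one>\<^bsub>torus_alg m n q\<^esub>"

text \<open>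
  \<^const>\<open>finsum\<close> over an infinite set would be the default value zero; the lemma below excludes this.
\<close>

definition A_gen ::
  "nat \<Rightarrow> nat \<Rightarrow> 'k::field \<Rightarrow> nat \<Rightarrow> coord \<Rightarrow> (torus_letter, 'k) free_algebra set" where
  "A_gen m n q t a = (\<Oplus>\<^bsub>torus_alg m n q\<^esub> p \<in> Gamma m n t a. path_weight m n q p)"

lemma finite_Gamma: "finite (Gamma m n t a)"
proof -
  let ?V = "White ` ({1..m} \<times> {0..n}) \<union> Row ` {1..m} \<union> Col ` {1..n} \<union> {Row (fst a)}"
  have finV: "finite ?V"
    by simp
  have tgt: "y \<in> ?V" if "h_edge m n x y \<or> v_edge m n x y" for x y
    using that by (elim disjE h_edge.cases v_edge.cases) (auto simp: coords_def)
  have sub: "set p \<subseteq> ?V"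
    if "successively (\<lambda>x y. h_edge m n x y \<or> v_edge m n x y) p" "p \<noteq> []" "hd p \<in> ?V" for p
    using that
  proof (induction p rule: induct_list012)
    case (3 x y zs)
    then have "y \<in> ?V"
      by (intro tgt[of x]) simp
    with 3 show ?case by simp
  qed auto
  have "Gamma m n t a \<subseteq> {p. set p \<subseteq> ?V \<and> distinct p}"
  proof
    fix p assume "p \<in> Gamma m n t a"
    then have p: "p \<in> dipaths m n (Row (fst a)) (Col (snd a))"
      by (simp add: Gamma_def split: prod.splits)
    then have "set p \<subseteq> ?V"
      by (intro sub) (simp_all add: dipaths_def)
    with p show "p \<in> {p. set p \<subseteq> ?V \<and> distinct p}"
      by (simp add: dipaths_def)
  qed
  moreover have "finite {p. set p \<subseteq> ?V \<and> distinct p}"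
    using finite_subset_distinct[OF finV] by simp
  ultimately show ?thesis
    by (rule finite_subset)
qed

definition A_alg ::
  "nat \<Rightarrow> nat \<Rightarrow> 'k::field \<Rightarrow> nat \<Rightarrow> ('k, (torus_letter, 'k) free_algebra set) module" where
  "A_alg m n q t = gen_subalg (torus_alg m n q) (A_gen m n q t ` coords m n)"

end

(* The quantum torus acts faithfully on functions of the exponent lattice by twisted shifts, so all
   computations can be carried out with linear operators.

   Let X^(t) be the matrix of path sums. Allowing turns at one more vertex (r,s) replaces X_ij, for
   i < r and j < s, by X_ij + X_is X_rs^-1 X_rj, because the new paths are exactly those that enter
   (r,s) vertically and leave it horizontally. This is a step of Cauchon's restoration algorithm,
   and it carries the relations of R^(t-1) to those of R^(t); hence there is a surjection from R^(t)
   onto A^(t).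

   For injectivity, the relations of R^(t) straighten every word to a combination of sorted words.
   Giving t_ij the weight i j, every nontrivial turn lowers the weight of a path, so X_ij is t_ij plus
   terms of smaller weight. The sorted words in the X_ij therefore have distinct leading monomials and
   are linearly independent. *)

theory Submission
  imports Defs "HOL-Library.Product_Lexorder" "HOL-Library.Multiset"
begin

section \<open>Linear operators on function spaces\<close>

text \<open>The obstacle is that equality in a presented algebra means membership in a generated
  ideal. For the torus and for each R^(t), this ideal is shown to be exactly the kernel of an
  evaluation in operators. One criterion serves both: a set of words spans modulo the ideal, and the
  values of these words are linearly independent. Cosets are then the fibres of the evaluation, both
  algebras become sets of operators, and the isomorphism is the identity on operators. The weight i
  j is chosen so that the correction X_is X_rs^-1 X_rj has leading weight i s - r s + r j = i j - (r
  - i)(s - j), which is less than i j whenever i < r and j < s. Thus a restoration step never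
  disturbs the leading term t_ij.\<close>

typedef (overloaded) ('i, 'k::field) lop =
  "{f :: ('i \<Rightarrow> 'k) \<Rightarrow> 'i \<Rightarrow> 'k. (\<forall>u v i. f (\<lambda>i. u i + v i) i = f u i + f v i)
    \<and> (\<forall>c v i. f (\<lambda>i. c * v i) i = c * f v i)}"
  morphisms app Lop
  by (intro exI[of _ "\<lambda>v. v"]) auto

setup_lifting type_definition_lop

lemma lop_eqI: "(\<And>v i. app A v i = app B v i) \<Longrightarrow> A = B"
  by (metis app_inject ext)

lemma app_add_right: "app A (\<lambda>i. u i + v i) i = app A u i + app A v i"
  using app[of A] by blast

lemma app_scale_right: "app A (\<lambda>i. c * v i) i = c * app A v i"
  using app[of A] by blast

text \<open>A type rather than a carrier set: products, \<open>prod_list\<close>, finite sums and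
  the ring rules of the simplifier then apply without closure conditions.\<close>

instantiation lop :: (type, field) ring_1
begin

lift_definition zero_lop :: "('a, 'b) lop" is "\<lambda>v i. 0" by simp
lift_definition one_lop :: "('a, 'b) lop" is "\<lambda>v. v" by simp
lift_definition plus_lop :: "('a, 'b) lop \<Rightarrow> ('a, 'b) lop \<Rightarrow> ('a, 'b) lop" is "\<lambda>f g v i. f v i + g v i"
  by (simp add: algebra_simps)
lift_definition minus_lop :: "('a, 'b) lop \<Rightarrow> ('a, 'b) lop \<Rightarrow> ('a, 'b) lop" is "\<lambda>f g v i. f v i - g v i"
  by (simp add: algebra_simps)
lift_definition uminus_lop :: "('a, 'b) lop \<Rightarrow> ('a, 'b) lop" is "\<lambda>f v i. - f v i"
  by simp
lift_definition times_lop :: "('a, 'b) lop \<Rightarrow> ('a, 'b) lop \<Rightarrow> ('a, 'b) lop" is "\<lambda>f g v. f (g v)"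
proof -
  fix f g :: "('a \<Rightarrow> 'b) \<Rightarrow> 'a \<Rightarrow> 'b"
  assume f: "(\<forall>u v i. f (\<lambda>i. u i + v i) i = f u i + f v i) \<and> (\<forall>c v i. f (\<lambda>i. c * v i) i = c * f v i)"
    and g: "(\<forall>u v i. g (\<lambda>i. u i + v i) i = g u i + g v i) \<and> (\<forall>c v i. g (\<lambda>i. c * v i) i = c * g v i)"
  have "g (\<lambda>i. u i + v i) = (\<lambda>i. g u i + g v i)" "g (\<lambda>i. c * v i) = (\<lambda>i. c * g v i)" for u v c
    using g by auto
  with f show "(\<forall>u v i. f (g (\<lambda>i. u i + v i)) i = f (g u) i + f (g v) i)
      \<and> (\<forall>c v i. f (g (\<lambda>i. c * v i)) i = c * f (g v) i)"
    by simp
qed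

instance
proof
  fix A B C :: "('a, 'b) lop"
  show "A * (B + C) = A * B + A * C"
    by (rule lop_eqI) (simp add: plus_lop.rep_eq times_lop.rep_eq app_add_right)
  have "app (1 :: ('a, 'b) lop) (\<lambda>_. 1) i \<noteq> app 0 (\<lambda>_. 1) i" for i
    by (simp add: one_lop.rep_eq zero_lop.rep_eq)
  then show "(0 :: ('a, 'b) lop) \<noteq> 1"
    by metis
qed (transfer; simp add: fun_eq_iff algebra_simps)+

end

lift_definition sc :: "'k \<Rightarrow> ('i, 'k::field) lop" is "\<lambda>c v i. c * v i"
  by (simp add: algebra_simps)

lemmas app_simps = plus_lop.rep_eq minus_lop.rep_eq uminus_lop.rep_eq times_lop.rep_eq
  zero_lop.rep_eq one_lop.rep_eq sc.rep_eq

lemma app_sum: "app (\<Sum>x\<in>A. f x) v i = (\<Sum>x\<in>A. app (f x) v i)"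
  by (induction A rule: infinite_finite_induct) (simp_all add: app_simps)

lemma sc_0 [simp]: "sc 0 = 0" and sc_1 [simp]: "sc 1 = 1"
  by (rule lop_eqI, simp add: app_simps)+

lemma sc_add: "sc (c + d) = sc c + sc d"   and sc_diff: "sc (c - d) = sc c - sc d" and sc_mult: "sc (c * d) = sc c * sc d"
  by (rule lop_eqI, simp add: app_simps algebra_simps)+

lemma sc_commute: "A * sc c = sc c * A"
  by (rule lop_eqI) (simp add: app_simps app_scale_right)

lemma sc_left_commute: "A * (sc c * B) = sc c * (A * B)"
  by (metis mult.assoc sc_commute)

section \<open>Evaluation of noncommutative polynomials\<close>

text \<open>Peeling off one monomial at a time shrinks the support. The set \<open>A\<close> is
  carried along because membership in \<open>free_alg X\<close> is a condition on the
  support.\<close>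

lemma poly_mapping_induct_on:
  fixes p :: "'a \<Rightarrow>\<^sub>0 'b::ab_group_add"
  assumes "Poly_Mapping.keys p \<subseteq> A" "P 0"
    and step: "\<And>w c p. w \<in> A \<Longrightarrow> Poly_Mapping.keys p \<subseteq> A \<Longrightarrow> P p \<Longrightarrow> P (Poly_Mapping.single w c + p)"
  shows "P p"
  using assms(1)
proof (induction "card (Poly_Mapping.keys p)" arbitrary: p)
  case 0
  then show ?case using \<open>P 0\<close> by simp
next
  case (Suc k)
  then obtain w where w: "w \<in> Poly_Mapping.keys p"
    by fastforce
  let ?r = "p - Poly_Mapping.single w (Poly_Mapping.lookup p w)"
  have keys: "Poly_Mapping.keys ?r = Poly_Mapping.keys p - {w}"
    by (auto simp: in_keys_iff lookup_minus lookup_single when_def split: if_splits)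
  have "P ?r"
  proof (rule Suc.hyps(1))
    show "k = card (Poly_Mapping.keys ?r)"
      using keys Suc.hyps(2) w by (metis card_Diff_singleton diff_Suc_1)
  qed (use keys Suc.prems in auto)
  then have "P (Poly_Mapping.single w (Poly_Mapping.lookup p w) + ?r)"
    using w Suc.prems keys by (intro step) auto
  then show ?case by simp
qed

definition ev :: "('x \<Rightarrow> ('i, 'k) lop) \<Rightarrow> ('x, 'k::field) free_algebra \<Rightarrow> ('i, 'k) lop" where
  "ev E p = (\<Sum>w\<in>Poly_Mapping.keys p. sc (Poly_Mapping.lookup p w) * prod_list (map E (letters w)))"

lemma ev_superset:
  assumes "finite A" "Poly_Mapping.keys p \<subseteq> A"
  shows "ev E p = (\<Sum>w\<in>A. sc (Poly_Mapping.lookup p w) * prod_list (map E (letters w)))"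
  unfolding ev_def by (rule sum.mono_neutral_left) (use assms in \<open>auto simp: in_keys_iff\<close>)

lemma ev_add: "ev E (p + r) = ev E p + ev E r"
proof -
  let ?A = "Poly_Mapping.keys p \<union> Poly_Mapping.keys r"
  have "Poly_Mapping.keys (p + r) \<subseteq> ?A" by (rule Poly_Mapping.keys_add)
  then show ?thesis
    using ev_superset[of ?A "p + r" E] ev_superset[of ?A p E] ev_superset[of ?A r E]
    by (simp add: lookup_add sc_add distrib_right sum.distrib)
qed

lemma ev_0 [simp]: "ev E 0 = 0"
  by (simp add: ev_def)

lemma ev_uminus: "ev E (- p) = - ev E p"
  using ev_add[of E p "- p"] by (simp add: add_eq_0_iff)

lemma ev_diff: "ev E (p - r) = ev E p - ev E r"
  using ev_add[of E p "- r"] by (simp add: ev_uminus)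

lemma ev_single: "ev E (Poly_Mapping.single w c) = sc c * prod_list (map E (letters w))"
  by (simp add: ev_superset[of "{w}"])

lemma ev_letter [simp]: "ev E (letter x) = E x"
  by (simp add: letter_def ev_single)

lemma ev_scalar [simp]: "ev E (scalar c) = sc c"
  by (simp add: scalar_def ev_single zero_free_monoid_def)

lemma ev_1 [simp]: "ev E 1 = 1"
  by (simp add: ev_single zero_free_monoid_def flip: single_one)

text \<open>By bilinearity it suffices to treat two monomials. There the scalar of the second has to
  pass the operators of the first, which is possible because scalars are central.\<close>

lemma ev_mult: "ev E (p * r) = ev E p * ev E r"
proof (induction p rule: poly_mapping_induct_on[where A = UNIV])
  case (3 w c p)
  have "ev E (Poly_Mapping.single w c * r) = ev E (Poly_Mapping.single w c) * ev E r"
  proof (induction r rule: poly_mapping_induct_on[where A = UNIV])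
    case (3 v d r)
    have "ev E (Poly_Mapping.single w c * Poly_Mapping.single v d)
        = ev E (Poly_Mapping.single w c) * ev E (Poly_Mapping.single v d)"
      using sc_left_commute[of "prod_list (map E (letters w))" d "prod_list (map E (letters v))"]
      by (simp add: mult_single ev_single plus_free_monoid_def sc_mult mult.assoc)
    with 3 show ?case
      by (simp add: distrib_left ev_add)
  qed simp_all
  with 3 show ?case
    by (simp add: distrib_right ev_add)
qed simp_all

section \<open>Presentations with a faithful representation\<close>

lemma carrier_free_alg_iff:
  "p \<in> carrier (free_alg X) \<longleftrightarrow> Poly_Mapping.keys p \<subseteq> {w. set (letters w) \<subseteq> X}"
  by (auto simp: free_alg_def)

lemma free_alg_sel [simp]:
  "p \<otimes>\<^bsub>free_alg X\<^esub> r = p * r" "\<one>\<^bsub>free_alg X\<^esub> = 1" "\<zero>\<^bsub>free_alg X\<^esub> = 0"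
  "p \<oplus>\<^bsub>free_alg X\<^esub> r = p + r" "c \<odot>\<^bsub>free_alg X\<^esub> p = scalar c * p"
  by (simp_all add: free_alg_def)

lemma free_alg_closed:
  assumes "p \<in> carrier (free_alg X)" "r \<in> carrier (free_alg X)"
  shows "p + r \<in> carrier (free_alg X)" "p * r \<in> carrier (free_alg X)"
proof -
  interpret ring "free_alg X :: ('b, ('a, 'b) free_algebra) module" by (rule ring_free_alg)
  show "p + r \<in> carrier (free_alg X)" "p * r \<in> carrier (free_alg X)"
    using a_closed[OF assms] m_closed[OF assms] by simp_all
qed

lemma free_alg_uminus_closed: "p \<in> carrier (free_alg X) \<Longrightarrow> - p \<in> carrier (free_alg X)"
  by (simp add: carrier_free_alg_iff)

lemma free_alg_diff_closed:
  "p \<in> carrier (free_alg X) \<Longrightarrow> r \<in> carrier (free_alg X) \<Longrightarrow> p - r \<in> carrier (free_alg X)"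
  using free_alg_closed(1)[of p X "- r"] free_alg_uminus_closed[of r X] by simp

lemma free_alg_single_closed: "set xs \<subseteq> X \<Longrightarrow> Poly_Mapping.single (Word xs) c \<in> carrier (free_alg X)"
  by (simp add: carrier_free_alg_iff)

lemma free_alg_letter_closed: "x \<in> X \<Longrightarrow> letter x \<in> carrier (free_alg X)"
  by (simp add: letter_def free_alg_single_closed)

lemma free_alg_scalar_closed: "scalar c \<in> carrier (free_alg X)"
  by (simp add: scalar_def zero_free_monoid_def free_alg_single_closed)

lemma free_alg_0_closed: "0 \<in> carrier (free_alg X)" and free_alg_1_closed: "1 \<in> carrier (free_alg X)"
  using free_alg_scalar_closed[of 1 X] by (simp_all add: carrier_free_alg_iff scalar_def single_one)

lemmas free_alg_intros = free_alg_closed free_alg_uminus_closed free_alg_diff_closed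
  free_alg_single_closed free_alg_letter_closed free_alg_scalar_closed free_alg_0_closed
  free_alg_1_closed

lemma scalar_mult_single: "scalar c * Poly_Mapping.single w d = Poly_Mapping.single w (c * d)"
  by (simp add: scalar_def mult_single)

lemma free_alg_induct [consumes 1, case_names zero step]:
  assumes "p \<in> carrier (free_alg X)" "P 0"
    and "\<And>xs c p. set xs \<subseteq> X \<Longrightarrow> p \<in> carrier (free_alg X) \<Longrightarrow> P p
      \<Longrightarrow> P (Poly_Mapping.single (Word xs) c + p)"
  shows "P p"
proof (rule poly_mapping_induct_on[where P = P and A = "{w. set (letters w) \<subseteq> X}"])
  fix w c and p :: "('a, 'b) free_algebra"
  assume "w \<in> {w. set (letters w) \<subseteq> X}" "Poly_Mapping.keys p \<subseteq> {w. set (letters w) \<subseteq> X}" "P p"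
  then show "P (Poly_Mapping.single w c + p)"
    using assms(3)[of "letters w" p c] by (simp add: carrier_free_alg_iff)
qed (use assms in \<open>simp_all add: carrier_free_alg_iff\<close>)

text \<open>The fibre of the evaluation over the operator \<open>c\<close>. Once the kernel is the
  relation ideal, the nonempty fibres are precisely the cosets, so operators can serve as names of
  residue classes.\<close>

definition cls :: "('x \<Rightarrow> ('i, 'k) lop) \<Rightarrow> 'x set \<Rightarrow> ('i, 'k) lop \<Rightarrow> ('x, 'k::field) free_algebra set" where
  "cls E X c = {p \<in> carrier (free_alg X). ev E p = c}"

lemma cls_0_ideal:
  fixes E :: "'x \<Rightarrow> ('i, 'k::field) lop"
  shows "ideal (cls E X 0) (free_alg X)"
proof (rule idealI)
  show "subgroup (cls E X 0) (add_monoid (free_alg X))"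
  proof (unfold_locales, goal_cases)
    case (4 p)
    have "inv\<^bsub>add_monoid (free_alg X)\<^esub> p = - p"
    proof -
      interpret ring "free_alg X :: ('k, ('x, 'k) free_algebra) module" by (rule ring_free_alg)
      have "\<ominus>\<^bsub>free_alg X\<^esub> p = - p"
        using 4 by (intro minus_equality) (auto simp: cls_def free_alg_intros)
      then show ?thesis by (simp add: a_inv_def)
    qed
    with 4 show ?case
      by (simp add: cls_def free_alg_intros ev_uminus)
  qed (auto simp: cls_def ev_add free_alg_intros)
qed (auto simp: cls_def ev_mult ring_free_alg free_alg_intros)

lemma rel_ideal_facts:
  assumes "\<And>u v. (u, v) \<in> S \<Longrightarrow> u \<in> carrier (free_alg X) \<and> v \<in> carrier (free_alg X)"
  shows rel_ideal_ideal: "ideal (rel_ideal X S) (free_alg X)"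
    and rel_ideal_rel: "(u, v) \<in> S \<Longrightarrow> u - v \<in> rel_ideal X S"
proof -
  interpret ring "free_alg X :: ('b, ('a, 'b) free_algebra) module" by (rule ring_free_alg)
  have sub: "(\<lambda>(u, v). u - v) ` S \<subseteq> carrier (free_alg X)"
    using assms by (auto intro!: free_alg_intros)
  show "ideal (rel_ideal X S) (free_alg X)"
    unfolding rel_ideal_def by (rule genideal_ideal[OF sub])
  show "u - v \<in> rel_ideal X S" if "(u, v) \<in> S"
    using genideal_self[OF sub] that unfolding rel_ideal_def by auto
qed

lemma rel_ideal_le_cls:
  assumes "\<And>u v. (u, v) \<in> S \<Longrightarrow> u \<in> carrier (free_alg X) \<and> v \<in> carrier (free_alg X)"
    and "\<And>u v. (u, v) \<in> S \<Longrightarrow> ev E u = ev E v"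
  shows "rel_ideal X S \<subseteq> cls E X 0"
proof -
  interpret ring "free_alg X :: ('b, ('a, 'b) free_algebra) module" by (rule ring_free_alg)
  show ?thesis
    unfolding rel_ideal_def using assms
    by (intro genideal_minimal[OF cls_0_ideal]) (auto simp: cls_def ev_diff intro!: free_alg_intros)
qed

lemma ideal_free_alg_closed:
  assumes "ideal I (free_alg X :: ('k::field, ('x, 'k) free_algebra) module)"
  shows "0 \<in> I" "p \<in> I \<Longrightarrow> r \<in> I \<Longrightarrow> p + r \<in> I"
    "p \<in> I \<Longrightarrow> r \<in> carrier (free_alg X) \<Longrightarrow> r * p \<in> I"
    "p \<in> I \<Longrightarrow> r \<in> carrier (free_alg X) \<Longrightarrow> p * r \<in> I"
    "p \<in> I \<Longrightarrow> p \<in> carrier (free_alg X)"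
    "p \<in> I \<Longrightarrow> - p \<in> I"
proof -
  interpret ideal I "free_alg X :: ('k, ('x, 'k) free_algebra) module" by (rule assms)
  show "0 \<in> I" using additive_subgroup.zero_closed[OF is_additive_subgroup] by simp
  show "p \<in> I \<Longrightarrow> r \<in> I \<Longrightarrow> p + r \<in> I" using additive_subgroup.a_closed[OF is_additive_subgroup, of p r] by simp
  show l: "p \<in> I \<Longrightarrow> r \<in> carrier (free_alg X) \<Longrightarrow> r * p \<in> I" for p r using I_l_closed[of p r] by simp
  show "p \<in> I \<Longrightarrow> r \<in> carrier (free_alg X) \<Longrightarrow> p * r \<in> I" using I_r_closed[of p r] by simp
  show "p \<in> I \<Longrightarrow> p \<in> carrier (free_alg X)" using a_subset by auto
  show "p \<in> I \<Longrightarrow> - p \<in> I"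
    using l[of p "- 1"] by (simp add: free_alg_intros)
qed

text \<open>The criterion for both presentations: a kernel element is congruent to a combination of
  words in \<open>N\<close>, whose value is again zero; by independence its coefficients vanish, so
  the element lies in the ideal.\<close>

lemma rel_ideal_eq_cls:
  fixes E :: "'x \<Rightarrow> ('i, 'k::field) lop"
  assumes carr: "\<And>u v. (u, v) \<in> S \<Longrightarrow> u \<in> carrier (free_alg X) \<and> v \<in> carrier (free_alg X)"
    and rels: "\<And>u v. (u, v) \<in> S \<Longrightarrow> ev E u = ev E v"
    and span: "\<And>xs. set xs \<subseteq> X \<Longrightarrow>
      \<exists>r. Poly_Mapping.keys r \<subseteq> Word ` N \<and> Poly_Mapping.single (Word xs) 1 - r \<in> rel_ideal X S"
    and indep: "\<And>W c. finite W \<Longrightarrow> W \<subseteq> N \<Longrightarrow> (\<Sum>w\<in>W. sc (c w) * prod_list (map E w)) = 0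
      \<Longrightarrow> \<forall>w\<in>W. c w = 0"
  shows "rel_ideal X S = cls E X 0"
proof
  let ?I = "rel_ideal X S"
  show le: "?I \<subseteq> cls E X 0" using rel_ideal_le_cls[OF carr rels] .
  note I = ideal_free_alg_closed[OF rel_ideal_ideal[OF carr]]
  show "cls E X 0 \<subseteq> ?I"
  proof
    fix p assume "p \<in> cls E X 0"
    then have p: "p \<in> carrier (free_alg X)" "ev E p = 0" by (auto simp: cls_def)
    from p(1) have "\<exists>r. Poly_Mapping.keys r \<subseteq> Word ` N \<and> p - r \<in> ?I"
    proof (induction rule: free_alg_induct)
      case zero
      show ?case using I(1) by (intro exI[of _ 0]) simp
    next
      case (step xs c p)
      obtain r s where r: "Poly_Mapping.keys r \<subseteq> Word ` N" "p - r \<in> ?I"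
        and s: "Poly_Mapping.keys s \<subseteq> Word ` N" "Poly_Mapping.single (Word xs) 1 - s \<in> ?I"
        using step(3) span[OF step(1)] by auto
      have "scalar c * (Poly_Mapping.single (Word xs) 1 - s) \<in> ?I"
        using I(3) s(2) free_alg_scalar_closed by blast
      with r(2) have "Poly_Mapping.single (Word xs) c + p - (scalar c * s + r) \<in> ?I"
        using I(2) by (force simp: right_diff_distrib scalar_mult_single algebra_simps)
      moreover have "Poly_Mapping.keys (scalar c * s) \<subseteq> Poly_Mapping.keys s"
        using keys_mult[of "scalar c" s] by (auto simp: scalar_def split: if_splits)
      then have "Poly_Mapping.keys (scalar c * s + r) \<subseteq> Word ` N"
        using r(1) s(1) Poly_Mapping.keys_add[of "scalar c * s" r] by blast
      ultimately show ?case by blast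
    qed
    then obtain r where r: "Poly_Mapping.keys r \<subseteq> Word ` N" "p - r \<in> ?I" by blast
    have "ev E r = 0"
      using r(2) le p(2) by (auto simp: cls_def ev_diff)
    moreover have "ev E r = (\<Sum>w\<in>letters ` Poly_Mapping.keys r.
        sc (Poly_Mapping.lookup r (Word w)) * prod_list (map E w))"
      unfolding ev_def
      by (subst sum.reindex) (auto simp: inj_on_def free_monoid.expand)
    ultimately have "\<forall>w\<in>letters ` Poly_Mapping.keys r. Poly_Mapping.lookup r (Word w) = 0"
      using r(1) by (intro indep) auto
    then have "r = 0"
      by (auto simp flip: keys_eq_empty simp: in_keys_iff)
    with r(2) show "p \<in> ?I" by simp
  qed
qed

section \<open>Quotient algebras as sets of operators\<close>

definition img :: "('x \<Rightarrow> ('i, 'k) lop) \<Rightarrow> 'x set \<Rightarrow> ('i, 'k::field) lop set" where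
  "img E X = ev E ` carrier (free_alg X)"

lemma img_closed:
  "c \<in> img E X \<Longrightarrow> d \<in> img E X \<Longrightarrow> c + d \<in> img E X"
  "c \<in> img E X \<Longrightarrow> d \<in> img E X \<Longrightarrow> c * d \<in> img E X"
  "c \<in> img E X \<Longrightarrow> - c \<in> img E X"
  "c \<in> img E X \<Longrightarrow> sc k * c \<in> img E X"
  "0 \<in> img E X" "1 \<in> img E X" "x \<in> X \<Longrightarrow> E x \<in> img E X"
proof -
  have "ev E p \<in> img E X" if "p \<in> carrier (free_alg X)" for p
    using that by (simp add: img_def)
  note ev_in = this
  show "c \<in> img E X \<Longrightarrow> d \<in> img E X \<Longrightarrow> c + d \<in> img E X"
    by (auto simp: img_def free_alg_intros simp flip: ev_add)
  show "c \<in> img E X \<Longrightarrow> d \<in> img E X \<Longrightarrow> c * d \<in> img E X"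
    by (auto simp: img_def free_alg_intros simp flip: ev_mult)
  show "c \<in> img E X \<Longrightarrow> - c \<in> img E X"
    by (auto simp: img_def free_alg_intros simp flip: ev_uminus)
  show "sc k * c \<in> img E X" if "c \<in> img E X"
  proof -
    from that obtain p where "p \<in> carrier (free_alg X)" "c = ev E p" by (auto simp: img_def)
    then show ?thesis
      using ev_in[of "scalar k * p"] by (simp add: free_alg_intros ev_mult)
  qed
  show "0 \<in> img E X" "1 \<in> img E X" using ev_in[of 0] ev_in[of 1] by (simp_all add: free_alg_intros)
  show "x \<in> X \<Longrightarrow> E x \<in> img E X" using ev_in[of "letter x"] by (simp add: free_alg_intros)
qed

text \<open>Fibres over values are nonempty and hence distinct; outside \<open>img E X\<close> all
  fibres are empty and coincide.\<close>

lemma cls_inj_on: "inj_on (cls E X) (img E X)"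
  by (auto simp: inj_on_def cls_def img_def)

lemma cls_coset:
  assumes "p \<in> carrier (free_alg X)"
  shows "cls E X 0 +>\<^bsub>free_alg X\<^esub> p = cls E X (ev E p)"
proof -
  have "x \<in> (\<lambda>h. h + p) ` cls E X 0" if "x \<in> cls E X (ev E p)" for x
    using that assms by (intro image_eqI[of _ _ "x - p"]) (auto simp: cls_def ev_diff free_alg_intros)
  then have "(\<lambda>h. h + p) ` cls E X 0 = cls E X (ev E p)"
    using assms by (auto simp: cls_def ev_add free_alg_intros)
  then show ?thesis by (auto simp: a_r_coset_def')
qed

locale faithful_presentation =
  fixes X :: "'x set" and S and E :: "'x \<Rightarrow> ('i, 'k::field) lop"
  assumes ker: "rel_ideal X S = cls E X 0"
begin

abbreviation "B \<equiv> presented_alg X S"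

lemma carrier_B: "carrier B = cls E X ` img E X"
proof -
  have "carrier B = a_rcosets\<^bsub>free_alg X\<^esub> cls E X 0"
    by (simp add: presented_alg_def quot_alg_def FactRing_def ring.defs module.defs ker)
  also have "\<dots> = (\<lambda>p. cls E X 0 +>\<^bsub>free_alg X\<^esub> p) ` carrier (free_alg X)"
    by (auto simp: A_RCOSETS_def')
  also have "\<dots> = cls E X ` img E X"
    by (simp add: cls_coset img_def image_image cong: image_cong)
  finally show ?thesis .
qed

lemma one_B: "\<one>\<^bsub>B\<^esub> = cls E X 1"
  by (simp add: presented_alg_def quot_alg_def FactRing_def ring.defs module.defs ker cls_coset
    free_alg_intros)

lemma zero_B: "\<zero>\<^bsub>B\<^esub> = cls E X 0"
  by (simp add: presented_alg_def quot_alg_def FactRing_def ring.defs module.defs ker)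

lemma add_B:
  assumes "c \<in> img E X" "d \<in> img E X"
  shows "cls E X c \<oplus>\<^bsub>B\<^esub> cls E X d = cls E X (c + d)"
proof -
  from assms(1) obtain p where p: "p \<in> carrier (free_alg X)" "ev E p = c" by (auto simp: img_def)
  have "x \<in> (\<Union>h\<in>cls E X c. \<Union>k\<in>cls E X d. {h + k})" if "x \<in> cls E X (c + d)" for x
  proof -
    have "p \<in> cls E X c" "x - p \<in> cls E X d"
      using that p by (auto simp: cls_def ev_diff free_alg_intros)
    moreover have "x = p + (x - p)" by simp
    ultimately show ?thesis by blast
  qed
  then have "(\<Union>h\<in>cls E X c. \<Union>k\<in>cls E X d. {h + k}) = cls E X (c + d)"
    by (auto simp: cls_def ev_add free_alg_intros)
  then show ?thesis
    by (simp add: presented_alg_def quot_alg_def FactRing_def ring.defs module.defs set_add_def')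
qed

lemma mult_B:
  assumes "c \<in> img E X" "d \<in> img E X"
  shows "cls E X c \<otimes>\<^bsub>B\<^esub> cls E X d = cls E X (c * d)"
proof -
  from assms obtain p r where p: "p \<in> carrier (free_alg X)" "ev E p = c"
    and r: "r \<in> carrier (free_alg X)" "ev E r = d" by (auto simp: img_def)
  have "cls E X 0 +>\<^bsub>free_alg X\<^esub> (a * b) = cls E X (c * d)" if "a \<in> cls E X c" "b \<in> cls E X d" for a b
    using that by (auto simp: cls_def[of E X c] cls_def[of E X d] cls_coset free_alg_intros ev_mult)
  then have "(\<Union>a\<in>cls E X c. \<Union>b\<in>cls E X d. cls E X 0 +>\<^bsub>free_alg X\<^esub> (a * b)) = cls E X (c * d)"
    using p r by (force simp: cls_def)
  then show ?thesis
    by (simp add: presented_alg_def quot_alg_def FactRing_def ring.defs module.defs ker rcoset_mult_def)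
qed

lemma smult_B:
  assumes "c \<in> img E X"
  shows "k \<odot>\<^bsub>B\<^esub> cls E X c = cls E X (sc k * c)"
proof -
  from assms obtain p where p: "p \<in> carrier (free_alg X)" "ev E p = c" by (auto simp: img_def)
  have "cls E X 0 +>\<^bsub>free_alg X\<^esub> (scalar k * a) = cls E X (sc k * c)" if "a \<in> cls E X c" for a
    using that by (auto simp: cls_def[of E X c] cls_coset free_alg_intros ev_mult)
  then have "(\<Union>a\<in>cls E X c. cls E X 0 +>\<^bsub>free_alg X\<^esub> (scalar k * a)) = cls E X (sc k * c)"
    using p by (force simp: cls_def)
  then show ?thesis
    by (simp add: presented_alg_def quot_alg_def FactRing_def ring.defs module.defs ker)
qed

lemmas ops_B = one_B zero_B add_B mult_B smult_B

lemma ring_B: "ring B"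
proof (rule ringI)
  show "abelian_group B"
  proof (rule abelian_groupI)
    show "\<exists>y\<in>carrier B. y \<oplus>\<^bsub>B\<^esub> x = \<zero>\<^bsub>B\<^esub>" if "x \<in> carrier B" for x
    proof -
      from that obtain c where "c \<in> img E X" "x = cls E X c" by (auto simp: carrier_B)
      then show ?thesis
        by (intro bexI[of _ "cls E X (- c)"]) (auto simp: carrier_B ops_B img_closed)
    qed
  qed (auto simp: carrier_B ops_B img_closed add_ac)
  show "Group.monoid B"
    by (rule monoidI) (auto simp: carrier_B ops_B img_closed mult.assoc)
qed (auto simp: carrier_B ops_B img_closed algebra_simps)

lemma uminus_B:
  assumes "c \<in> img E X"
  shows "\<ominus>\<^bsub>B\<^esub> cls E X c = cls E X (- c)"
  using assms by (intro abelian_group.minus_equality[OF ring.is_abelian_group[OF ring_B]])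
    (auto simp: carrier_B ops_B img_closed)

lemma presented_gen_B: "x \<in> X \<Longrightarrow> presented_gen X S x = cls E X (E x)"
  by (simp add: presented_gen_def ker cls_coset free_alg_intros)

end

text \<open>Both algebras are copies of the operators in \<open>img E X\<close>: the quotient
  through the fibres of \<open>E\<close>, the subalgebra through the fibres of \<open>G\<close>.
  What has to be computed is the generated subalgebra, an intersection by definition.\<close>

lemma presented_alg_iso_gen_subalg:
  assumes "faithful_presentation X S E" and "faithful_presentation Y U G"
    and gens: "\<And>x. x \<in> X \<Longrightarrow> E x \<in> img G Y" "\<And>x. x \<in> X \<Longrightarrow> g x = cls G Y (E x)"
  shows "\<exists>\<phi>. \<phi> \<in> alg_iso (presented_alg X S) (gen_subalg (presented_alg Y U) (g ` X))
    \<and> (\<forall>x\<in>X. \<phi> (presented_gen X S x) = g x)"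
proof -
  interpret A: faithful_presentation X S E by fact
  interpret B: faithful_presentation Y U G by fact
  interpret RB: ring "presented_alg Y U" by (rule B.ring_B)
  have word: "prod_list (map E xs) \<in> img G Y" if "set xs \<subseteq> X" for xs
    using that by (induction xs) (auto simp: img_closed gens)
  have sub: "c \<in> img G Y" if "c \<in> img E X" for c
  proof -
    have "ev E p \<in> img G Y" if "p \<in> carrier (free_alg X)" for p
      using that by (induction rule: free_alg_induct) (auto simp: ev_add ev_single img_closed word)
    with that show ?thesis by (auto simp: img_def[of E])
  qed
  let ?C = "cls G Y ` img E X"
  have "subalgebra_of ?C (presented_alg Y U)"
    unfolding subalgebra_of_def
  proof (intro conjI RB.subringI)
    show "\<ominus>\<^bsub>presented_alg Y U\<^esub> h \<in> ?C" if "h \<in> ?C" for h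
      using that by (auto simp: B.uminus_B sub img_closed)
  qed (auto simp: B.ops_B B.carrier_B sub img_closed)
  moreover have "g ` X \<subseteq> ?C"
    using gens by (auto simp: img_closed)
  \<comment> \<open>Minimality: a subalgebra with the generators contains the fibre over the value
    of each word, by induction on the word, and then the fibre over each linear combination.\<close>
  moreover have "?C \<subseteq> D" if D: "subalgebra_of D (presented_alg Y U)" "g ` X \<subseteq> D" for D
  proof -
    have D': "subring D (presented_alg Y U)" and smul: "\<And>c b. b \<in> D \<Longrightarrow> c \<odot>\<^bsub>presented_alg Y U\<^esub> b \<in> D"
      using D(1) by (auto simp: subalgebra_of_def)
    have clD: "cls G Y 0 \<in> D" "cls G Y 1 \<in> D"
      "\<And>c d. c \<in> img G Y \<Longrightarrow> d \<in> img G Y \<Longrightarrow> cls G Y c \<in> D \<Longrightarrow> cls G Y d \<in> D \<Longrightarrow> cls G Y (c + d) \<in> D"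
      "\<And>c d. c \<in> img G Y \<Longrightarrow> d \<in> img G Y \<Longrightarrow> cls G Y c \<in> D \<Longrightarrow> cls G Y d \<in> D \<Longrightarrow> cls G Y (c * d) \<in> D"
      "\<And>k c. c \<in> img G Y \<Longrightarrow> cls G Y c \<in> D \<Longrightarrow> cls G Y (sc k * c) \<in> D"
      using subringE(2,3,6,7)[OF D'] smul by (metis B.ops_B)+
    have wordD: "cls G Y (prod_list (map E xs)) \<in> D" if "set xs \<subseteq> X" for xs
      using that
    proof (induction xs)
      case (Cons x xs)
      moreover have "cls G Y (E x) \<in> D" using Cons D(2) gens(2) by force
      ultimately show ?case using word gens by (simp add: clD)
    qed (simp add: clD)
    have "cls G Y (ev E p) \<in> D" if "p \<in> carrier (free_alg X)" for p
      using that
    proof (induction rule: free_alg_induct)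
      case (step xs c p)
      have "ev E p \<in> img G Y" using sub step by (simp add: img_def)
      with step show ?case by (simp add: ev_add ev_single clD word wordD img_closed)
    qed (simp add: clD)
    then show ?thesis by (auto simp: img_def[of E])
  qed
  ultimately have "(\<Inter>{D. subalgebra_of D (presented_alg Y U) \<and> g ` X \<subseteq> D}) = ?C"
    by blast
  then have gs: "gen_subalg (presented_alg Y U) (g ` X) = presented_alg Y U\<lparr>carrier := ?C\<rparr>"
    by (simp add: gen_subalg_def)
  \<comment> \<open>Going through values avoids a choice of representatives: a coset with value
    \<open>c\<close> is sent to the whole fibre over \<open>c\<close> of the other
    evaluation.\<close>
  define \<phi> where "\<phi> C = {r \<in> carrier (free_alg Y). \<exists>p\<in>C. ev G r = ev E p}" for C
  have \<phi>: "\<phi> (cls E X c) = cls G Y c" if "c \<in> img E X" for c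
    using that by (auto simp: \<phi>_def cls_def img_def)
  have "bij_betw \<phi> (cls E X ` img E X) ?C"
    unfolding bij_betw_def
  proof
    show "inj_on \<phi> (cls E X ` img E X)"
    proof (rule inj_onI)
      fix x y assume "x \<in> cls E X ` img E X" "y \<in> cls E X ` img E X" and eq: "\<phi> x = \<phi> y"
      then obtain c d where cd: "c \<in> img E X" "x = cls E X c" "d \<in> img E X" "y = cls E X d" by auto
      then have "c = d"
        using eq \<phi> sub inj_onD[OF cls_inj_on[of G Y], of c d] by simp
      with cd show "x = y" by simp
    qed
    show "\<phi> ` cls E X ` img E X = ?C" by (simp add: image_image \<phi> cong: image_cong)
  qed
  then have "\<phi> \<in> alg_iso (presented_alg X S) (gen_subalg (presented_alg Y U) (g ` X))"
    unfolding gs alg_iso_def ring_iso_def ring_hom_def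
    by (auto simp: A.carrier_B A.ops_B B.ops_B \<phi> img_closed sub)
  moreover have "\<forall>x\<in>X. \<phi> (presented_gen X S x) = g x"
    by (simp add: A.presented_gen_B \<phi> img_closed gens)
  ultimately show ?thesis by blast
qed

section \<open>Restoring one quantum relation\<close>

text \<open>Scalars get an operation of their own, so that rewriting to normal order does not
  mistake \<open>sc c\<close> for a factor to be sorted.\<close>

definition smul :: "'k \<Rightarrow> ('i, 'k::field) lop \<Rightarrow> ('i, 'k) lop" (infixr "\<cdot>" 75) where
  "c \<cdot> A = sc c * A"

lemma smul_simps:
  "(c \<cdot> A) * B = c \<cdot> (A * B)" "A * (c \<cdot> B) = c \<cdot> (A * B)" "c \<cdot> (d \<cdot> A) = (c * d) \<cdot> A"
  "c \<cdot> (A + B) = c \<cdot> A + c \<cdot> B" "c \<cdot> (A - B) = c \<cdot> A - c \<cdot> B" "1 \<cdot> A = A" "0 \<cdot> A = 0"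
  "(c + d) \<cdot> A = c \<cdot> A + d \<cdot> A" "(c - d) \<cdot> A = c \<cdot> A - d \<cdot> A"
proof -
  show "A * (c \<cdot> B) = c \<cdot> (A * B)" by (simp only: smul_def sc_left_commute)
qed (simp_all add: smul_def sc_mult sc_add sc_diff distrib_left distrib_right left_diff_distrib
  right_diff_distrib mult.assoc)

text \<open>Products are kept right-nested, so a commutation rule for \<open>x * y\<close> must also
  fire inside \<open>x * (y * v)\<close>; this produces the second form from the first.\<close>

lemma mult_right_cong: "x * y = e \<Longrightarrow> x * (y * v) = e * (v :: 'a :: semigroup_mult)"
  by (metis mult.assoc)

lemmas normal_order = distrib_left distrib_right mult.assoc smul_simps left_diff_distrib
  right_diff_distrib

text \<open>
  The letters name entries of the matrix \<open>x\<close> before the step with pivot \<open>z = x\<^sub>r\<^sub>s\<close> and \<open>w = z\<^sup>-\<^sup>1\<close>: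
  for \<open>i < k < r\<close> and \<open>j < l < s\<close>, the rows \<open>i, k, r\<close> and columns \<open>j, l, s\<close> of \<open>x\<close> form
  \<open>[a b \<alpha>; c d \<gamma>; \<beta> \<delta> z]\<close>. The hypotheses are oriented as rewrite rules to the normal order
  \<open>\<gamma>, \<alpha>, \<delta>, \<beta>, w, d, c, b, a\<close>.
\<close>

context
  fixes q :: "'k::field" and w z \<alpha> \<beta> \<gamma> \<delta> a b c d :: "('i, 'k) lop"
  assumes q: "q \<noteq> 0"
begin

lemma inv_q [simp]: "q * (inverse q * x) = x" "inverse q * (q * x) = x"
  using q by (simp_all flip: mult.assoc)

text \<open>As in most of the lemmas that follow, the hypotheses form a rewrite system that sorts
  every product that occurs; after sorting, both sides are the same combination of ordered
  monomials.\<close>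

lemma restore_row:
  assumes "a * b = q \<cdot> (b * a)" "a * \<alpha> = q \<cdot> (\<alpha> * a)" "b * \<alpha> = q \<cdot> (\<alpha> * b)"
    "a * \<beta> = q \<cdot> (\<beta> * a)" "b * \<delta> = q \<cdot> (\<delta> * b)" "\<beta> * \<delta> = q \<cdot> (\<delta> * \<beta>)"
    "b * \<beta> = \<beta> * b" "a * \<delta> = \<delta> * a + (q - inverse q) \<cdot> (b * \<beta>)"
    "\<beta> * \<alpha> = \<alpha> * \<beta>" "\<delta> * \<alpha> = \<alpha> * \<delta>"
    "w * \<alpha> = q \<cdot> (\<alpha> * w)" "w * \<beta> = q \<cdot> (\<beta> * w)" "w * \<delta> = q \<cdot> (\<delta> * w)" "a * w = w * a" "b * w = w * b"
  shows "(a + \<alpha> * w * \<beta>) * (b + \<alpha> * w * \<delta>) = q \<cdot> ((b + \<alpha> * w * \<delta>) * (a + \<alpha> * w * \<beta>))"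
  by (simp add: assms assms[THEN mult_right_cong] normal_order q)

lemma restore_col:
  assumes "a * c = q \<cdot> (c * a)" "a * \<alpha> = q \<cdot> (\<alpha> * a)" "c * \<gamma> = q \<cdot> (\<gamma> * c)"
    "a * \<beta> = q \<cdot> (\<beta> * a)" "c * \<beta> = q \<cdot> (\<beta> * c)" "\<alpha> * \<gamma> = q \<cdot> (\<gamma> * \<alpha>)"
    "c * \<alpha> = \<alpha> * c" "a * \<gamma> = \<gamma> * a + (q - inverse q) \<cdot> (\<alpha> * c)"
    "\<beta> * \<alpha> = \<alpha> * \<beta>" "\<beta> * \<gamma> = \<gamma> * \<beta>"
    "w * \<alpha> = q \<cdot> (\<alpha> * w)" "w * \<beta> = q \<cdot> (\<beta> * w)" "w * \<gamma> = q \<cdot> (\<gamma> * w)" "a * w = w * a" "c * w = w * c"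
  shows "(a + \<alpha> * w * \<beta>) * (c + \<gamma> * w * \<beta>) = q \<cdot> ((c + \<gamma> * w * \<beta>) * (a + \<alpha> * w * \<beta>))"
  by (simp add: assms assms[THEN mult_right_cong] normal_order q)

lemma restore_anti_diag:
  assumes "a * b = q \<cdot> (b * a)" "c * d = q \<cdot> (d * c)" "a * c = q \<cdot> (c * a)" "b * d = q \<cdot> (d * b)"
    "b * c = c * b" "a * d = d * a + (q - inverse q) \<cdot> (b * c)"
    "a * \<alpha> = q \<cdot> (\<alpha> * a)" "b * \<alpha> = q \<cdot> (\<alpha> * b)" "c * \<gamma> = q \<cdot> (\<gamma> * c)" "d * \<gamma> = q \<cdot> (\<gamma> * d)"
    "a * \<beta> = q \<cdot> (\<beta> * a)" "c * \<beta> = q \<cdot> (\<beta> * c)" "b * \<delta> = q \<cdot> (\<delta> * b)" "d * \<delta> = q \<cdot> (\<delta> * d)"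
    "\<alpha> * \<gamma> = q \<cdot> (\<gamma> * \<alpha>)" "\<beta> * \<delta> = q \<cdot> (\<delta> * \<beta>)"
    "c * \<alpha> = \<alpha> * c" "d * \<alpha> = \<alpha> * d" "b * \<beta> = \<beta> * b" "d * \<beta> = \<beta> * d"
    "a * \<gamma> = \<gamma> * a + (q - inverse q) \<cdot> (\<alpha> * c)" "b * \<gamma> = \<gamma> * b + (q - inverse q) \<cdot> (\<alpha> * d)"
    "a * \<delta> = \<delta> * a + (q - inverse q) \<cdot> (b * \<beta>)" "c * \<delta> = \<delta> * c + (q - inverse q) \<cdot> (d * \<beta>)"
    "\<beta> * \<alpha> = \<alpha> * \<beta>" "\<beta> * \<gamma> = \<gamma> * \<beta>" "\<delta> * \<alpha> = \<alpha> * \<delta>" "\<delta> * \<gamma> = \<gamma> * \<delta>"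
    "w * \<alpha> = q \<cdot> (\<alpha> * w)" "w * \<beta> = q \<cdot> (\<beta> * w)" "w * \<gamma> = q \<cdot> (\<gamma> * w)" "w * \<delta> = q \<cdot> (\<delta> * w)"
    "a * w = w * a" "b * w = w * b" "c * w = w * c" "d * w = w * d"
  shows "(b + \<alpha> * w * \<delta>) * (c + \<gamma> * w * \<beta>) = (c + \<gamma> * w * \<beta>) * (b + \<alpha> * w * \<delta>)"
    and "(a + \<alpha> * w * \<beta>) * (d + \<gamma> * w * \<delta>) = (d + \<gamma> * w * \<delta>) * (a + \<alpha> * w * \<beta>)
      + (q - inverse q) \<cdot> ((b + \<alpha> * w * \<delta>) * (c + \<gamma> * w * \<beta>))"
  by (simp_all add: assms assms[THEN mult_right_cong] normal_order q)

lemma restore_with_col: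
  assumes "a * \<alpha> = q \<cdot> (\<alpha> * a)" "w * \<alpha> = q \<cdot> (\<alpha> * w)" "\<beta> * \<alpha> = \<alpha> * \<beta>"
  shows "(a + \<alpha> * w * \<beta>) * \<alpha> = q \<cdot> (\<alpha> * (a + \<alpha> * w * \<beta>))"
  by (simp add: assms assms[THEN mult_right_cong] normal_order q)

lemma restore_with_row:
  assumes "a * \<beta> = q \<cdot> (\<beta> * a)" "w * \<beta> = q \<cdot> (\<beta> * w)" "\<beta> * \<alpha> = \<alpha> * \<beta>"
  shows "(a + \<alpha> * w * \<beta>) * \<beta> = q \<cdot> (\<beta> * (a + \<alpha> * w * \<beta>))"
  by (simp add: assms assms[THEN mult_right_cong] normal_order q)

lemma restore_anti_row:
  assumes "b * \<beta> = \<beta> * b" "w * \<beta> = q \<cdot> (\<beta> * w)" "w * \<delta> = q \<cdot> (\<delta> * w)" "\<beta> * \<delta> = q \<cdot> (\<delta> * \<beta>)" "\<beta> * \<alpha> = \<alpha> * \<beta>"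
  shows "(b + \<alpha> * w * \<delta>) * \<beta> = \<beta> * (b + \<alpha> * w * \<delta>)"
  by (simp add: assms assms[THEN mult_right_cong] normal_order q)

lemma restore_anti_col:
  assumes "c * \<alpha> = \<alpha> * c" "w * \<alpha> = q \<cdot> (\<alpha> * w)" "\<alpha> * \<gamma> = q \<cdot> (\<gamma> * \<alpha>)" "\<beta> * \<alpha> = \<alpha> * \<beta>"
  shows "\<alpha> * (c + \<gamma> * w * \<beta>) = (c + \<gamma> * w * \<beta>) * \<alpha>"
  by (simp add: assms assms[THEN mult_right_cong] normal_order q)

lemma restore_diag_col:
  assumes "a * \<gamma> = \<gamma> * a + (q - inverse q) \<cdot> (\<alpha> * c)" "\<alpha> * \<gamma> = q \<cdot> (\<gamma> * \<alpha>)"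
    "w * \<gamma> = q \<cdot> (\<gamma> * w)" "\<beta> * \<gamma> = \<gamma> * \<beta>"
  shows "(a + \<alpha> * w * \<beta>) * \<gamma> = \<gamma> * (a + \<alpha> * w * \<beta>) + (q - inverse q) \<cdot> (\<alpha> * (c + \<gamma> * w * \<beta>))"
  by (simp add: assms assms[THEN mult_right_cong] normal_order q)

lemma restore_diag_row:
  assumes "a * \<delta> = \<delta> * a + (q - inverse q) \<cdot> (b * \<beta>)" "\<beta> * \<delta> = q \<cdot> (\<delta> * \<beta>)"
    "w * \<delta> = q \<cdot> (\<delta> * w)" "w * \<beta> = q \<cdot> (\<beta> * w)" "\<delta> * \<alpha> = \<alpha> * \<delta>" 
  shows "(a + \<alpha> * w * \<beta>) * \<delta> = \<delta> * (a + \<alpha> * w * \<beta>) + (q - inverse q) \<cdot> ((b + \<alpha> * w * \<delta>) * \<beta>)"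
  by (simp add: assms assms[THEN mult_right_cong] normal_order q)

text \<open>Here a new quantum relation is created. In \<open>\<alpha> * w * \<beta> * z\<close> the
  pivot passes \<open>\<beta>\<close> with factor \<open>q\<close> before it cancels
  \<open>w\<close>; in \<open>z * \<alpha> * w * \<beta>\<close> it passes \<open>\<alpha>\<close>
  with factor \<open>inverse q\<close>. The difference of the two is the extra term.\<close>

lemma restore_diag_pivot:
  assumes "a * z = z * a" "\<alpha> * z = q \<cdot> (z * \<alpha>)" "\<beta> * z = q \<cdot> (z * \<beta>)" "w * z = 1" "z * w = 1"
  shows "(a + \<alpha> * w * \<beta>) * z = z * (a + \<alpha> * w * \<beta>) + (q - inverse q) \<cdot> (\<alpha> * \<beta>)"
proof -
  have "z * \<alpha> = inverse q \<cdot> (\<alpha> * z)"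
    using q by (simp add: assms normal_order)
  then have 1: "z * (\<alpha> * (w * \<beta>)) = inverse q \<cdot> (\<alpha> * \<beta>)"
    using assms(5)[THEN mult_right_cong, of \<beta>]
    by (simp add: mult_right_cong[OF \<open>z * \<alpha> = _\<close>] smul_simps mult.assoc)
  have 2: "\<alpha> * (w * (\<beta> * z)) = q \<cdot> (\<alpha> * \<beta>)"
    using assms(4)[THEN mult_right_cong, of \<beta>] by (simp add: normal_order assms(3))
  show ?thesis
    by (simp add: distrib_left distrib_right mult.assoc 1 2 assms(1)) (simp add: normal_order)
qed

text \<open>The entry \<open>d\<close> need not commute with each factor of the correction; the
  scalars picked up at the column entry, the inverse pivot and the row entry only have to
  cancel.\<close>

lemma restore_commute:
  assumes "a * d = d * a" "\<alpha> * d = u \<cdot> (d * \<alpha>)" "w * d = v \<cdot> (d * w)" "\<beta> * d = y \<cdot> (d * \<beta>)" "u * v * y = 1"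
  shows "(a + \<alpha> * w * \<beta>) * d = d * (a + \<alpha> * w * \<beta>)"
proof -
  have "y * (v * u) = 1" using assms(5) by (simp add: ac_simps)
  then show ?thesis
    by (simp add: assms(1-4) assms(1-4)[THEN mult_right_cong] normal_order)
qed

lemma restore_scaled_commute:
  assumes "a * d = u \<cdot> (d * a)" "\<alpha> * d = u \<cdot> (d * \<alpha>)" "w * d = d * w" "\<beta> * d = d * \<beta>"
  shows "(a + \<alpha> * w * \<beta>) * d = u \<cdot> (d * (a + \<alpha> * w * \<beta>))"
  by (simp add: assms assms[THEN mult_right_cong] normal_order)

lemma restore_scaled_commute':
  assumes "a * d = u \<cdot> (d * a)" "\<alpha> * d = d * \<alpha>" "w * d = d * w" "\<beta> * d = u \<cdot> (d * \<beta>)"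
  shows "(a + \<alpha> * w * \<beta>) * d = u \<cdot> (d * (a + \<alpha> * w * \<beta>))"
  by (simp add: assms assms[THEN mult_right_cong] normal_order)

text \<open>Here \<open>d\<close> stands to the right of the pivot column and keeps its value, while
  \<open>a\<close> and \<open>\<alpha>\<close> both have quantum relations with it. The two extra
  terms combine to the restored entry below \<open>a\<close>.\<close>

lemma restore_diag_right:
  assumes "a * d = d * a + (q - inverse q) \<cdot> (b * c)" "\<alpha> * d = d * \<alpha> + (q - inverse q) \<cdot> (b * \<gamma>)"
    "w * d = d * w" "\<beta> * d = d * \<beta>"
  shows "(a + \<alpha> * w * \<beta>) * d = d * (a + \<alpha> * w * \<beta>) + (q - inverse q) \<cdot> (b * (c + \<gamma> * w * \<beta>))"
  by (simp add: assms assms[THEN mult_right_cong] normal_order)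

end

text \<open>Insert \<open>z * w\<close> behind \<open>y\<close> and cancel \<open>w * z\<close>. The
  three forms fit entries before the pivot in its row or column, entries after it, and entries that
  commute with it.\<close>

lemma inverse_commute:
  assumes "w * z = 1" "z * w = (1 :: ('i, 'k::field) lop)"
  shows "y * z = u \<cdot> (z * y) \<Longrightarrow> w * y = u \<cdot> (y * w)"
    and "z * y = u \<cdot> (y * z) \<Longrightarrow> u \<noteq> 0 \<Longrightarrow> w * y = inverse u \<cdot> (y * w)"
    and "z * y = y * z \<Longrightarrow> w * y = y * w"
proof -
  have *: "w * y = u \<cdot> (y * w)" if "y * z = u \<cdot> (z * y)" for u y
  proof -
    have "w * y = w * ((y * z) * w)" using assms(2) by (simp add: mult.assoc)
    also have "\<dots> = u \<cdot> ((w * z) * (y * w))" by (simp only: that smul_simps mult.assoc)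
    finally show ?thesis using assms(1) by simp
  qed
  show "w * y = u \<cdot> (y * w)" if "y * z = u \<cdot> (z * y)"
    using * that .
  show "w * y = inverse u \<cdot> (y * w)" if "z * y = u \<cdot> (y * z)" "u \<noteq> 0"
    using that by (intro *) (simp add: smul_simps)
  show "w * y = y * w" if "z * y = y * z"
    using *[of y 1] that by (simp add: smul_simps)
qed

text \<open>The relations of \<open>q_relations\<close> for operators, sorted by pairs of entries
  instead of submatrices, so that each row or column relation is treated once.\<close>

definition q_commuting :: "nat \<Rightarrow> nat \<Rightarrow> 'k \<Rightarrow> (coord \<Rightarrow> bool) \<Rightarrow> (coord \<Rightarrow> ('i, 'k::field) lop) \<Rightarrow> bool" where
  "q_commuting m n q P x \<longleftrightarrow>
    (\<forall>i j l. 1 \<le> i \<and> i \<le> m \<and> 1 \<le> j \<and> j < l \<and> l \<le> n \<longrightarrow> x (i, j) * x (i, l) = q \<cdot> (x (i, l) * x (i, j))) \<and>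
    (\<forall>i k j. 1 \<le> i \<and> i < k \<and> k \<le> m \<and> 1 \<le> j \<and> j \<le> n \<longrightarrow> x (i, j) * x (k, j) = q \<cdot> (x (k, j) * x (i, j))) \<and>
    (\<forall>i k j l. 1 \<le> i \<and> i < k \<and> k \<le> m \<and> 1 \<le> j \<and> j < l \<and> l \<le> n \<longrightarrow>
      x (i, l) * x (k, j) = x (k, j) * x (i, l) \<and>
      x (i, j) * x (k, l) = (if P (k, l) then x (k, l) * x (i, j) + (q - inverse q) \<cdot> (x (i, l) * x (k, j))
        else x (k, l) * x (i, j)))"

text \<open>One step of Cauchon's restoration algorithm, with pivot \<open>(r, s)\<close>.\<close>

definition restore :: "nat \<Rightarrow> nat \<Rightarrow> ('i, 'k) lop \<Rightarrow> (coord \<Rightarrow> ('i, 'k::field) lop) \<Rightarrow> coord \<Rightarrow> ('i, 'k) lop" where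
  "restore r s w x = (\<lambda>(i, j). if i < r \<and> j < s then x (i, j) + x (i, s) * w * x (r, j) else x (i, j))"

text \<open>The two predicates differ only at \<open>(r, s)\<close>: the pivot commutes with the
  entries above and to the left of it before the step, and satisfies quantum relations with them
  afterwards. All other relations have to be preserved, case by case according to the position
  relative to the pivot.\<close>

theorem q_commuting_restore:
  fixes x :: "coord \<Rightarrow> ('i, 'k::field) lop"
  assumes x: "q_commuting m n q (\<lambda>(k, l). k < r \<or> k = r \<and> l < s) x"
    and q: "q \<noteq> 0" and rs: "1 \<le> r" "r \<le> m" "1 \<le> s" "s \<le> n"
    and w: "w * x (r, s) = 1" "x (r, s) * w = 1"
  shows "q_commuting m n q (\<lambda>(k, l). k < r \<or> k = r \<and> l \<le> s) (restore r s w x)"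
proof -
  have row: "x (i, j) * x (i, l) = q \<cdot> (x (i, l) * x (i, j))"
    if "1 \<le> i" "i \<le> m" "1 \<le> j" "j < l" "l \<le> n" for i j l
    using x that unfolding q_commuting_def by blast
  have col: "x (i, j) * x (k, j) = q \<cdot> (x (k, j) * x (i, j))"
    if "1 \<le> i" "i < k" "k \<le> m" "1 \<le> j" "j \<le> n" for i j k
    using x that unfolding q_commuting_def by blast
  have anti: "x (i, l) * x (k, j) = x (k, j) * x (i, l)"
    if "1 \<le> i" "i < k" "k \<le> m" "1 \<le> j" "j < l" "l \<le> n" for i j k l
    using x that unfolding q_commuting_def by blast
  have diag: "x (i, j) * x (k, l) = (if k < r \<or> k = r \<and> l < s
      then x (k, l) * x (i, j) + (q - inverse q) \<cdot> (x (i, l) * x (k, j)) else x (k, l) * x (i, j))"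
    if "1 \<le> i" "i < k" "k \<le> m" "1 \<le> j" "j < l" "l \<le> n" for i j k l
    using x that unfolding q_commuting_def by simp
  \<comment> \<open>The conditional in \<open>diag\<close> is resolved region by region, so that the
    applicable instance can be recognised by linear arithmetic on the indices.\<close>
  have diag1: "x (i, j) * x (k, l) = x (k, l) * x (i, j) + (q - inverse q) \<cdot> (x (i, l) * x (k, j))"
    if "1 \<le> i" "i < k" "k < r" "1 \<le> j" "j < l" "l \<le> n" for i j k l
    using diag[of i k j l] that rs by simp
  have diag2: "x (i, j) * x (r, l) = x (r, l) * x (i, j) + (q - inverse q) \<cdot> (x (i, l) * x (r, j))"
    if "1 \<le> i" "i < r" "1 \<le> j" "j < l" "l < s" for i j l
    using diag[of i r j l] that rs by simp
  have diag3: "x (i, j) * x (k, l) = x (k, l) * x (i, j)"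
    if "1 \<le> i" "i < k" "r < k" "k \<le> m" "1 \<le> j" "j < l" "l \<le> n" for i j k l
    using diag[of i k j l] that rs by simp
  have diag4: "x (i, j) * x (r, l) = x (r, l) * x (i, j)"
    if "1 \<le> i" "i < r" "1 \<le> j" "j < l" "l \<le> n" "s \<le> l" for i j l
    using diag[of i r j l] that rs by simp
  \<comment> \<open>How \<open>w\<close> passes an entry: with factor \<open>q\<close> above the
    pivot in its column and left of it in its row, with \<open>inverse q\<close> below and right of
    it, and freely in the four quadrants.\<close>
  have w1: "w * x (i, s) = q \<cdot> (x (i, s) * w)" if "1 \<le> i" "i < r" for i
    using that rs by (intro inverse_commute[OF w] col) auto
  have w2: "w * x (r, j) = q \<cdot> (x (r, j) * w)" if "1 \<le> j" "j < s" for j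
    using that rs by (intro inverse_commute[OF w] row) auto
  have w3: "w * x (k, s) = inverse q \<cdot> (x (k, s) * w)" if "r < k" "k \<le> m" for k
    using that rs q by (intro inverse_commute[OF w] col) auto
  have w4: "w * x (r, l) = inverse q \<cdot> (x (r, l) * w)" if "s < l" "l \<le> n" for l
    using that rs q by (intro inverse_commute[OF w] row) auto
  \<comment> \<open>In this quadrant \<open>w\<close> commutes only because the diagonal relations
    that end at the pivot are still the plain ones.\<close>
  have w5: "w * x (i, j) = x (i, j) * w" if "1 \<le> i" "i < r" "1 \<le> j" "j < s" for i j
    using that rs diag4[of i j s] by (intro inverse_commute[OF w]) auto
  have w6: "w * x (i, j) = x (i, j) * w" if "1 \<le> i" "i < r" "s < j" "j \<le> n" for i j
    using that rs anti[of i r s j] by (intro inverse_commute[OF w]) auto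
  have w7: "w * x (i, j) = x (i, j) * w" if "r < i" "i \<le> m" "1 \<le> j" "j < s" for i j
    using that rs anti[of r i j s] by (intro inverse_commute[OF w]) auto
  have w8: "w * x (i, j) = x (i, j) * w" if "r < i" "i \<le> m" "s < j" "j \<le> n" for i j
    using that rs diag3[of r i s j] by (intro inverse_commute[OF w]) auto
  \<comment> \<open>Most algebraic hypotheses below are discharged by trying these rules in turn;
    \<open>linarith\<close> rejects those whose index conditions fail.\<close>
  note rels = row col anti anti[symmetric] diag1 diag2 diag3 diag4 w1 w2 w3 w4 w5 w5[symmetric] w6 w7 w8
  note rd = restore_def
  have Row: "restore r s w x (i, j) * restore r s w x (i, l) = q \<cdot> (restore r s w x (i, l) * restore r s w x (i, j))"
    if c: "1 \<le> i" "i \<le> m" "1 \<le> j" "j < l" "l \<le> n" for i j l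
  proof -
    consider "i < r" "l < s" | "i < r" "l = s" | "i < r" "j < s" "s < l" | "\<not> (i < r \<and> j < s)"
      by linarith
    then show ?thesis
    proof cases
      case 1
      have "(x (i, j) + x (i, s) * w * x (r, j)) * (x (i, l) + x (i, s) * w * x (r, l)) =
          q \<cdot> ((x (i, l) + x (i, s) * w * x (r, l)) * (x (i, j) + x (i, s) * w * x (r, j)))"
        using c 1 rs by - (rule restore_row[OF q]; (rule rels; linarith))
      then show ?thesis using c 1 by (simp add: rd)
    next
      case 2
      have "(x (i, j) + x (i, s) * w * x (r, j)) * x (i, s) =
          q \<cdot> (x (i, s) * (x (i, j) + x (i, s) * w * x (r, j)))"
        using c 2 rs by - (rule restore_with_col[OF q]; (rule rels; linarith))
      then show ?thesis using c 2 by (simp add: rd)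
    next
      case 3
      have "(x (i, j) + x (i, s) * w * x (r, j)) * x (i, l) =
          q \<cdot> (x (i, l) * (x (i, j) + x (i, s) * w * x (r, j)))"
        using c 3 rs by - (rule restore_scaled_commute[OF q]; (rule rels; linarith))
      then show ?thesis using c 3 by (simp add: rd)
    next
      case 4
      then show ?thesis using c row[of i j l] by (auto simp: rd)
    qed
  qed
  have Col: "restore r s w x (i, j) * restore r s w x (k, j) = q \<cdot> (restore r s w x (k, j) * restore r s w x (i, j))"
    if c: "1 \<le> i" "i < k" "k \<le> m" "1 \<le> j" "j \<le> n" for i j k
  proof -
    consider "j < s" "k < r" | "j < s" "k = r" | "j < s" "i < r" "r < k" | "\<not> (i < r \<and> j < s)"
      by linarith
    then show ?thesis
    proof cases
      case 1
      have "(x (i, j) + x (i, s) * w * x (r, j)) * (x (k, j) + x (k, s) * w * x (r, j)) =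
          q \<cdot> ((x (k, j) + x (k, s) * w * x (r, j)) * (x (i, j) + x (i, s) * w * x (r, j)))"
        using c 1 rs by - (rule restore_col[OF q]; (rule rels; linarith))
      then show ?thesis using c 1 by (simp add: rd)
    next
      case 2
      have "(x (i, j) + x (i, s) * w * x (r, j)) * x (r, j) =
          q \<cdot> (x (r, j) * (x (i, j) + x (i, s) * w * x (r, j)))"
        using c 2 rs by - (rule restore_with_row[OF q]; (rule rels; linarith))
      then show ?thesis using c 2 by (simp add: rd)
    next
      case 3
      have "(x (i, j) + x (i, s) * w * x (r, j)) * x (k, j) =
          q \<cdot> (x (k, j) * (x (i, j) + x (i, s) * w * x (r, j)))"
        using c 3 rs by - (rule restore_scaled_commute'[OF q]; (rule rels; linarith))
      then show ?thesis using c 3 by (simp add: rd)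
    next
      case 4
      then show ?thesis using c col[of i k j] by (auto simp: rd)
    qed
  qed
  have Anti: "restore r s w x (i, l) * restore r s w x (k, j) = restore r s w x (k, j) * restore r s w x (i, l)"
    if c: "1 \<le> i" "i < k" "k \<le> m" "1 \<le> j" "j < l" "l \<le> n" for i j k l
  proof -
    consider "k < r" "l < s" | "i < r" "l < s" "k = r" | "i < r" "l < s" "r < k"
      | "k < r" "j < s" "l = s" | "k < r" "j < s" "s < l" | "\<not> (i < r \<and> l < s)" "\<not> (k < r \<and> j < s)"
      by linarith
    then show ?thesis
    proof cases
      case 1
      have "(x (i, l) + x (i, s) * w * x (r, l)) * (x (k, j) + x (k, s) * w * x (r, j)) =
          (x (k, j) + x (k, s) * w * x (r, j)) * (x (i, l) + x (i, s) * w * x (r, l))"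
        using c 1 rs
        by - (rule restore_anti_diag(1)[OF q, where a = "x (i, j)" and d = "x (k, l)"]; (rule rels; linarith))
      then show ?thesis using c 1 by (simp add: rd)
    next
      case 2
      have "(x (i, l) + x (i, s) * w * x (r, l)) * x (r, j) = x (r, j) * (x (i, l) + x (i, s) * w * x (r, l))"
        using c 2 rs by - (rule restore_anti_row[OF q]; (rule rels; linarith))
      then show ?thesis using c 2 by (simp add: rd)
    next
      case 3
      have "x (i, s) * x (k, j) = 1 \<cdot> (x (k, j) * x (i, s))" "w * x (k, j) = 1 \<cdot> (x (k, j) * w)"
          "x (r, l) * x (k, j) = 1 \<cdot> (x (k, j) * x (r, l))"
        using c 3 rs unfolding smul_simps by - (rule rels; linarith)+
      then have "(x (i, l) + x (i, s) * w * x (r, l)) * x (k, j) = x (k, j) * (x (i, l) + x (i, s) * w * x (r, l))"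
        using c 3 by (intro restore_commute[OF q]) (auto intro: anti)
      then show ?thesis using c 3 by (simp add: rd)
    next
      case 4
      have "x (i, s) * (x (k, j) + x (k, s) * w * x (r, j)) = (x (k, j) + x (k, s) * w * x (r, j)) * x (i, s)"
        using c 4 rs by - (rule restore_anti_col[OF q]; (rule rels; linarith))
      then show ?thesis using c 4 by (simp add: rd)
    next
      case 5
      have "x (k, s) * x (i, l) = 1 \<cdot> (x (i, l) * x (k, s))" "w * x (i, l) = 1 \<cdot> (x (i, l) * w)"
          "x (r, j) * x (i, l) = 1 \<cdot> (x (i, l) * x (r, j))"
        using c 5 rs unfolding smul_simps by - (rule rels; linarith)+
      then have "(x (k, j) + x (k, s) * w * x (r, j)) * x (i, l) = x (i, l) * (x (k, j) + x (k, s) * w * x (r, j))"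
        using c 5 by (intro restore_commute[OF q]) (auto intro: anti[symmetric])
      then show ?thesis using c 5 by (simp add: rd)
    next
      case 6
      then show ?thesis using c anti[of i k j l] by (auto simp: rd)
    qed
  qed
  have Diag: "restore r s w x (i, j) * restore r s w x (k, l) = (if k < r \<or> k = r \<and> l \<le> s
      then restore r s w x (k, l) * restore r s w x (i, j)
        + (q - inverse q) \<cdot> (restore r s w x (i, l) * restore r s w x (k, j))
      else restore r s w x (k, l) * restore r s w x (i, j))"
    if c: "1 \<le> i" "i < k" "k \<le> m" "1 \<le> j" "j < l" "l \<le> n" for i j k l
  proof -
    \<comment> \<open>For \<open>(k, l)\<close> after the pivot, \<open>x (k, l)\<close> keeps its
      value and the diagonal relation stays plain, so only the scalars of the three factors must be
      supplied.\<close>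
    have comm: ?thesis if "i < r" "j < s" "r < k \<or> k = r \<and> s < l"
      "x (i, s) * x (k, l) = u \<cdot> (x (k, l) * x (i, s))" "w * x (k, l) = v \<cdot> (x (k, l) * w)"
      "x (r, j) * x (k, l) = y \<cdot> (x (k, l) * x (r, j))" "u * v * y = 1" for u v y
    proof -
      have "x (i, j) * x (k, l) = x (k, l) * x (i, j)"
        using c that(1-3) rs diag3[of i k j l] diag4[of i j l] by auto
      then have "(x (i, j) + x (i, s) * w * x (r, j)) * x (k, l) = x (k, l) * (x (i, j) + x (i, s) * w * x (r, j))"
        using that(4-7) by (rule restore_commute[OF q])
      then show ?thesis
        using that(1-3) c by (auto simp: rd)
    qed
    consider "k < r" "l < s" | "k < r" "l = s" | "k < r" "j < s" "s < l" | "k = r" "l < s"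
      | "k = r" "l = s" | "k = r" "j < s" "s < l" | "r < k" "i < r" "l < s" | "r < k" "i < r" "l = s"
      | "r < k" "i < r" "j < s" "s < l" | "\<not> (i < r \<and> j < s)"
      using c by linarith
    then show ?thesis
    proof cases
      case 1
      have "(x (i, j) + x (i, s) * w * x (r, j)) * (x (k, l) + x (k, s) * w * x (r, l)) =
          (x (k, l) + x (k, s) * w * x (r, l)) * (x (i, j) + x (i, s) * w * x (r, j))
          + (q - inverse q) \<cdot> ((x (i, l) + x (i, s) * w * x (r, l)) * (x (k, j) + x (k, s) * w * x (r, j)))"
        using c 1 rs by - (rule restore_anti_diag(2)[OF q]; (rule rels; linarith))
      then show ?thesis using c 1 by (simp add: rd)
    next
      case 2
      have "(x (i, j) + x (i, s) * w * x (r, j)) * x (k, s) = x (k, s) * (x (i, j) + x (i, s) * w * x (r, j))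
          + (q - inverse q) \<cdot> (x (i, s) * (x (k, j) + x (k, s) * w * x (r, j)))"
        using c 2 rs by - (rule restore_diag_col[OF q]; (rule rels; linarith))
      then show ?thesis using c 2 by (simp add: rd)
    next
      case 3
      have "(x (i, j) + x (i, s) * w * x (r, j)) * x (k, l) = x (k, l) * (x (i, j) + x (i, s) * w * x (r, j))
          + (q - inverse q) \<cdot> (x (i, l) * (x (k, j) + x (k, s) * w * x (r, j)))"
        using c 3 rs by - (rule restore_diag_right[OF q]; (rule rels; linarith))
      then show ?thesis using c 3 by (simp add: rd)
    next
      case 4
      have "(x (i, j) + x (i, s) * w * x (r, j)) * x (r, l) = x (r, l) * (x (i, j) + x (i, s) * w * x (r, j))
          + (q - inverse q) \<cdot> ((x (i, l) + x (i, s) * w * x (r, l)) * x (r, j))"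
        using c 4 rs by - (rule restore_diag_row[OF q]; (rule rels; linarith))
      then show ?thesis using c 4 by (simp add: rd)
    next
      case 5
      have "x (i, j) * x (r, s) = x (r, s) * x (i, j)" "x (i, s) * x (r, s) = q \<cdot> (x (r, s) * x (i, s))"
        "x (r, j) * x (r, s) = q \<cdot> (x (r, s) * x (r, j))"
        using c 5 rs by - (rule rels; linarith)+
      then have "(x (i, j) + x (i, s) * w * x (r, j)) * x (r, s) = x (r, s) * (x (i, j) + x (i, s) * w * x (r, j))
          + (q - inverse q) \<cdot> (x (i, s) * x (r, j))"
        using w by (rule restore_diag_pivot[OF q])
      then show ?thesis using c 5 by (simp add: rd)
    next
      case 6
      \<comment> \<open>Right of the pivot in its row, \<open>inverse q\<close> from
        \<open>w\<close> cancels the \<open>q\<close> from \<open>x (r, j)\<close>. Below the pivot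
        in its column (case 8), it cancels the \<open>q\<close> from
        \<open>x (i, s)\<close>.\<close>
      show ?thesis
        using c 6 rs q w4[of l] row[of r j l] diag4[of i s l]
        by (intro comm[of 1 "inverse q" q]) (auto simp: smul_simps)
    next
      case 7
      show ?thesis
        using c 7 rs w7[of k l] diag3[of r k j l] anti[of i k l s]
        by (intro comm[of 1 1 1]) (auto simp: smul_simps)
    next
      case 8
      show ?thesis
        using c 8 rs q w3[of k] diag3[of r k j l] col[of i k s]
        by (intro comm[of q "inverse q" 1]) (auto simp: smul_simps)
    next
      case 9
      show ?thesis
        using c 9 rs w8[of k l] diag3[of r k j l] diag3[of i k s l]
        by (intro comm[of 1 1 1]) (auto simp: smul_simps)
    next
      case 10
      \<comment> \<open>If \<open>x (i, j)\<close> keeps its value, so do the other three entries,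
        and \<open>(k, l)\<close> cannot be the pivot; hence the old relation is the new
        one.\<close>
      then show ?thesis using c diag[of i k j l] by (auto simp: rd)
    qed
  qed
  show ?thesis
    unfolding q_commuting_def prod.case
    by (intro conjI allI impI; elim conjE; rule Row Col Anti Diag; assumption)
qed

section \<open>The shift representation of the quantum torus\<close>

type_synonym 'k shift_op = "(coord \<Rightarrow> int, 'k) lop"

definition twist :: "nat \<Rightarrow> nat \<Rightarrow> coord \<Rightarrow> (coord \<Rightarrow> int) \<Rightarrow> int" where
  "twist m n a N = (\<Sum>l\<in>{snd a<..n}. N (fst a, l)) + (\<Sum>k\<in>{fst a<..m}. N (k, snd a))"

text \<open>Left multiplication by the power \<open>\<sigma>\<close> of t_a on formal sums of
  monomials t^N written with larger coordinates first, where \<open>v N\<close> is the coefficient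
  of t^N. The power of \<open>q\<close> comes from moving t_a past the letters to the right of it
  and below it. Sums may be infinite, which keeps the operators free of conditions on
  supports.\<close>

lift_definition shift :: "nat \<Rightarrow> nat \<Rightarrow> 'k \<Rightarrow> coord \<Rightarrow> int \<Rightarrow> 'k::field shift_op"
  is "\<lambda>m n q a \<sigma> v N. power_int q (\<sigma> * twist m n a N) * v (N(a := N a - \<sigma>))"
  by (simp add: algebra_simps)

definition twist_coeff :: "coord \<Rightarrow> coord \<Rightarrow> int" where
  "twist_coeff a b = (if fst a = fst b \<and> snd a < snd b \<or> snd a = snd b \<and> fst a < fst b then 1 else 0)"

lemma twist_upd:
  assumes "a \<in> coords m n"
  shows "twist m n b (N(a := N a - \<sigma>)) = twist m n b N - \<sigma> * twist_coeff b a"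
proof -
  obtain i j where a: "a = (i, j)" by force
  have *: "(\<Sum>l\<in>A. (N(a := N a - \<sigma>)) (f l)) = (\<Sum>l\<in>A. N (f l)) - (\<Sum>l\<in>A. if f l = a then \<sigma> else 0)"
    if "finite A" for A :: "nat set" and f
    using that by (simp add: sum_subtractf[symmetric]) (rule sum.cong; simp)
  have 1: "(\<Sum>l\<in>{snd b<..n}. if (fst b, l) = a then \<sigma> else 0)
      = (if fst b = i \<and> snd b < j then \<sigma> else 0)"
    using assms by (auto simp: a coords_def sum.If_cases Int_def conj_commute cong: conj_cong)
  have 2: "(\<Sum>k\<in>{fst b<..m}. if (k, snd b) = a then \<sigma> else 0)
      = (if snd b = j \<and> fst b < i then \<sigma> else 0)"
    using assms by (auto simp: a coords_def)
  show ?thesis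
    unfolding twist_def twist_coeff_def by (simp only: * finite_greaterThanAtMost 1 2) (auto simp: a)
qed

lemma app_smul: "app (c \<cdot> A) v N = c * app A v N"
  by (simp add: smul_def app_simps)

lemma shift_mult:
  assumes "a \<in> coords m n" "q \<noteq> 0"
  shows "app (shift m n q a \<sigma> * shift m n q b \<tau>) v N
    = power_int q (\<sigma> * twist m n a N + \<tau> * twist m n b N - \<sigma> * \<tau> * twist_coeff b a)
      * v (N(a := N a - \<sigma>, b := (N(a := N a - \<sigma>)) b - \<tau>))"
proof -
  have "\<sigma> * twist m n a N + \<tau> * twist m n b N - \<sigma> * \<tau> * twist_coeff b a
      = \<sigma> * twist m n a N + \<tau> * twist m n b (N(a := N a - \<sigma>))"
    unfolding twist_upd[OF assms(1)] by (simp only: right_diff_distrib mult.left_commute mult.assoc)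
  then show ?thesis
    by (simp only: times_lop.rep_eq shift.rep_eq power_int_add[OF disjI1[OF assms(2)]] mult.assoc)
qed

text \<open>The translations of the exponents commute, so only the powers of \<open>q\<close> have
  to be compared.\<close>

lemma shift_commute:
  assumes "a \<in> coords m n" "b \<in> coords m n" "q \<noteq> 0"
  shows "shift m n q a \<sigma> * shift m n q b \<tau>
    = power_int q (\<sigma> * \<tau> * (twist_coeff a b - twist_coeff b a)) \<cdot> (shift m n q b \<tau> * shift m n q a \<sigma>)"
proof (rule lop_eqI)
  fix v :: "(coord \<Rightarrow> int) \<Rightarrow> 'a" and N
  have "N(a := N a - \<sigma>, b := (N(a := N a - \<sigma>)) b - \<tau>) = N(b := N b - \<tau>, a := (N(b := N b - \<tau>)) a - \<sigma>)"
    by auto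
  then have 1: "v (N(a := N a - \<sigma>, b := (N(a := N a - \<sigma>)) b - \<tau>))
      = v (N(b := N b - \<tau>, a := (N(b := N b - \<tau>)) a - \<sigma>))"
    by (rule arg_cong)
  have 2: "\<sigma> * twist m n a N + \<tau> * twist m n b N - \<sigma> * \<tau> * twist_coeff b a
      = \<sigma> * \<tau> * (twist_coeff a b - twist_coeff b a)
        + (\<tau> * twist m n b N + \<sigma> * twist m n a N - \<tau> * \<sigma> * twist_coeff a b)"
    by (simp add: algebra_simps)
  show "app (shift m n q a \<sigma> * shift m n q b \<tau>) v N
    = app (power_int q (\<sigma> * \<tau> * (twist_coeff a b - twist_coeff b a)) \<cdot> (shift m n q b \<tau> * shift m n q a \<sigma>)) v N"
    unfolding app_smul shift_mult[OF assms(1,3)] shift_mult[OF assms(2,3)] 1 2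
    by (simp only: power_int_add[OF disjI1[OF assms(3)]] mult.assoc)
qed

lemma shift_inverse:
  assumes "a \<in> coords m n" "q \<noteq> 0"
  shows "shift m n q a \<sigma> * shift m n q a (- \<sigma>) = 1"
  by (rule lop_eqI) (simp add: shift_mult assms, simp add: app_simps twist_coeff_def)

lemma q_commuting_shift:
  assumes "q \<noteq> 0"
  shows "q_commuting m n q (\<lambda>_. False) (\<lambda>a. shift m n q a 1)"
proof -
  have *: "shift m n q a 1 * shift m n q b 1
      = power_int q (twist_coeff a b - twist_coeff b a) \<cdot> (shift m n q b 1 * shift m n q a 1)"
    if "a \<in> coords m n" "b \<in> coords m n" for a b
    using shift_commute[OF that assms, of 1 1] by simp
  show ?thesis
    unfolding q_commuting_def
  proof (intro conjI allI impI, goal_cases)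
    case (1 i j l)
    then show ?case
      using *[of "(i, j)" "(i, l)"] by (simp add: coords_def twist_coeff_def)
  next
    case (2 i k j)
    then show ?case
      using *[of "(i, j)" "(k, j)"] by (simp add: coords_def twist_coeff_def)
  next
    case (3 i k j l)
    then show ?case
      using *[of "(i, l)" "(k, j)"] by (simp add: coords_def twist_coeff_def smul_simps)
  next
    case (4 i k j l)
    then show ?case
      using *[of "(i, j)" "(k, l)"] by (simp add: coords_def twist_coeff_def smul_simps)
  qed
qed

section \<open>Leading terms\<close>

definition weight :: "nat \<Rightarrow> nat \<Rightarrow> (coord \<Rightarrow> int) \<Rightarrow> int" where
  "weight m n N = (\<Sum>a\<in>coords m n. int (fst a * snd a) * N a)"

lemma weight_upd:
  assumes "a \<in> coords m n"
  shows "weight m n (N(a := N a + \<sigma>)) = weight m n N + int (fst a * snd a) * \<sigma>"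
proof -
  have fin: "finite (coords m n)" by (simp add: coords_def)
  show ?thesis
    unfolding weight_def sum.remove[OF fin assms]
    by (simp add: algebra_simps)
qed

lemma weight_upd_minus:
  assumes "a \<in> coords m n"
  shows "weight m n (N(a := N a - \<sigma>)) = weight m n N - int (fst a * snd a) * \<sigma>"
  using weight_upd[OF assms, of N "- \<sigma>"] by simp

text \<open>A filtration degree: \<open>p\<close> is an upper bound, possibly negative, on the
  growth of the weights in the support. An upper bound is what adds under products and survives sums
  of operators of different degrees.\<close>

definition raises_by :: "nat \<Rightarrow> nat \<Rightarrow> int \<Rightarrow> 'k::field shift_op \<Rightarrow> bool" where
  "raises_by m n p A \<longleftrightarrow> (\<forall>v M. (\<forall>N. weight m n N \<ge> M \<longrightarrow> v N = 0)
    \<longrightarrow> (\<forall>N. weight m n N \<ge> M + p \<longrightarrow> app A v N = 0))"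

lemma raises_byD:
  "raises_by m n p A \<Longrightarrow> (\<And>N. weight m n N \<ge> M \<Longrightarrow> v N = 0) \<Longrightarrow> weight m n N \<ge> M + p \<Longrightarrow> app A v N = 0"
  unfolding raises_by_def by blast

lemma raises_by_shift:
  assumes "a \<in> coords m n"
  shows "raises_by m n (int (fst a * snd a) * \<sigma>) (shift m n q a \<sigma>)"
  unfolding raises_by_def using assms by (auto simp: shift.rep_eq weight_upd_minus)

lemma raises_by_0: "raises_by m n p 0"
  unfolding raises_by_def by (simp add: app_simps)

lemma raises_by_add: "raises_by m n p A \<Longrightarrow> raises_by m n p B \<Longrightarrow> raises_by m n p (A + B)"
  unfolding raises_by_def by (simp add: app_simps)

lemma raises_by_mult:
  assumes "raises_by m n p A" "raises_by m n r B"
  shows "raises_by m n (p + r) (A * B)"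
  unfolding raises_by_def
proof (intro allI impI)
  fix v :: "(coord \<Rightarrow> int) \<Rightarrow> 'a" and M N
  assume "\<forall>N. weight m n N \<ge> M \<longrightarrow> v N = 0" "M + (p + r) \<le> weight m n N"
  then show "app (A * B) v N = 0"
    using raises_byD[OF assms(2)] by (auto simp: app_simps intro!: raises_byD[OF assms(1), where M = "M + r"])
qed

lemma raises_by_mono: "raises_by m n p A \<Longrightarrow> p \<le> r \<Longrightarrow> raises_by m n r A"
  unfolding raises_by_def by (meson add_left_mono order_trans)

text \<open>Many exponents share a weight, so uniqueness of the top one is part of the notion:
  everything else in the support has strictly smaller weight than \<open>D\<close>.\<close>

definition leads_at :: "nat \<Rightarrow> nat \<Rightarrow> ((coord \<Rightarrow> int) \<Rightarrow> 'k::field) \<Rightarrow> (coord \<Rightarrow> int) \<Rightarrow> bool" where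
  "leads_at m n v D \<longleftrightarrow> v D \<noteq> 0 \<and> (\<forall>N. weight m n N \<ge> weight m n D \<longrightarrow> N \<noteq> D \<longrightarrow> v N = 0)"

text \<open>The shift carries the leading exponent along, and the lower part \<open>L\<close> cannot
  reach the new weight; as weights are integers, the bound with \<open>- 1\<close> expresses strict
  inequality.\<close>

lemma leads_at_shift:
  assumes "leads_at m n v D" "a \<in> coords m n" "q \<noteq> 0"
    and L: "raises_by m n (int (fst a * snd a) * \<sigma> - 1) L"
  shows "leads_at m n (app (shift m n q a \<sigma> + L) v) (D(a := D a + \<sigma>))"
proof -
  let ?D = "D(a := D a + \<sigma>)"
  have v: "v N = 0" if "weight m n N \<ge> weight m n D + 1" for N
    using assms(1) that by (cases "N = D") (auto simp: leads_at_def)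
  have l: "app L v N = 0" if "weight m n N \<ge> weight m n ?D" for N
    using raises_byD[OF L, where v = v and M = "weight m n D + 1" and N = N] v that by (simp add: weight_upd assms(2))
  have "app (shift m n q a \<sigma>) v N = 0" if "weight m n N \<ge> weight m n ?D" "N \<noteq> ?D" for N
  proof -
    have "weight m n (N(a := N a - \<sigma>)) \<ge> weight m n D"
      using that(1) by (simp add: weight_upd weight_upd_minus assms(2))
    moreover have "N(a := N a - \<sigma>) \<noteq> D"
    proof
      assume "N(a := N a - \<sigma>) = D"
      then have "D(a := D a + \<sigma>) = N" by auto
      with that(2) show False by simp
    qed
    ultimately show ?thesis
      using assms(1) by (simp add: shift.rep_eq leads_at_def)
  qed
  moreover have "app (shift m n q a \<sigma>) v ?D \<noteq> 0"
    using assms(1,3) by (simp add: shift.rep_eq leads_at_def)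
  ultimately show ?thesis
    using l by (auto simp: leads_at_def app_simps)
qed

text \<open>The monomial 1 as a function of exponents; words are told apart by their action on
  it.\<close>

definition delta :: "(coord \<Rightarrow> int) \<Rightarrow> 'k::field" where
  "delta N = (if N = (\<lambda>_. 0) then 1 else 0)"

text \<open>Evaluate a vanishing combination at the heaviest leading exponent that has a nonzero
  coefficient. Any other word in the combination has a different leading exponent of no greater
  weight, so it contributes nothing there.\<close>

lemma leads_at_independent:
  fixes E :: "'x \<Rightarrow> 'k::field shift_op"
  assumes fin: "finite W" and inj: "inj_on D W"
    and lead: "\<And>w. w \<in> W \<Longrightarrow> leads_at m n (app (prod_list (map E w)) v) (D w)"
    and zero: "(\<Sum>w\<in>W. sc (c w) * prod_list (map E w)) = 0"
  shows "\<forall>w\<in>W. c w = 0"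
proof (rule ccontr)
  assume "\<not> ?thesis"
  then have ne: "{w\<in>W. c w \<noteq> 0} \<noteq> {}" by auto
  then have "Max ((\<lambda>w. weight m n (D w)) ` {w\<in>W. c w \<noteq> 0}) \<in> (\<lambda>w. weight m n (D w)) ` {w\<in>W. c w \<noteq> 0}"
    using fin by (intro Max_in) auto
  then obtain x where x: "x \<in> {w\<in>W. c w \<noteq> 0}"
    "Max ((\<lambda>w. weight m n (D w)) ` {w\<in>W. c w \<noteq> 0}) = weight m n (D x)"
    by blast
  then have x: "x \<in> W" "c x \<noteq> 0" "\<And>w. w \<in> W \<Longrightarrow> c w \<noteq> 0 \<Longrightarrow> weight m n (D w) \<le> weight m n (D x)"
    using fin by (auto simp flip: x(2))
  have "0 = app (\<Sum>w\<in>W. sc (c w) * prod_list (map E w)) v (D x)"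
    by (simp add: zero app_simps)
  also have "\<dots> = (\<Sum>w\<in>W. c w * app (prod_list (map E w)) v (D x))"
    by (simp add: app_sum app_simps)
  also have "\<dots> = (\<Sum>w\<in>{x}. c w * app (prod_list (map E w)) v (D x))"
  proof (rule sum.mono_neutral_right)
    show "\<forall>w\<in>W - {x}. c w * app (prod_list (map E w)) v (D x) = 0"
    proof
      fix w assume w: "w \<in> W - {x}"
      then have "D x \<noteq> D w" using inj x(1) by (auto simp: inj_on_def)
      then show "c w * app (prod_list (map E w)) v (D x) = 0"
        using x(3)[of w] lead[of w] w by (auto simp: leads_at_def)
    qed
  qed (use fin x(1) in auto)
  finally show False
    using x(2) lead[OF x(1)] by (simp add: leads_at_def)
qed

section \<open>The presentation of the quantum torus\<close>

lemma q_relations_carrier: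
  assumes "\<And>a. a \<in> coords m n \<Longrightarrow> x a \<in> carrier (free_alg X)" "(u, v) \<in> q_relations m n q P x"
  shows "u \<in> carrier (free_alg X) \<and> v \<in> carrier (free_alg X)"
  using assms(2)
  by (auto simp: q_relations_def Let_def coords_def split: if_splits intro!: free_alg_intros assms(1))

lemma q_relations_ev:
  assumes "q_commuting m n q P (\<lambda>a. ev E (x a))" "(u, v) \<in> q_relations m n q P x"
  shows "ev E u = ev E v"
proof -
  from assms(2) obtain i j k l where r: "1 \<le> i" "i < k" "k \<le> m" "1 \<le> j" "j < l" "l \<le> n"
    and uv: "(u, v) \<in> (let a = x (i, j); b = x (i, l); c = x (k, j); d = x (k, l) in
        {(a * b, scalar q * (b * a)), (c * d, scalar q * (d * c)), (a * c, scalar q * (c * a)),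
         (b * d, scalar q * (d * b)), (b * c, c * b),
         (a * d, if P (k, l) then d * a + scalar (q - inverse q) * (b * c) else d * a)})"
    unfolding q_relations_def by blast
  let ?x = "\<lambda>a. ev E (x a)"
  have r': "i \<le> m" "1 \<le> k" "j \<le> n" "1 \<le> l" using r by auto
  have "?x (i, j) * ?x (i, l) = q \<cdot> (?x (i, l) * ?x (i, j))" "?x (k, j) * ?x (k, l) = q \<cdot> (?x (k, l) * ?x (k, j))"
    "?x (i, j) * ?x (k, j) = q \<cdot> (?x (k, j) * ?x (i, j))" "?x (i, l) * ?x (k, l) = q \<cdot> (?x (k, l) * ?x (i, l))"
    "?x (i, l) * ?x (k, j) = ?x (k, j) * ?x (i, l)"
    "?x (i, j) * ?x (k, l) = (if P (k, l) then ?x (k, l) * ?x (i, j) + (q - inverse q) \<cdot> (?x (i, l) * ?x (k, j))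
        else ?x (k, l) * ?x (i, j))"
    using assms(1) r r' unfolding q_commuting_def by blast+
  with uv show ?thesis
    by (auto simp: Let_def ev_mult ev_add smul_def)
qed

text \<open>The presentation contains a row relation only as part of a submatrix, so a second row is
  required: the last one, or the first one if \<open>i\<close> is the last.\<close>

lemma q_relations_row:
  assumes "2 \<le> m" "1 \<le> i" "i \<le> m" "1 \<le> j" "j < l" "l \<le> n"
  shows "(x (i, j) * x (i, l), scalar q * (x (i, l) * x (i, j))) \<in> q_relations m n q P x"
proof (cases "i < m")
  case True
  then show ?thesis
    unfolding q_relations_def Let_def using assms by (intro UN_I[of "(i, j, m, l)"]) auto
next
  case False
  then show ?thesis
    unfolding q_relations_def Let_def using assms by (intro UN_I[of "(1, j, i, l)"]) auto
qed

lemma q_relations_col: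
  assumes "2 \<le> n" "1 \<le> i" "i < k" "k \<le> m" "1 \<le> j" "j \<le> n"
  shows "(x (i, j) * x (k, j), scalar q * (x (k, j) * x (i, j))) \<in> q_relations m n q P x"
proof (cases "j < n")
  case True
  then show ?thesis
    unfolding q_relations_def Let_def using assms by (intro UN_I[of "(i, j, k, n)"]) auto
next
  case False
  then show ?thesis
    unfolding q_relations_def Let_def using assms by (intro UN_I[of "(i, 1, k, j)"]) auto
qed

lemma q_relations_anti_diag:
  assumes "1 \<le> i" "i < k" "k \<le> m" "1 \<le> j" "j < l" "l \<le> n"
  shows "(x (i, l) * x (k, j), x (k, j) * x (i, l)) \<in> q_relations m n q P x"
    and "(x (i, j) * x (k, l), if P (k, l) then x (k, l) * x (i, j)
        + scalar (q - inverse q) * (x (i, l) * x (k, j)) else x (k, l) * x (i, j)) \<in> q_relations m n q P x"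
  unfolding q_relations_def Let_def using assms by (auto intro!: UN_I[of "(i, j, k, l)"])

lemma letter_mult: "letter a * letter b = (Poly_Mapping.single (Word [a, b]) 1 :: ('x, 'k::field) free_algebra)"
  by (simp add: letter_def mult_single plus_free_monoid_def)

section \<open>Congruence of words up to scalars modulo an ideal\<close>

locale free_ideal =
  fixes X :: "'x set" and I :: "('x, 'k::field) free_algebra set"
  assumes I: "ideal I (free_alg X)"
begin

lemmas I_closed = ideal_free_alg_closed[OF I]

text \<open>The scalar is forgotten because these congruences serve only to show spanning. It may be
  zero, so symmetry is not automatic and both directions are derived where they are used.\<close>

definition wcong :: "'x list \<Rightarrow> 'x list \<Rightarrow> bool" where
  "wcong u v \<longleftrightarrow> (\<exists>c. Poly_Mapping.single (Word u) 1 - Poly_Mapping.single (Word v) c \<in> I)"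

lemma wcongI: "Poly_Mapping.single (Word u) 1 - Poly_Mapping.single (Word v) c \<in> I \<Longrightarrow> wcong u v"
  unfolding wcong_def by blast

lemma wcong_refl: "wcong u u"
  using I_closed(1) by (intro wcongI[of u u 1]) simp

lemma wcong_flip:
  assumes "Poly_Mapping.single (Word u) 1 - Poly_Mapping.single (Word v) c \<in> I" "c \<noteq> 0"
  shows "wcong v u"
proof (rule wcongI[of v u "inverse c"])
  have "scalar (- inverse c) * (Poly_Mapping.single (Word u) 1 - Poly_Mapping.single (Word v) c) \<in> I"
    using assms(1) I_closed(3) free_alg_scalar_closed by blast
  then show "Poly_Mapping.single (Word v) 1 - Poly_Mapping.single (Word u) (inverse c) \<in> I"
    using assms(2) by (simp add: right_diff_distrib scalar_mult_single single_uminus)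
qed

lemma wcong_trans [trans]:
  assumes "wcong u v" "wcong v w"
  shows "wcong u w"
proof -
  from assms obtain c d where c: "Poly_Mapping.single (Word u) 1 - Poly_Mapping.single (Word v) c \<in> I"
    and d: "Poly_Mapping.single (Word v) 1 - Poly_Mapping.single (Word w) d \<in> I"
    by (auto simp: wcong_def)
  have "scalar c * (Poly_Mapping.single (Word v) 1 - Poly_Mapping.single (Word w) d) \<in> I"
    using d I_closed(3) free_alg_scalar_closed by blast
  from I_closed(2)[OF c this] show ?thesis
    by (intro wcongI[of u w "c * d"]) (simp add: right_diff_distrib scalar_mult_single)
qed

lemma wcong_append:
  assumes "wcong u v" "set xs \<subseteq> X" "set ys \<subseteq> X"
  shows "wcong (xs @ u @ ys) (xs @ v @ ys)"
proof -
  from assms obtain c where c: "Poly_Mapping.single (Word u) 1 - Poly_Mapping.single (Word v) c \<in> I"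
    by (auto simp: wcong_def)
  have "Poly_Mapping.single (Word xs) 1 * (Poly_Mapping.single (Word u) 1 - Poly_Mapping.single (Word v) c)
      * Poly_Mapping.single (Word ys) 1 \<in> I"
    by (intro I_closed(3,4) c free_alg_single_closed assms)
  then show ?thesis
    by (intro wcongI[of _ _ c]) (simp add: left_diff_distrib right_diff_distrib mult_single plus_free_monoid_def)
qed

text \<open>Insert a cancelling pair on the far side of \<open>y\<close>, exchange \<open>x\<close>
  with \<open>y\<close>, and cancel on the near side.\<close>

lemma wcong_commute_inverse:
  assumes inv: "wcong [x', x] []" "wcong [] [x', x]" "wcong [x, x'] []" "wcong [] [x, x']"
    and X: "x \<in> X" "x' \<in> X" "y \<in> X"
  shows "wcong [y, x] [x, y] \<Longrightarrow> wcong [x', y] [y, x']"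
    and "wcong [x, y] [y, x] \<Longrightarrow> wcong [y, x'] [x', y]"
proof -
  show "wcong [x', y] [y, x']" if "wcong [y, x] [x, y]"
  proof -
    have "wcong [x', y] [x', y, x, x']" using wcong_append[OF inv(4), of "[x', y]" "[]"] X by simp
    also have "wcong [x', y, x, x'] [x', x, y, x']" using wcong_append[OF that, of "[x']" "[x']"] X by simp
    also have "wcong [x', x, y, x'] [y, x']" using wcong_append[OF inv(1), of "[]" "[y, x']"] X by simp
    finally show ?thesis .
  qed
  show "wcong [y, x'] [x', y]" if "wcong [x, y] [y, x]"
  proof -
    have "wcong [y, x'] [x', x, y, x']" using wcong_append[OF inv(2), of "[]" "[y, x']"] X by simp
    also have "wcong [x', x, y, x'] [x', y, x, x']" using wcong_append[OF that, of "[x']" "[x']"] X by simp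
    also have "wcong [x', y, x, x'] [x', y]" using wcong_append[OF inv(3), of "[x', y]" "[]"] X by simp
    finally show ?thesis .
  qed
qed

end

section \<open>Words in the torus letters and their exponents\<close>

fun torus_inv :: "torus_letter \<Rightarrow> torus_letter" where
  "torus_inv (T a) = T_inv a"
| "torus_inv (T_inv a) = T a"

fun letter_pos :: "torus_letter \<Rightarrow> coord" where
  "letter_pos (T a) = a"
| "letter_pos (T_inv a) = a"

fun letter_sign :: "torus_letter \<Rightarrow> int" where
  "letter_sign (T a) = 1"
| "letter_sign (T_inv a) = - 1"

fun torus_degree :: "torus_letter list \<Rightarrow> coord \<Rightarrow> int" where
  "torus_degree [] = (\<lambda>_. 0)"
| "torus_degree (x # xs) = (torus_degree xs)(letter_pos x := torus_degree xs (letter_pos x) + letter_sign x)"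

lemma torus_degree_append: "torus_degree (xs @ ys) a = torus_degree xs a + torus_degree ys a"
  by (induction xs) auto

lemma torus_degree_inv: "torus_degree (rev (map torus_inv xs)) a = - torus_degree xs a"
proof (induction xs)
  case (Cons x xs)
  then show ?case by (cases x) (auto simp: torus_degree_append)
qed simp

lemma torus_degree_nonneg: "T_inv a \<notin> set xs \<Longrightarrow> torus_degree xs a \<ge> 0"
  and torus_degree_nonpos: "T a \<notin> set xs \<Longrightarrow> torus_degree xs a \<le> 0"
proof (induction xs)
  case (Cons x xs)
  {
    case 1
    with Cons show ?case by (cases x) auto
  next
    case 2
    with Cons show ?case by (cases x) auto
  }
qed simp_all

lemma torus_letters_inv [simp]: "torus_inv x \<in> torus_letters m n \<longleftrightarrow> x \<in> torus_letters m n"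
  by (cases x) (auto simp: torus_letters_def)

lemma torus_letters_iff [simp]:
  "T a \<in> torus_letters m n \<longleftrightarrow> a \<in> coords m n" "T_inv a \<in> torus_letters m n \<longleftrightarrow> a \<in> coords m n"
  by (auto simp: torus_letters_def)

definition torus_op :: "nat \<Rightarrow> nat \<Rightarrow> 'k::field \<Rightarrow> torus_letter \<Rightarrow> 'k shift_op" where
  "torus_op m n q x = shift m n q (letter_pos x) (letter_sign x)"

lemma torus_rels_carrier:
  assumes "(u, v) \<in> torus_rels m n q"
  shows "u \<in> carrier (free_alg (torus_letters m n)) \<and> v \<in> carrier (free_alg (torus_letters m n))"
  using assms unfolding torus_rels_def
proof
  assume "(u, v) \<in> q_relations m n q (\<lambda>_. False) (\<lambda>a. letter (T a))"
  then show ?thesis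
    by (intro q_relations_carrier[of m n "\<lambda>a. letter (T a)"]) (simp_all add: free_alg_letter_closed)
qed (auto intro!: free_alg_intros)

lemma torus_rels_ev:
  assumes "q \<noteq> 0" "(u, v) \<in> torus_rels m n q"
  shows "ev (torus_op m n q) u = ev (torus_op m n q) v"
  using assms(2) unfolding torus_rels_def
proof
  assume "(u, v) \<in> q_relations m n q (\<lambda>_. False) (\<lambda>a. letter (T a))"
  then show ?thesis
    by (intro q_relations_ev[of m n q "\<lambda>_. False" _ "\<lambda>a. letter (T a)"])
      (simp_all add: torus_op_def q_commuting_shift assms(1))
next
  assume "(u, v) \<in> (\<Union>a \<in> coords m n. {(letter (T a) * letter (T_inv a), 1), (letter (T_inv a) * letter (T a), 1)})"
  then show ?thesis
    using shift_inverse[OF _ assms(1), of _ m n 1] shift_inverse[OF _ assms(1), of _ m n "- 1"]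
    by (auto simp: ev_mult torus_op_def)
qed

locale torus_ideal =
  fixes m n :: nat and q :: "'k::field"
  assumes mn: "2 \<le> m" "2 \<le> n" and q: "q \<noteq> 0"
begin

sublocale free_ideal "torus_letters m n" "rel_ideal (torus_letters m n) (torus_rels m n q)"
  by (rule free_ideal.intro) (rule rel_ideal_ideal[OF torus_rels_carrier])

lemma wcong_inverse:
  assumes "x \<in> torus_letters m n"
  shows "wcong [x, torus_inv x] []" "wcong [] [x, torus_inv x]"
proof -
  have "(letter x * letter (torus_inv x), 1) \<in> torus_rels m n q"
    using assms unfolding torus_rels_def by (cases x) auto
  then have *: "Poly_Mapping.single (Word [x, torus_inv x]) 1 - Poly_Mapping.single (Word []) 1
      \<in> rel_ideal (torus_letters m n) (torus_rels m n q)"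
    using rel_ideal_rel[OF torus_rels_carrier] by (force simp: letter_mult zero_free_monoid_def simp flip: single_one)
  then show "wcong [x, torus_inv x] []" by (rule wcongI)
  show "wcong [] [x, torus_inv x]" using * by (rule wcong_flip) simp
qed

lemma wcong_relation:
  assumes "(letter x * letter y, scalar c * (letter y * letter x)) \<in> torus_rels m n q" "c \<noteq> 0"
  shows "wcong [x, y] [y, x]" "wcong [y, x] [x, y]"
proof -
  have *: "Poly_Mapping.single (Word [x, y]) 1 - Poly_Mapping.single (Word [y, x]) c
      \<in> rel_ideal (torus_letters m n) (torus_rels m n q)"
    using rel_ideal_rel[OF torus_rels_carrier assms(1)] by (simp add: letter_mult scalar_mult_single)
  then show "wcong [x, y] [y, x]" by (rule wcongI)
  show "wcong [y, x] [x, y]" using * assms(2) by (rule wcong_flip)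
qed

lemma wcong_T_T:
  assumes "a \<in> coords m n" "b \<in> coords m n"
  shows "wcong [T a, T b] [T b, T a]"
proof -
  have lt: "wcong [T (i, j), T (k, l)] [T (k, l), T (i, j)] \<and> wcong [T (k, l), T (i, j)] [T (i, j), T (k, l)]"
    if "(i, j) \<in> coords m n" "(k, l) \<in> coords m n" and ord: "i < k \<or> i = k \<and> j < l" for i j k l
  proof -
    let ?r = "\<lambda>c. (letter (T (i, j)) * letter (T (k, l)), scalar c * (letter (T (k, l)) * letter (T (i, j)))) \<in> torus_rels m n q"
    have one: "scalar 1 = (1 :: (torus_letter, 'k) free_algebra)" by (simp add: scalar_def single_one)
    consider "i = k" "j < l" | "i < k" "j = l" | "i < k" "l < j" | "i < k" "j < l"
      using ord by linarith
    then have "?r q \<or> ?r 1"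
    proof cases
      case 1
      then show ?thesis using mn that q_relations_row[of m i j l n "\<lambda>a. letter (T a)"]
        by (auto simp: torus_rels_def coords_def)
    next
      case 2
      then show ?thesis using mn that q_relations_col[of n i k m j "\<lambda>a. letter (T a)"]
        by (auto simp: torus_rels_def coords_def)
    next
      case 3
      then show ?thesis using mn that q_relations_anti_diag(1)[of i k m l j n "\<lambda>a. letter (T a)"]
        by (auto simp: torus_rels_def coords_def one)
    next
      case 4
      then show ?thesis using mn that q_relations_anti_diag(2)[of i k m j l n "\<lambda>a. letter (T a)" "\<lambda>_. False"]
        by (auto simp: torus_rels_def coords_def one)
    qed
    then show ?thesis using wcong_relation[of "T (i, j)" "T (k, l)"] q by auto
  qed
  obtain i j k l where ab: "a = (i, j)" "b = (k, l)" by force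
  consider "i < k \<or> i = k \<and> j < l" | "k < i \<or> k = i \<and> l < j" | "i = k" "j = l"
    by linarith
  then show ?thesis
    using lt[of i j k l] lt[of k l i j] assms wcong_refl[of "[T a, T b]"] unfolding ab by cases auto
qed

lemma wcong_commute:
  assumes "x \<in> torus_letters m n" "y \<in> torus_letters m n"
  shows "wcong [x, y] [y, x]"
proof -
  have inv: "wcong [T_inv a, T a] []" "wcong [] [T_inv a, T a]" "wcong [T a, T_inv a] []" "wcong [] [T a, T_inv a]"
    if "a \<in> coords m n" for a
    using wcong_inverse[of "T a"] wcong_inverse[of "T_inv a"] that by simp_all
  have 1: "wcong [T_inv a, T b] [T b, T_inv a]" "wcong [T b, T_inv a] [T_inv a, T b]"
    if "a \<in> coords m n" "b \<in> coords m n" for a b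
    using wcong_commute_inverse[OF inv[OF that(1)], of "T b"] that wcong_T_T by simp_all
  have 2: "wcong [T_inv a, T_inv b] [T_inv b, T_inv a]" if "a \<in> coords m n" "b \<in> coords m n" for a b
    using wcong_commute_inverse[OF inv[OF that(1)], of "T_inv b"] that 1 by simp
  show ?thesis
    using assms by (cases x; cases y) (simp_all add: wcong_T_T 1 2)
qed

lemma wcong_move:
  assumes "x \<in> torus_letters m n" "set u \<subseteq> torus_letters m n"
  shows "wcong (x # u) (u @ [x])"
  using assms(2)
proof (induction u)
  case Nil
  then show ?case by (simp add: wcong_refl)
next
  case (Cons y u)
  have "wcong (x # y # u) (y # x # u)"
    using wcong_append[OF wcong_commute[of x y], of "[]" u] Cons.prems assms(1) by simp
  also have "wcong (y # x # u) (y # u @ [x])"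
    using wcong_append[of "x # u" "u @ [x]" "[y]" "[]"] Cons by simp
  finally show ?case by simp
qed

text \<open>The first letter can be moved next to an inverse of itself and cancelled, which shortens
  the word and keeps its degree.\<close>

lemma wcong_degree_0:
  assumes "set u \<subseteq> torus_letters m n" "torus_degree u = (\<lambda>_. 0)"
  shows "wcong u []"
  using assms
proof (induction "length u" arbitrary: u rule: less_induct)
  case less
  show ?case
  proof (cases u)
    case Nil
    then show ?thesis by (simp add: wcong_refl)
  next
    case (Cons x w)
    have deg: "torus_degree w (letter_pos x) + letter_sign x = 0"
      using less.prems(2) Cons by (metis fun_upd_same torus_degree.simps(2))
    \<comment> \<open>Otherwise all letters at this position would have the sign of
      \<open>x\<close>, and the total exponent there could not vanish.\<close>
    have "torus_inv x \<in> set w"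
    proof (rule ccontr)
      assume "torus_inv x \<notin> set w"
      then show False
        using deg torus_degree_nonneg[of "letter_pos x" w] torus_degree_nonpos[of "letter_pos x" w]
        by (cases x) auto
    qed
    then obtain w1 w2 where w: "w = w1 @ torus_inv x # w2" by (meson split_list)
    have X: "x \<in> torus_letters m n" "set w1 \<subseteq> torus_letters m n" "set w2 \<subseteq> torus_letters m n"
      using less.prems(1) Cons w by auto
    have "wcong u (w1 @ [x, torus_inv x] @ w2)"
      using wcong_append[OF wcong_move[OF X(1,2)], of "[]" "torus_inv x # w2"] X Cons w by simp
    also have "wcong (w1 @ [x, torus_inv x] @ w2) (w1 @ [] @ w2)"
      using X by (intro wcong_append wcong_inverse)
    also have "wcong (w1 @ [] @ w2) []"
    proof (rule less.hyps)
      have "torus_degree (w1 @ w2) a = torus_degree u a" for a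
        unfolding Cons w by (cases x) (auto simp: torus_degree_append)
      then show "torus_degree (w1 @ [] @ w2) = (\<lambda>_. 0)"
        using less.prems(2) by auto
    qed (use Cons w X in auto)
    finally show ?thesis .
  qed
qed

text \<open>Append to \<open>u\<close> the formal inverse of \<open>v\<close> followed by
  \<open>v\<close>; then \<open>u\<close> together with that inverse has degree zero and
  disappears.\<close>

lemma wcong_same_degree:
  assumes "set u \<subseteq> torus_letters m n" "set v \<subseteq> torus_letters m n" "torus_degree u = torus_degree v"
  shows "wcong u v"
proof -
  have "wcong [] (rev (map torus_inv v) @ v)"
    using assms(2)
  proof (induction v)
    case (Cons y v)
    have "wcong [] (rev (map torus_inv v) @ [] @ v)" using Cons by simp
    also have "wcong (rev (map torus_inv v) @ [] @ v) (rev (map torus_inv v) @ [torus_inv y, torus_inv (torus_inv y)] @ v)"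
      using Cons.prems by (intro wcong_append wcong_inverse) auto
    also have "torus_inv (torus_inv y) = y" by (cases y) simp_all
    finally show ?case by simp
  qed (simp add: wcong_refl)
  then have "wcong (u @ [] @ []) (u @ (rev (map torus_inv v) @ v) @ [])"
    using assms(1) by (intro wcong_append) auto
  then have "wcong u ((u @ rev (map torus_inv v)) @ v)" by simp
  also have "wcong ((u @ rev (map torus_inv v)) @ v) v"
  proof -
    have "torus_degree (u @ rev (map torus_inv v)) = (\<lambda>_. 0)"
      by (rule ext) (simp add: torus_degree_append torus_degree_inv assms(3))
    then have "wcong (u @ rev (map torus_inv v)) []"
      using assms by (intro wcong_degree_0) auto
    from wcong_append[OF this, of "[]" v] show ?thesis using assms(2) by simp
  qed
  finally show ?thesis .
qed

lemma leads_at_torus_word: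
  assumes "set xs \<subseteq> torus_letters m n"
  shows "leads_at m n (app (prod_list (map (torus_op m n q) xs)) delta) (torus_degree xs)"
  using assms
proof (induction xs)
  case Nil
  then show ?case by (simp add: leads_at_def app_simps delta_def)
next
  case (Cons x xs)
  then have "letter_pos x \<in> coords m n" by (cases x) auto
  then have "leads_at m n (app (shift m n q (letter_pos x) (letter_sign x) + 0)
      (app (prod_list (map (torus_op m n q) xs)) delta)) (torus_degree (x # xs))"
    unfolding torus_degree.simps using Cons q by (intro leads_at_shift raises_by_0) auto
  then show ?case
    by (simp only: list.map prod_list.Cons torus_op_def[of m n q x] times_lop.rep_eq add_0_right)
qed

lemma torus_faithful: "faithful_presentation (torus_letters m n) (torus_rels m n q) (torus_op m n q)"
proof
  let ?X = "torus_letters m n"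
  \<comment> \<open>One word is chosen for each exponent vector. Since the choice depends on the
    degree alone, the chosen words form a transversal and take the place of an explicit normal
    order.\<close>
  define rep where "rep u = (SOME v. set v \<subseteq> ?X \<and> torus_degree v = torus_degree u)" for u
  have rep: "set (rep u) \<subseteq> ?X \<and> torus_degree (rep u) = torus_degree u" if "set u \<subseteq> ?X" for u
    unfolding rep_def by (rule someI[of _ u]) (use that in simp)
  have rep_cong: "rep u = rep v" if "torus_degree u = torus_degree v" for u v
    using that by (simp add: rep_def)
  let ?N = "rep ` {u. set u \<subseteq> ?X}"
  have inj: "inj_on torus_degree ?N"
  proof (rule inj_onI)
    fix x y assume xy: "x \<in> ?N" "y \<in> ?N" "torus_degree x = torus_degree y"
    then obtain u v where uv: "set u \<subseteq> ?X" "x = rep u" "set v \<subseteq> ?X" "y = rep v" by blast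
    then have "torus_degree u = torus_degree v" using rep xy(3) by metis
    then show "x = y" unfolding uv by (rule rep_cong)
  qed
  show "rel_ideal ?X (torus_rels m n q) = cls (torus_op m n q) ?X 0"
  proof (rule rel_ideal_eq_cls[where N = ?N])
    fix u v assume "(u, v) \<in> torus_rels m n q"
    then show "u \<in> carrier (free_alg ?X) \<and> v \<in> carrier (free_alg ?X)"
      and "ev (torus_op m n q) u = ev (torus_op m n q) v"
      using torus_rels_carrier torus_rels_ev q by blast+
  next
    fix xs assume xs: "set xs \<subseteq> ?X"
    then obtain c where "Poly_Mapping.single (Word xs) 1 - Poly_Mapping.single (Word (rep xs)) c
        \<in> rel_ideal ?X (torus_rels m n q)"
      using wcong_same_degree[of xs "rep xs"] rep[OF xs] unfolding wcong_def by auto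
    then show "\<exists>r. Poly_Mapping.keys r \<subseteq> Word ` ?N
        \<and> Poly_Mapping.single (Word xs) 1 - r \<in> rel_ideal ?X (torus_rels m n q)"
      using xs by (intro exI[of _ "Poly_Mapping.single (Word (rep xs)) c"]) auto
  next
    fix W and c :: "torus_letter list \<Rightarrow> 'k"
    assume W: "finite W" "W \<subseteq> ?N" "(\<Sum>w\<in>W. sc (c w) * prod_list (map (torus_op m n q) w)) = 0"
    show "\<forall>w\<in>W. c w = 0"
    proof (rule leads_at_independent[where D = torus_degree and v = delta, OF W(1) _ _ W(3)])
      show "inj_on torus_degree W" using inj W(2) by (rule inj_on_subset)
      show "leads_at m n (app (prod_list (map (torus_op m n q) w)) delta) (torus_degree w)" if "w \<in> W" for w
        using that W(2) rep by (intro leads_at_torus_word) auto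
    qed
  qed
qed

end

section \<open>Straightening of words in the generators\<close>

lemma not_sorted_descent:
  fixes xs :: "'a::linorder list"
  assumes "\<not> sorted xs"
  obtains u y x v where "xs = u @ [y, x] @ v" "x < y"
proof -
  from assms obtain i where i: "Suc i < length xs" "xs ! Suc i < xs ! i"
    by (auto simp: sorted_iff_nth_Suc not_le)
  have "xs = take i xs @ [xs ! i, xs ! Suc i] @ drop (Suc (Suc i)) xs"
    using id_take_nth_drop[of i xs] Cons_nth_drop_Suc[of "Suc i" xs] i(1) by simp
  with i(2) that show thesis by blast
qed

text \<open>A replacement of equal length lowers the word as soon as the first changed letter gets
  smaller, whatever happens to the second.\<close>

lemma lenlex_two_letters:
  assumes "(a, c) \<in> r"
  shows "(u @ [a, b] @ v, u @ [c, d] @ v) \<in> lenlex r"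
proof -
  have "u @ [a, b] @ v = u @ a # (b # v)" "u @ [c, d] @ v = u @ c # (d # v)"
    "length (u @ [a, b] @ v) = length (u @ [c, d] @ v)" by simp_all
  with assms show ?thesis
    unfolding lenlex_conv lex_conv by blast
qed

locale matrix_ideal =
  fixes m n :: nat and q :: "'k::field" and P :: "coord \<Rightarrow> bool"
  assumes mn: "2 \<le> m" "2 \<le> n" and q: "q \<noteq> 0"
begin

abbreviation "J \<equiv> rel_ideal (coords m n) (q_relations m n q P letter)"

lemma rels_carrier:
  "(u, v) \<in> q_relations m n q P letter \<Longrightarrow>
    u \<in> carrier (free_alg (coords m n)) \<and> v \<in> carrier (free_alg (coords m n))"
  by (rule q_relations_carrier) (simp_all add: free_alg_letter_closed)

sublocale free_ideal "coords m n" J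
  by (rule free_ideal.intro) (rule rel_ideal_ideal[OF rels_carrier])

text \<open>The term with coefficient zero is padding; it gives the one-term relations the same
  shape as the diagonal relation.\<close>

lemma straighten_scaled:
  assumes "(letter x * letter y, scalar c * (letter y * letter x)) \<in> q_relations m n q P letter" "c \<noteq> 0"
  shows "Poly_Mapping.single (Word [y, x]) 1 - (Poly_Mapping.single (Word [x, y]) (inverse c)
    + Poly_Mapping.single (Word [x, y]) 0) \<in> J"
proof -
  have "Poly_Mapping.single (Word [x, y]) 1 - Poly_Mapping.single (Word [y, x]) c \<in> J"
    using rel_ideal_rel[OF rels_carrier assms(1)] by (simp add: letter_mult scalar_mult_single)
  then have "scalar (- inverse c) * (Poly_Mapping.single (Word [x, y]) 1 - Poly_Mapping.single (Word [y, x]) c) \<in> J"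
    using I_closed(3) free_alg_scalar_closed by blast
  then show ?thesis
    using assms(2) by (simp add: right_diff_distrib scalar_mult_single single_uminus)
qed

text \<open>Termination rests on \<open>z < y\<close>: in the diagonal relation the extra word
  begins with the entry \<open>(i, l)\<close> straight above \<open>y = (k, l)\<close>, so both
  resulting words precede \<open>[y, x]\<close>.\<close>

lemma straighten_pair:
  assumes "x \<in> coords m n" "y \<in> coords m n" "x < y"
  obtains (straightened) c d z w where "z \<in> coords m n" "w \<in> coords m n" "z < y"
    "Poly_Mapping.single (Word [y, x]) 1
      - (Poly_Mapping.single (Word [x, y]) c + Poly_Mapping.single (Word [z, w]) d) \<in> J"
proof -
  obtain i j k l where xy: "x = (i, j)" "y = (k, l)" by force
  have r: "1 \<le> i" "i \<le> m" "1 \<le> j" "j \<le> n" "1 \<le> k" "k \<le> m" "1 \<le> l" "l \<le> n"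
    and ord: "i < k \<or> i = k \<and> j < l"
    using assms by (auto simp: xy coords_def)
  have one: "scalar 1 = (1 :: (coord, 'k) free_algebra)" by (simp add: scalar_def single_one)
  have scaled: thesis if "(letter x * letter y, scalar c * (letter y * letter x)) \<in> q_relations m n q P letter" "c \<noteq> 0" for c
    using straightened[OF assms(1,2,3) straighten_scaled[OF that]] .
  consider "i = k" "j < l" | "i < k" "j = l" | "i < k" "l < j" | "i < k" "j < l"
    using ord by linarith
  then show thesis
  proof cases
    case 1
    then show ?thesis using q_relations_row[of m i j l n letter q P] mn r q scaled[of q] by (simp add: xy)
  next
    case 2
    then show ?thesis using q_relations_col[of n i k m j letter q P] mn r q scaled[of q] by (simp add: xy)
  next
    case 3
    then show ?thesis using q_relations_anti_diag(1)[of i k m l j n letter q P] r scaled[of 1] by (simp add: xy one)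
  next
    case 4
    let ?p = "if P (k, l) then q - inverse q else 0"
    have "(letter x * letter y, letter y * letter x + scalar ?p * (letter (i, l) * letter (k, j)))
        \<in> q_relations m n q P letter"
      using q_relations_anti_diag(2)[of i k m j l n letter P q] r 4 by (auto simp: xy scalar_def split: if_splits)
    from rel_ideal_rel[OF rels_carrier this]
    have *: "Poly_Mapping.single (Word [x, y]) 1 - (Poly_Mapping.single (Word [y, x]) 1
        + Poly_Mapping.single (Word [(i, l), (k, j)]) ?p) \<in> J"
      by (simp only: letter_mult scalar_mult_single mult_1_right)
    have "Poly_Mapping.single (Word [y, x]) 1
      - (Poly_Mapping.single (Word [x, y]) 1 + Poly_Mapping.single (Word [(i, l), (k, j)]) (- ?p)) \<in> J"
      using I_closed(6)[OF *] by (simp add: single_uminus algebra_simps)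
    then show ?thesis
      using r 4 by (intro straightened[of "(i, l)" "(k, j)"]) (auto simp: xy coords_def)
  qed
qed

text \<open>Each step replaces a descent by words of the same length that are lexicographically
  smaller. Only spanning is obtained here; that distinct sorted words stay independent is seen in
  the representation.\<close>

lemma straighten:
  assumes "set xs \<subseteq> coords m n"
  shows "\<exists>r. Poly_Mapping.keys r \<subseteq> Word ` {ys. sorted ys \<and> set ys \<subseteq> coords m n}
    \<and> Poly_Mapping.single (Word xs) 1 - r \<in> J"
  using assms
proof (induction xs rule: wf_induct_rule[OF wf_lenlex[OF wf, where 'a1 = coord]])
  case (1 xs)
  let ?N = "Word ` {ys. sorted ys \<and> set ys \<subseteq> coords m n}"
  show ?case
  proof (cases "sorted xs")
    case True
    then show ?thesis
      using 1(2) I_closed(1) by (intro exI[of _ "Poly_Mapping.single (Word xs) 1"]) auto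
  next
    case False
    then obtain u y x v where xs: "xs = u @ [y, x] @ v" "x < y" by (rule not_sorted_descent)
    have uv: "set u \<subseteq> coords m n" "set v \<subseteq> coords m n" "x \<in> coords m n" "y \<in> coords m n"
      using 1(2) xs by auto
    obtain c d z w where zw: "z \<in> coords m n" "w \<in> coords m n" "z < y"
      and J: "Poly_Mapping.single (Word [y, x]) 1
        - (Poly_Mapping.single (Word [x, y]) c + Poly_Mapping.single (Word [z, w]) d) \<in> J"
      by (rule straighten_pair[OF uv(3,4) xs(2)])
    have IH: "\<exists>r. Poly_Mapping.keys r \<subseteq> ?N \<and> Poly_Mapping.single (Word (u @ [a, b] @ v)) 1 - r \<in> J"
      if "a < y" "a \<in> coords m n" "b \<in> coords m n" for a b
    proof (rule 1(1))
      show "(u @ [a, b] @ v, xs) \<in> lenlex {(x, y). x < y}"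
        unfolding xs(1) using that(1) by (intro lenlex_two_letters) simp
    qed (use that uv in simp)
    obtain r where r: "Poly_Mapping.keys r \<subseteq> ?N" "Poly_Mapping.single (Word (u @ [x, y] @ v)) 1 - r \<in> J"
      using IH[OF xs(2) uv(3,4)] by blast
    obtain s where s: "Poly_Mapping.keys s \<subseteq> ?N" "Poly_Mapping.single (Word (u @ [z, w] @ v)) 1 - s \<in> J"
      using IH[OF zw(3,1,2)] by blast
    have "Poly_Mapping.single (Word u) 1 * (Poly_Mapping.single (Word [y, x]) 1
        - (Poly_Mapping.single (Word [x, y]) c + Poly_Mapping.single (Word [z, w]) d))
        * Poly_Mapping.single (Word v) 1 \<in> J"
      by (intro I_closed(3,4) J free_alg_single_closed uv)
    then have 1: "Poly_Mapping.single (Word xs) 1 - (Poly_Mapping.single (Word (u @ [x, y] @ v)) c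
        + Poly_Mapping.single (Word (u @ [z, w] @ v)) d) \<in> J"
      by (simp add: xs left_diff_distrib right_diff_distrib distrib_left distrib_right mult_single plus_free_monoid_def)
    have 2: "scalar c * (Poly_Mapping.single (Word (u @ [x, y] @ v)) 1 - r)
        + scalar d * (Poly_Mapping.single (Word (u @ [z, w] @ v)) 1 - s) \<in> J"
      by (intro I_closed(2,3) r s free_alg_scalar_closed)
    have "Poly_Mapping.single (Word xs) 1 - (scalar c * r + scalar d * s) \<in> J"
      using I_closed(2)[OF 1 2] by (simp add: right_diff_distrib scalar_mult_single algebra_simps)
    moreover have "Poly_Mapping.keys (scalar c * r) \<subseteq> Poly_Mapping.keys r" for c and r :: "(coord, 'k) free_algebra"
      using keys_mult[of "scalar c" r] by (auto simp: scalar_def split: if_splits)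
    then have "Poly_Mapping.keys (scalar c * r + scalar d * s) \<subseteq> ?N"
      using r(1) s(1) Poly_Mapping.keys_add[of "scalar c * r" "scalar d * s"] by blast
    ultimately show ?thesis by blast
  qed
qed

end

fun matrix_degree :: "coord list \<Rightarrow> coord \<Rightarrow> int" where
  "matrix_degree [] = (\<lambda>_. 0)"
| "matrix_degree (x # xs) = (matrix_degree xs)(x := matrix_degree xs x + 1)"

lemma matrix_degree_count: "matrix_degree xs a = int (count (mset xs) a)"
  by (induction xs) auto

lemma inj_on_matrix_degree: "inj_on matrix_degree {xs. sorted xs}"
proof (rule inj_onI)
  fix xs ys :: "coord list"
  assume "xs \<in> {xs. sorted xs}" "ys \<in> {xs. sorted xs}" and eq: "matrix_degree xs = matrix_degree ys"
  have "mset xs = mset ys"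
  proof (rule multiset_eqI)
    fix a
    show "count (mset xs) a = count (mset ys) a"
      using fun_cong[OF eq, of a] by (simp only: matrix_degree_count of_nat_eq_iff)
  qed
  moreover have "sorted xs" "sorted ys"
    using \<open>xs \<in> _\<close> \<open>ys \<in> _\<close> by simp_all
  ultimately show "xs = ys"
    by (metis properties_for_sort)
qed

context matrix_ideal
begin

text \<open>Leading exponents add up along a word, and a sorted word is determined by its letter
  multiplicities. Hence any operators that satisfy the relations and have leading terms
  \<open>t_a\<close> form a faithful model, wherever they come from.\<close>

theorem matrix_faithful:
  assumes comm: "q_commuting m n q P E"
    and lead: "\<And>a. a \<in> coords m n \<Longrightarrow> raises_by m n (int (fst a * snd a) - 1) (E a - shift m n q a 1)"
  shows "faithful_presentation (coords m n) (q_relations m n q P letter) E"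
proof
  let ?N = "{ys. sorted ys \<and> set ys \<subseteq> coords m n}"
  have leads: "leads_at m n (app (prod_list (map E xs)) delta) (matrix_degree xs)"
    if "set xs \<subseteq> coords m n" for xs
    using that
  proof (induction xs)
    case Nil
    then show ?case by (simp add: leads_at_def app_simps delta_def)
  next
    case (Cons x xs)
    then have "leads_at m n (app (shift m n q x 1 + (E x - shift m n q x 1))
        (app (prod_list (map E xs)) delta)) (matrix_degree (x # xs))"
      unfolding matrix_degree.simps using q lead by (intro leads_at_shift) auto
    moreover have "shift m n q x 1 + (E x - shift m n q x 1) = E x" by simp
    ultimately show ?case
      by (simp only: list.map prod_list.Cons times_lop.rep_eq)
  qed
  show "J = cls E (coords m n) 0"
  proof (rule rel_ideal_eq_cls[where N = ?N])
    fix u v assume uv: "(u, v) \<in> q_relations m n q P letter"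
    show "u \<in> carrier (free_alg (coords m n)) \<and> v \<in> carrier (free_alg (coords m n))"
      by (rule rels_carrier[OF uv])
    show "ev E u = ev E v"
      using uv by (intro q_relations_ev[of m n q P E letter]) (simp_all add: comm)
  next
    fix W and c :: "coord list \<Rightarrow> 'k"
    assume W: "finite W" "W \<subseteq> ?N" "(\<Sum>w\<in>W. sc (c w) * prod_list (map E w)) = 0"
    show "\<forall>w\<in>W. c w = 0"
    proof (rule leads_at_independent[where D = matrix_degree and v = delta, OF W(1) _ _ W(3)])
      show "inj_on matrix_degree W"
        using W(2) by (intro inj_on_subset[OF inj_on_matrix_degree]) auto
      show "leads_at m n (app (prod_list (map E w)) delta) (matrix_degree w)" if "w \<in> W" for w
        using that W(2) by (intro leads) auto
    qed
  qed (rule straighten)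
qed

end

section \<open>Path sums and the restoration algorithm\<close>

context torus_ideal
begin

abbreviation t_op :: "coord \<Rightarrow> 'k shift_op" where
  "t_op a \<equiv> shift m n q a 1"

abbreviation t_inv_op :: "coord \<Rightarrow> 'k shift_op" where
  "t_inv_op a \<equiv> shift m n q a (- 1)"

text \<open>
  The weight of all continuations of a path that goes down from row \<open>m - k\<close> in column \<open>l\<close> and ends
  in column \<open>j\<close>, where \<open>Q\<close> selects the vertices at which it may turn.
\<close>

fun descent_sum :: "(coord \<Rightarrow> bool) \<Rightarrow> nat \<Rightarrow> nat \<Rightarrow> nat \<Rightarrow> 'k shift_op" where
  "descent_sum Q 0 l j = (if l = j then 1 else 0)"
| "descent_sum Q (Suc k) l j = descent_sum Q k l j
    + (if Q (m - k, l) then \<Sum>l'\<in>{1..<l}. t_inv_op (m - k, l) * t_op (m - k, l') * descent_sum Q k l' j else 0)"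

text \<open>The weights of the initial run along row \<open>i\<close> telescope to
  \<open>t_op (i, l)\<close>, where \<open>l\<close> is the column in which the path leaves the row.
  Vertices on this run are entered horizontally, so they are not turns and \<open>Q\<close> is not
  consulted.\<close>

definition path_sum :: "(coord \<Rightarrow> bool) \<Rightarrow> coord \<Rightarrow> 'k shift_op" where
  "path_sum Q = (\<lambda>(i, j). \<Sum>l\<in>{1..n}. t_op (i, l) * descent_sum Q (m - i) l j)"

lemma descent_sum_cong:
  assumes "\<And>a. a \<in> coords m n \<Longrightarrow> Q a = Q' a"
  shows "k < m \<Longrightarrow> 1 \<le> l \<Longrightarrow> l \<le> n \<Longrightarrow> descent_sum Q k l j = descent_sum Q' k l j"
proof (induction k arbitrary: l)
  case (Suc k)
  then have "Q (m - k, l) = Q' (m - k, l)"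
    by (intro assms) (auto simp: coords_def)
  with Suc show ?case by (auto intro!: sum.cong)
qed simp

lemma path_sum_cong:
  assumes "\<And>a. a \<in> coords m n \<Longrightarrow> Q a = Q' a" "a \<in> coords m n"
  shows "path_sum Q a = path_sum Q' a"
proof -
  obtain i j where ij: "a = (i, j)" "1 \<le> i" "i \<le> m"
    using assms(2) by (auto simp: coords_def)
  then have "descent_sum Q (m - i) l j = descent_sum Q' (m - i) l j" if "1 \<le> l" "l \<le> n" for l
    using that by (intro descent_sum_cong assms(1)) auto
  then show ?thesis
    unfolding ij path_sum_def prod.case by (intro sum.cong) auto
qed

lemma descent_sum_no_turn:
  assumes "\<And>i l. m - k < i \<Longrightarrow> i \<le> m \<Longrightarrow> \<not> Q (i, l)" "k \<le> m"
  shows "descent_sum Q k l j = (if l = j then 1 else 0)"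
  using assms
proof (induction k)
  case (Suc k)
  have "\<not> Q (m - k, l)" using Suc.prems by auto
  moreover have "descent_sum Q k l j = (if l = j then 1 else 0)"
    using Suc.prems by (intro Suc.IH) auto
  ultimately show ?case by simp
qed simp

text \<open>The initial segment of the lexicographic order up to \<open>(r, s)\<close>;
  \<open>s = 0\<close> is allowed and means that row \<open>r\<close> has not been started.\<close>

definition below :: "nat \<Rightarrow> nat \<Rightarrow> coord \<Rightarrow> bool" where
  "below r s = (\<lambda>(k, l). k < r \<or> k = r \<and> l \<le> s)"

lemma below_iff [simp]: "below r s (k, l) \<longleftrightarrow> k < r \<or> k = r \<and> l \<le> s"
  by (simp add: below_def)

text \<open>With no turn permitted under row \<open>i\<close>, a path must leave that row in its
  final column, so there is only one. In particular the pivot entry is the invertible operator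
  \<open>t_op (r, s)\<close>.\<close>

lemma path_sum_below_row:
  assumes "r \<le> i" "i \<le> m" "1 \<le> j" "j \<le> n"
  shows "path_sum (below r s) (i, j) = t_op (i, j)"
proof -
  have "descent_sum (below r s) (m - i) l j = (if l = j then 1 else 0)" for l
    using assms by (intro descent_sum_no_turn) auto
  then have "path_sum (below r s) (i, j) = (\<Sum>l\<in>{1..n}. if l = j then t_op (i, l) else 0)"
    unfolding path_sum_def prod.case by (intro sum.cong) auto
  then show ?thesis using assms by (simp add: sum.delta)
qed

lemma descent_sum_pivot_row:
  assumes "1 \<le> r" "r \<le> m" "1 \<le> j"
  shows "descent_sum (below r s) (Suc (m - r)) l j
    = (if l = j then 1 else 0) + (if l \<le> s \<and> j < l then t_inv_op (r, l) * t_op (r, j) else 0)"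
proof -
  have d: "descent_sum (below r s) (m - r) l j = (if l = j then 1 else 0)" for l
    using assms by (intro descent_sum_no_turn) auto
  have r: "m - (m - r) = r" using assms by simp
  have "(\<Sum>l'\<in>{1..<l}. t_inv_op (r, l) * t_op (r, l') * descent_sum (below r s) (m - r) l' j)
      = (\<Sum>l'\<in>{1..<l}. if l' = j then t_inv_op (r, l) * t_op (r, l') else 0)"
    by (intro sum.cong) (auto simp: d)
  also have "\<dots> = (if j < l then t_inv_op (r, l) * t_op (r, j) else 0)"
    using assms by (simp add: sum.delta)
  finally show ?thesis unfolding descent_sum.simps r d by simp
qed

text \<open>A path that turns at \<open>(r, s)\<close> runs left to column \<open>j\<close> and then
  straight down. Replacing this end by the straight descent from \<open>(r, s)\<close> gives a path
  to column \<open>s\<close> without the new turn, and every old path to column \<open>s\<close>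
  from above row \<open>r\<close> arises so, since a turn left of \<open>(r, s)\<close> in row
  \<open>r\<close> leads away from column \<open>s\<close>.\<close>

lemma descent_sum_restore:
  assumes rs: "1 \<le> r" "r \<le> m" "1 \<le> s" "1 \<le> j"
  shows "descent_sum (below r s) (Suc (m - r) + k) l j = descent_sum (below r (s - 1)) (Suc (m - r) + k) l j
    + descent_sum (below r (s - 1)) (Suc (m - r) + k) l s * (if j < s then t_inv_op (r, s) * t_op (r, j) else 0)"
proof (induction k arbitrary: l)
  case 0
  show ?case
    using rs by (auto simp: descent_sum_pivot_row simp del: descent_sum.simps)
next
  case (Suc k)
  show ?case
  proof (cases "Suc k < r")
    case True
    then have "m - (Suc (m - r) + k) < r" using rs by linarith
    then show ?thesis
      unfolding add_Suc_right descent_sum.simps Suc.IH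
      by (simp add: distrib_left distrib_right sum.distrib sum_distrib_right mult.assoc)
  next
    \<comment> \<open>Beyond the top row, truncated subtraction yields row 0, where both predicates
      hold, so the recursion still runs alike on both sides.\<close>
    case False
    then have "m - (Suc (m - r) + k) = 0" using rs by linarith
    then show ?thesis
      unfolding add_Suc_right descent_sum.simps Suc.IH using rs
      by (simp add: distrib_left distrib_right sum.distrib sum_distrib_right mult.assoc)
  qed
qed

lemma path_sum_restore:
  assumes rs: "1 \<le> r" "r \<le> m" "1 \<le> s" "s \<le> n" and a: "a \<in> coords m n"
  shows "path_sum (below r s) a = restore r s (t_inv_op (r, s)) (path_sum (below r (s - 1))) a"
proof -
  obtain i j where ij: "a = (i, j)" "1 \<le> i" "i \<le> m" "1 \<le> j" "j \<le> n"
    using a by (auto simp: coords_def)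
  show ?thesis
  proof (cases "i < r")
    case False
    then show ?thesis using ij by (simp add: restore_def path_sum_below_row)
  next
    case True
    then obtain k where k: "m - i = Suc (m - r) + k"
      using rs by (metis Suc_diff_Suc Suc_leI add_Suc diff_less_mono2 le_iff_add less_le_trans)
    have "path_sum (below r s) (i, j) = path_sum (below r (s - 1)) (i, j)
        + path_sum (below r (s - 1)) (i, s) * (if j < s then t_inv_op (r, s) * t_op (r, j) else 0)"
      unfolding path_sum_def prod.case k descent_sum_restore[OF rs(1-3) ij(4)]
      by (simp add: distrib_left sum.distrib sum_distrib_right mult.assoc del: descent_sum.simps)
    then show ?thesis
      using True ij rs by (simp add: restore_def path_sum_below_row mult.assoc)
  qed
qed

lemma q_commuting_cong:
  assumes eq: "\<And>a. a \<in> coords m n \<Longrightarrow> x a = y a" "\<And>a. a \<in> coords m n \<Longrightarrow> P a = P' a"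
    and x: "q_commuting m n q P x"
  shows "q_commuting m n q P' y"
  unfolding q_commuting_def
proof (intro conjI allI impI, goal_cases)
  case (1 i j l)
  then have "y (i, j) = x (i, j)" "y (i, l) = x (i, l)"
    using eq by (auto simp: coords_def)
  moreover have "x (i, j) * x (i, l) = q \<cdot> (x (i, l) * x (i, j))"
    using x 1 unfolding q_commuting_def by blast
  ultimately show ?case by simp
next
  case (2 i k j)
  then have "y (i, j) = x (i, j)" "y (k, j) = x (k, j)"
    using eq by (auto simp: coords_def)
  moreover have "x (i, j) * x (k, j) = q \<cdot> (x (k, j) * x (i, j))"
    using x 2 unfolding q_commuting_def by blast
  ultimately show ?case by simp
next
  case (3 i k j l)
  then have "y (i, l) = x (i, l)" "y (k, j) = x (k, j)"
    using eq by (auto simp: coords_def)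
  moreover have "x (i, l) * x (k, j) = x (k, j) * x (i, l)"
    using x 3 unfolding q_commuting_def by blast
  ultimately show ?case by simp
next
  case (4 i k j l)
  then have "y (i, l) = x (i, l)" "y (k, j) = x (k, j)" "y (i, j) = x (i, j)" "y (k, l) = x (k, l)"
    "P' (k, l) = P (k, l)"
    using eq by (auto simp: coords_def)
  moreover have "x (i, j) * x (k, l) = (if P (k, l) then x (k, l) * x (i, j)
      + (q - inverse q) \<cdot> (x (i, l) * x (k, j)) else x (k, l) * x (i, j))"
    using x 4 unfolding q_commuting_def by blast
  ultimately show ?case by simp
qed

section \<open>Iterating the restoration over all pivots\<close>

definition admissible :: "(coord \<Rightarrow> bool) \<Rightarrow> bool" where
  "admissible Q \<longleftrightarrow> q_commuting m n q Q (path_sum Q)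
    \<and> (\<forall>a\<in>coords m n. raises_by m n (int (fst a * snd a) - 1) (path_sum Q a - t_op a))"

lemma admissible_cong:
  assumes "\<And>a. a \<in> coords m n \<Longrightarrow> Q a = Q' a"
  shows "admissible Q \<Longrightarrow> admissible Q'"
  unfolding admissible_def
  using q_commuting_cong[of "path_sum Q" "path_sum Q'" Q Q'] path_sum_cong[of Q Q'] assms by simp

lemma admissible_start: "admissible (below 1 0)"
proof -
  have p: "path_sum (below 1 0) a = t_op a" if "a \<in> coords m n" for a
    using that path_sum_below_row[of 1 "fst a" "snd a" 0] by (auto simp: coords_def)
  have "q_commuting m n q (below 1 0) (path_sum (below 1 0))"
  proof (rule q_commuting_cong[OF _ _ q_commuting_shift[OF q]])
    show "t_op a = path_sum (below 1 0) a" if "a \<in> coords m n" for a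
      using p[OF that] by (rule sym)
  qed (auto simp: coords_def)
  moreover have "raises_by m n (int (fst a * snd a) - 1) (path_sum (below 1 0) a - t_op a)"
    if "a \<in> coords m n" for a
    unfolding p[OF that] by (simp only: diff_self raises_by_0)
  ultimately show ?thesis
    unfolding admissible_def by blast
qed

text \<open>Before the step, row \<open>r\<close> still consists of the monomials
  \<open>t_op (r, j)\<close>. So \<open>t_inv_op (r, s)\<close> is a genuine inverse of the pivot,
  and the weight of the correction can be read off.\<close>

lemma admissible_step:
  assumes rs: "1 \<le> r" "r \<le> m" "1 \<le> s" "s \<le> n" and g: "admissible (below r (s - 1))"
  shows "admissible (below r s)"
  unfolding admissible_def
proof
  let ?x = "path_sum (below r (s - 1))" and ?w = "t_inv_op (r, s)"
  have rsc: "(r, s) \<in> coords m n" using rs by (simp add: coords_def)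
  have pivot: "?x (r, s) = t_op (r, s)" using rs by (simp add: path_sum_below_row)
  have "below r (s - 1) = (\<lambda>(k, l). k < r \<or> k = r \<and> l < s)"
    using rs by (auto simp: below_def fun_eq_iff)
  then have "q_commuting m n q (\<lambda>(k, l). k < r \<or> k = r \<and> l < s) ?x"
    using g by (simp add: admissible_def)
  then have "q_commuting m n q (below r s) (restore r s ?w ?x)"
    unfolding below_def
    by (rule q_commuting_restore[OF _ q rs])
      (use shift_inverse[OF rsc q, of 1] shift_inverse[OF rsc q, of "- 1"] pivot in \<open>simp_all add: below_def\<close>)
  then show "q_commuting m n q (below r s) (path_sum (below r s))"
    by (rule q_commuting_cong[rotated -1]) (simp_all add: path_sum_restore[OF rs])
  have lead: "raises_by m n (int (fst a * snd a) - 1) (?x a - t_op a)" if "a \<in> coords m n" for a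
    using g that by (simp add: admissible_def)
  show "\<forall>a\<in>coords m n. raises_by m n (int (fst a * snd a) - 1) (path_sum (below r s) a - t_op a)"
  proof
    fix a assume a: "a \<in> coords m n"
    obtain i j where ij: "a = (i, j)" "1 \<le> i" "i \<le> m" "1 \<le> j" "j \<le> n"
      using a by (auto simp: coords_def)
    show "raises_by m n (int (fst a * snd a) - 1) (path_sum (below r s) a - t_op a)"
    proof (cases "i < r \<and> j < s")
      case False
      then show ?thesis
        unfolding path_sum_restore[OF rs a] using lead[OF a] ij by (auto simp: restore_def)
    next
      case True
      have isc: "(i, s) \<in> coords m n" and rjc: "(r, j) \<in> coords m n"
        using ij rs by (auto simp: coords_def)
      have "raises_by m n (int (i * s)) (t_op (i, s) + (?x (i, s) - t_op (i, s)))"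
        using raises_by_shift[OF isc, of 1 q] raises_by_mono[OF lead[OF isc], of "int (i * s)"]
        by (intro raises_by_add) simp_all
      moreover have "raises_by m n (- int (r * s)) ?w"
        using raises_by_shift[OF rsc, of "- 1" q] by simp
      moreover have "raises_by m n (int (r * j)) (?x (r, j))"
        using raises_by_shift[OF rjc, of 1 q] path_sum_below_row[of r r j] ij rs by simp
      ultimately have "raises_by m n (int (i * s) + - int (r * s) + int (r * j)) (?x (i, s) * ?w * ?x (r, j))"
        by (intro raises_by_mult) simp_all
      moreover have "int (i * s) + - int (r * s) + int (r * j) \<le> int (i * j) - 1"
      proof -
        \<comment> \<open>This product is exactly the gap between the weights of the corrected entry
          and of the correction.\<close>
        have "0 < (int r - int i) * (int s - int j)" using True by simp
        then show ?thesis by (simp add: algebra_simps)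
      qed
      ultimately have "raises_by m n (int (i * j) - 1) (?x (i, s) * ?w * ?x (r, j))"
        by (rule raises_by_mono)
      then have "raises_by m n (int (i * j) - 1) ((?x (i, j) - t_op (i, j)) + ?x (i, s) * ?w * ?x (r, j))"
        using lead[OF a] ij by (intro raises_by_add) simp_all
      moreover have "path_sum (below r s) a - t_op a = (?x (i, j) - t_op (i, j)) + ?x (i, s) * ?w * ?x (r, j)"
        unfolding path_sum_restore[OF rs a] using True by (simp add: restore_def ij)
      ultimately show ?thesis by (simp only: ij(1) fst_conv snd_conv)
    qed
  qed
qed

lemma admissible_row:
  assumes "admissible (below r 0)" "1 \<le> r" "r \<le> m" "s \<le> n"
  shows "admissible (below r s)"
  using assms(4)
proof (induction s)
  case (Suc s)
  then show ?case using admissible_step[of r "Suc s"] assms by simp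
qed (use assms in simp)

lemma admissible_below:
  assumes "1 \<le> r" "r \<le> m" "s \<le> n"
  shows "admissible (below r s)"
proof -
  have "admissible (below (Suc k) 0)" if "Suc k \<le> m" for k
    using that
  proof (induction k)
    case 0
    show ?case using admissible_start by simp
  next
    case (Suc k)
    then have "admissible (below (Suc k) n)" by (intro admissible_row[OF Suc.IH]) simp_all
    \<comment> \<open>A finished row and a following row not yet started select the same coordinates
      of the matrix, although the predicates differ outside it.\<close>
    then show ?case by (rule admissible_cong[rotated]) (auto simp: coords_def)
  qed
  from this[of "r - 1"] have "admissible (below r 0)" using assms by simp
  then show ?thesis using assms by (rule admissible_row)
qed

end

section \<open>Sums over paths of the directed graph\<close>

lemma h_edge_iff:
  "h_edge m n (White (i, l)) x \<longleftrightarrow> (i, l) \<in> coords m n \<and> 2 \<le> l \<and> x = White (i, l - 1)"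
  "h_edge m n (Row i) x \<longleftrightarrow> 1 \<le> i \<and> i \<le> m \<and> x = White (i, n)"
  "\<not> h_edge m n (Col j) x"
proof -
  show "h_edge m n (White (i, l)) x \<longleftrightarrow> (i, l) \<in> coords m n \<and> 2 \<le> l \<and> x = White (i, l - 1)"
  proof
    assume "(i, l) \<in> coords m n \<and> 2 \<le> l \<and> x = White (i, l - 1)"
    then obtain k where "l = Suc k" "1 \<le> k" "x = White (i, k)" "(i, Suc k) \<in> coords m n"
      by (cases l) auto
    then show "h_edge m n (White (i, l)) x"
      by (auto simp: coords_def intro!: h_edge.intros)
  qed (auto elim!: h_edge.cases simp: coords_def)
qed (auto elim: h_edge.cases intro: h_edge.intros)

definition down :: "nat \<Rightarrow> coord \<Rightarrow> vertex" where
  "down m = (\<lambda>(i, l). if i = m then Col l else White (Suc i, l))"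

lemma v_edge_iff:
  "v_edge m n (White (i, l)) x \<longleftrightarrow> (i = m \<or> (i, l) \<in> coords m n) \<and> 1 \<le> l \<and> l \<le> n \<and> x = down m (i, l)"
  "\<not> v_edge m n (Row i) x"
  "\<not> v_edge m n (Col j) x"
proof -
  show "v_edge m n (White (i, l)) x \<longleftrightarrow> (i = m \<or> (i, l) \<in> coords m n) \<and> 1 \<le> l \<and> l \<le> n \<and> x = down m (i, l)"
  proof
    assume x: "(i = m \<or> (i, l) \<in> coords m n) \<and> 1 \<le> l \<and> l \<le> n \<and> x = down m (i, l)"
    show "v_edge m n (White (i, l)) x"
    proof (cases "i = m")
      case True
      then show ?thesis using x v_edge.intros(2)[of l n m] by (auto simp: coords_def down_def)
    next
      case False
      then show ?thesis using x v_edge.intros(1)[of i l m n] by (auto simp: coords_def down_def)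
    qed
  qed (auto elim!: v_edge.cases simp: coords_def down_def)
qed (auto elim: v_edge.cases)

definition edge :: "nat \<Rightarrow> nat \<Rightarrow> vertex \<Rightarrow> vertex \<Rightarrow> bool" where
  "edge m n x y \<longleftrightarrow> h_edge m n x y \<or> v_edge m n x y"

text \<open>Every edge raises this number by one, so the graph is acyclic and the distinctness
  demanded of paths is automatic.\<close>

fun vertex_rank :: "nat \<Rightarrow> nat \<Rightarrow> vertex \<Rightarrow> int" where
  "vertex_rank m n (White (i, j)) = int i - int j"
| "vertex_rank m n (Row i) = int i - int n - 1"
| "vertex_rank m n (Col j) = int m - int j + 1"

lemma edge_rank: "edge m n x y \<Longrightarrow> vertex_rank m n x < vertex_rank m n y"
  unfolding edge_def by (cases x) (auto simp: h_edge_iff v_edge_iff down_def)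

lemma walk_distinct:
  assumes "successively (edge m n) p"
  shows "distinct p"
proof -
  have "successively (\<lambda>x y. vertex_rank m n x < vertex_rank m n y) p"
    using assms by (rule successively_mono) (rule edge_rank)
  then have "sorted_wrt (\<lambda>x y. vertex_rank m n x < vertex_rank m n y) p"
    by (subst (asm) successively_conv_sorted_wrt) (auto simp: transp_def)
  then have "sorted_wrt (<) (map (vertex_rank m n) p)"
    by (simp add: sorted_wrt_map)
  then show ?thesis
    by (simp add: strict_sorted_iff distinct_map)
qed

definition turn_ok :: "nat \<Rightarrow> nat \<Rightarrow> (coord \<Rightarrow> bool) \<Rightarrow> vertex \<Rightarrow> vertex \<Rightarrow> vertex \<Rightarrow> bool" where
  "turn_ok m n Q u v x \<longleftrightarrow> (\<forall>a. v = White a \<and> v_edge m n u v \<and> h_edge m n v x \<longrightarrow> Q a)"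

text \<open>A recursion in place of the existential \<open>back_turn\<close>, so that turns can be
  checked while a path is extended at its front.\<close>

fun turns_ok :: "nat \<Rightarrow> nat \<Rightarrow> (coord \<Rightarrow> bool) \<Rightarrow> vertex list \<Rightarrow> bool" where
  "turns_ok m n Q (u # v # x # p) \<longleftrightarrow> turn_ok m n Q u v x \<and> turns_ok m n Q (v # x # p)"
| "turns_ok m n Q _ \<longleftrightarrow> True"

lemma back_turn_Cons:
  "back_turn m n (u # v # x # p) a \<longleftrightarrow>
    v = White a \<and> v_edge m n u v \<and> h_edge m n v x \<or> back_turn m n (v # x # p) a"
proof
  assume "back_turn m n (u # v # x # p) a"
  then obtain xs u' v' ys where e: "u # v # x # p = xs @ [u', White a, v'] @ ys"
    and t: "v_edge m n u' (White a)" "h_edge m n (White a) v'"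
    unfolding back_turn_def by blast
  show "v = White a \<and> v_edge m n u v \<and> h_edge m n v x \<or> back_turn m n (v # x # p) a"
  proof (cases xs)
    case Nil
    with e t show ?thesis by auto
  next
    case (Cons y zs)
    then have "v # x # p = zs @ [u', White a, v'] @ ys" using e by simp
    with t show ?thesis unfolding back_turn_def by blast
  qed
next
  assume "v = White a \<and> v_edge m n u v \<and> h_edge m n v x \<or> back_turn m n (v # x # p) a"
  then show "back_turn m n (u # v # x # p) a"
  proof
    assume "v = White a \<and> v_edge m n u v \<and> h_edge m n v x"
    moreover have "u # v # x # p = [] @ [u, v, x] @ p" by simp
    ultimately show ?thesis unfolding back_turn_def by metis
  next
    assume "back_turn m n (v # x # p) a"
    then obtain xs u' v' ys where "v # x # p = xs @ [u', White a, v'] @ ys"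
      and t: "v_edge m n u' (White a)" "h_edge m n (White a) v'"
      unfolding back_turn_def by blast
    then have "u # v # x # p = (u # xs) @ [u', White a, v'] @ ys" by simp
    with t show ?thesis unfolding back_turn_def by blast
  qed
qed

lemma turns_ok_iff: "turns_ok m n Q p \<longleftrightarrow> (\<forall>a. back_turn m n p a \<longrightarrow> Q a)"
proof (induction m n Q p rule: turns_ok.induct)
  case (1 m n Q u v x p)
  then show ?case by (auto simp: back_turn_Cons turn_ok_def)
next
  case ("2_2" m n Q u)
  then show ?case by (auto simp: back_turn_def Cons_eq_append_conv)
next
  case ("2_3" m n Q u v)
  then show ?case by (auto simp: back_turn_def Cons_eq_append_conv)
qed (auto simp: back_turn_def)

text \<open>The vertex \<open>u\<close> before the walk is recorded because whether \<open>v\<close>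
  is a turn depends on how \<open>v\<close> was entered; \<open>u\<close> itself does not belong to
  the walk.\<close>

definition walks :: "nat \<Rightarrow> nat \<Rightarrow> (coord \<Rightarrow> bool) \<Rightarrow> nat \<Rightarrow> vertex \<Rightarrow> vertex \<Rightarrow> vertex list set" where
  "walks m n Q j u v = {p. p \<noteq> [] \<and> hd p = v \<and> last p = Col j \<and> successively (edge m n) p
    \<and> turns_ok m n Q (u # p)}"

lemma walks_Col: "walks m n Q j u (Col j') = (if j' = j then {[Col j]} else {})"
proof -
  have "p = [Col j'] \<and> j' = j" if p: "p \<in> walks m n Q j u (Col j')" for p
  proof (cases p rule: remdups_adj.cases)
    case (3 x y zs)
    then show ?thesis
      using p by (auto simp: walks_def edge_def h_edge_iff v_edge_iff)
  qed (use p in \<open>auto simp: walks_def\<close>)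
  moreover have "[Col j] \<in> walks m n Q j u (Col j)"
    by (simp add: walks_def)
  ultimately show ?thesis by auto
qed

lemma walks_step:
  assumes "\<And>j. v \<noteq> Col j"
  shows "walks m n Q j u v = (\<Union>x\<in>{x. edge m n v x \<and> turn_ok m n Q u v x}. (#) v ` walks m n Q j v x)"
proof (intro equalityI subsetI)
  fix p assume p: "p \<in> walks m n Q j u v"
  show "p \<in> (\<Union>x\<in>{x. edge m n v x \<and> turn_ok m n Q u v x}. (#) v ` walks m n Q j v x)"
  proof (cases p rule: remdups_adj.cases)
    case (3 x y zs)
    then have "y # zs \<in> walks m n Q j v y" "x = v" "edge m n v y" "turn_ok m n Q u v y"
      using p by (auto simp: walks_def)
    with 3 show ?thesis by blast
  qed (use p assms in \<open>auto simp: walks_def\<close>)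
next
  fix p assume "p \<in> (\<Union>x\<in>{x. edge m n v x \<and> turn_ok m n Q u v x}. (#) v ` walks m n Q j v x)"
  then obtain x r where x: "edge m n v x" "turn_ok m n Q u v x" "r \<in> walks m n Q j v x" "p = v # r"
    by blast
  then obtain s where "r = x # s"
    by (cases r) (auto simp: walks_def)
  with x show "p \<in> walks m n Q j u v"
    by (auto simp: walks_def)
qed

context torus_ideal
begin

definition edge_op :: "vertex \<Rightarrow> vertex \<Rightarrow> 'k shift_op" where
  "edge_op u v = (case (u, v) of
      (White a, White b) \<Rightarrow> if fst a = fst b then t_inv_op a * t_op b else 1
    | (Row i, White a) \<Rightarrow> t_op a
    | _ \<Rightarrow> 1)"

fun path_op :: "vertex list \<Rightarrow> 'k shift_op" where
  "path_op (u # v # p) = edge_op u v * path_op (v # p)"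
| "path_op _ = 1"

text \<open>Finiteness is part of the claim because a sum over an infinite set would be the default
  value zero.\<close>

definition walks_sum :: "(coord \<Rightarrow> bool) \<Rightarrow> nat \<Rightarrow> vertex \<Rightarrow> vertex \<Rightarrow> 'k shift_op \<Rightarrow> bool" where
  "walks_sum Q j u v s \<longleftrightarrow> finite (walks m n Q j u v) \<and> (\<Sum>p\<in>walks m n Q j u v. path_op p) = s"

lemma walks_sum_Col: "walks_sum Q j u (Col j') (if j' = j then 1 else 0)"
  by (simp add: walks_sum_def walks_Col)

lemma walks_sum_step:
  assumes v: "\<And>j. v \<noteq> Col j" and A: "{x. edge m n v x \<and> turn_ok m n Q u v x} = A" "finite A"
    and s: "\<And>x. x \<in> A \<Longrightarrow> walks_sum Q j v x (s x)"
  shows "walks_sum Q j u v (\<Sum>x\<in>A. edge_op v x * s x)"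
proof -
  have eq: "walks m n Q j u v = (\<Union>x\<in>A. (#) v ` walks m n Q j v x)"
    using walks_step[OF v] A(1) by simp
  have fin: "finite (walks m n Q j v x)" if "x \<in> A" for x
    using s[OF that] by (simp add: walks_sum_def)
  have "(\<Sum>p\<in>walks m n Q j u v. path_op p) = (\<Sum>x\<in>A. \<Sum>p\<in>(#) v ` walks m n Q j v x. path_op p)"
    unfolding eq
  proof (rule sum.UNION_disjoint)
    show "\<forall>x\<in>A. \<forall>y\<in>A. x \<noteq> y \<longrightarrow> (#) v ` walks m n Q j v x \<inter> (#) v ` walks m n Q j v y = {}"
      by (auto simp: walks_def)
  qed (use A(2) fin in auto)
  also have "\<dots> = (\<Sum>x\<in>A. \<Sum>p\<in>walks m n Q j v x. path_op (v # p))"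
    by (simp add: sum.reindex)
  also have "\<dots> = (\<Sum>x\<in>A. edge_op v x * s x)"
  proof (rule sum.cong[OF refl])
    fix x assume "x \<in> A"
    have "path_op (v # p) = edge_op v x * path_op p" if "p \<in> walks m n Q j v x" for p
      using that by (cases p) (auto simp: walks_def)
    then have "(\<Sum>p\<in>walks m n Q j v x. path_op (v # p)) = edge_op v x * (\<Sum>p\<in>walks m n Q j v x. path_op p)"
      by (simp add: sum_distrib_left)
    then show "(\<Sum>p\<in>walks m n Q j v x. path_op (v # p)) = edge_op v x * s x"
      using s[OF \<open>x \<in> A\<close>] by (simp add: walks_sum_def)
  qed
  finally show ?thesis
    using A(2) fin by (simp add: walks_sum_def eq)
qed

text \<open>Prepending one horizontal edge cancels \<open>t_op (i, l)\<close> against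
  \<open>t_inv_op (i, l)\<close>, so the weights of a run telescope. Only the first vertex of a run
  can be a turn, hence the condition on \<open>u\<close>.\<close>

lemma walks_sum_horizontal:
  assumes below: "\<And>l u. 1 \<le> l \<Longrightarrow> l \<le> n \<Longrightarrow> walks_sum Q j (White (i, l)) (down m (i, l)) (d l)"
    and i: "1 \<le> i" "i \<le> m"
  shows "1 \<le> l \<Longrightarrow> l \<le> n \<Longrightarrow> \<not> v_edge m n u (White (i, l)) \<or> Q (i, l) \<Longrightarrow>
    walks_sum Q j u (White (i, l)) (\<Sum>l'\<in>{1..l}. t_inv_op (i, l) * t_op (i, l') * d l')"
proof (induction l arbitrary: u rule: nat_induct_at_least[of 1, consumes 1])
  case base
  have c: "(i, 1) \<in> coords m n" using i mn by (simp add: coords_def)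
  have ne: "fst a \<noteq> i" if "down m (i, 1) = White a" for a
    using that by (auto simp: down_def split: if_splits)
  then have "edge_op (White (i, 1)) (down m (i, 1)) = 1"
    by (auto simp: edge_op_def split: vertex.splits)
  moreover have "walks_sum Q j u (White (i, 1)) (\<Sum>x\<in>{down m (i, 1)}. edge_op (White (i, 1)) x * d 1)"
  proof (rule walks_sum_step)
    show "{x. edge m n (White (i, 1)) x \<and> turn_ok m n Q u (White (i, 1)) x} = {down m (i, 1)}"
      using c mn by (auto simp: edge_def h_edge_iff v_edge_iff turn_ok_def)
    show "walks_sum Q j (White (i, 1)) x (d 1)" if "x \<in> {down m (i, 1)}" for x
      using that below[of 1] mn by simp
  qed simp_all
  ultimately show ?case
    using shift_inverse[OF c q, of "- 1"] by simp
next
  case (Suc l)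
  have c: "(i, l) \<in> coords m n" "(i, Suc l) \<in> coords m n" using i Suc by (auto simp: coords_def)
  have ne: "down m (i, Suc l) \<noteq> White (i, l)" by (simp add: down_def)
  let ?v = "White (i, Suc l)"
  have e: "edge_op ?v (down m (i, Suc l)) = 1" "edge_op ?v (White (i, l)) = t_inv_op (i, Suc l) * t_op (i, l)"
    by (simp_all add: edge_op_def down_def)
  have tt: "t_op (i, l) * (t_inv_op (i, l) * x) = x" for x
    using shift_inverse[OF c(1) q, of 1] by (simp flip: mult.assoc)
  let ?s = "\<lambda>x. if x = White (i, l) then \<Sum>l'\<in>{1..l}. t_inv_op (i, l) * t_op (i, l') * d l' else d (Suc l)"
  have "walks_sum Q j u ?v (\<Sum>x\<in>{White (i, l), down m (i, Suc l)}. edge_op ?v x * ?s x)"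
  proof (rule walks_sum_step)
    show "{x. edge m n ?v x \<and> turn_ok m n Q u ?v x} = {White (i, l), down m (i, Suc l)}"
      using c Suc.prems Suc.hyps by (auto simp: edge_def h_edge_iff v_edge_iff turn_ok_def down_def)
    show "walks_sum Q j ?v x (?s x)" if "x \<in> {White (i, l), down m (i, Suc l)}" for x
    proof (cases "x = White (i, l)")
      case True
      have "\<not> v_edge m n ?v (White (i, l))" by (simp add: v_edge_iff down_def)
      then show ?thesis using True Suc.IH[of ?v] Suc.prems by simp
    next
      case False
      then show ?thesis using that below[of "Suc l"] Suc.prems Suc.hyps by simp
    qed
  qed simp_all
  moreover have "(\<Sum>x\<in>{White (i, l), down m (i, Suc l)}. edge_op ?v x * ?s x)
      = (\<Sum>l'\<in>{1..Suc l}. t_inv_op (i, Suc l) * t_op (i, l') * d l')"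
    using ne ne[symmetric] mult_right_cong[OF shift_inverse[OF c(2) q, of "- 1"], of "d (Suc l)"]
    by (simp add: e sum_distrib_left mult.assoc tt)
  ultimately show ?case by simp
qed

lemma walks_sum_vertical:
  "k < m \<Longrightarrow> 1 \<le> l \<Longrightarrow> l \<le> n \<Longrightarrow>
    walks_sum Q j (White (m - k, l)) (down m (m - k, l)) (descent_sum Q k l j)"
proof (induction k arbitrary: l)
  case 0
  then show ?case by (simp add: down_def walks_sum_Col)
next
  case (Suc k)
  let ?i = "m - k" and ?u = "White (m - Suc k, l)"
  have i: "1 \<le> ?i" "?i \<le> m" and dn: "down m (m - Suc k, l) = White (?i, l)" and u: "(m - Suc k, l) \<in> coords m n"
    and c: "(?i, l) \<in> coords m n"
    using Suc.prems by (auto simp: down_def coords_def)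
  have below: "walks_sum Q j (White (?i, l)) (down m (?i, l)) (descent_sum Q k l j)"
    if "1 \<le> l" "l \<le> n" for l
    using that Suc by simp
  show ?case
  proof (cases "Q (?i, l)")
    case True
    have "walks_sum Q j ?u (White (?i, l)) (\<Sum>l'\<in>{1..l}. t_inv_op (?i, l) * t_op (?i, l') * descent_sum Q k l' j)"
      using True Suc.prems by (intro walks_sum_horizontal below i) auto
    \<comment> \<open>The summand at \<open>l\<close> is the path that goes straight on, with factor
      1; the others turn here, as in the recursion of \<open>descent_sum\<close>.\<close>
    moreover have "{1..l} = insert l {1..<l}" using Suc.prems by auto
    ultimately show ?thesis
      using True shift_inverse[OF c q, of "- 1"] by (simp add: dn)
  next
    case False
    have "walks_sum Q j ?u (White (?i, l)) (\<Sum>x\<in>{down m (?i, l)}. edge_op (White (?i, l)) x * descent_sum Q k l j)"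
    proof (rule walks_sum_step)
      show "{x. edge m n (White (?i, l)) x \<and> turn_ok m n Q ?u (White (?i, l)) x} = {down m (?i, l)}"
        using c u False Suc.prems dn by (auto simp: edge_def h_edge_iff v_edge_iff turn_ok_def down_def)
      show "walks_sum Q j (White (?i, l)) x (descent_sum Q k l j)" if "x \<in> {down m (?i, l)}" for x
        using that below Suc.prems by simp
    qed simp_all
    moreover have "edge_op (White (?i, l)) (down m (?i, l)) = 1"
      by (simp add: edge_op_def down_def)
    ultimately show ?thesis using False by (simp add: dn)
  qed
qed

text \<open>The row vertex serves as its own predecessor: no vertical edge leaves it, so neither it
  nor the first white vertex counts as a turn.\<close>

lemma walks_sum_Row:
  assumes "(i, j) \<in> coords m n"
  shows "walks_sum Q j (Row i) (Row i) (path_sum Q (i, j))"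
proof -
  have i: "1 \<le> i" "i \<le> m" and c: "(i, n) \<in> coords m n" using assms by (auto simp: coords_def)
  let ?s = "\<Sum>l\<in>{1..n}. t_inv_op (i, n) * t_op (i, l) * descent_sum Q (m - i) l j"
  have below: "walks_sum Q j (White (i, l)) (down m (i, l)) (descent_sum Q (m - i) l j)"
    if "1 \<le> l" "l \<le> n" for l
    using walks_sum_vertical[of "m - i" l Q j] that i by simp
  have "walks_sum Q j (Row i) (Row i) (\<Sum>x\<in>{White (i, n)}. edge_op (Row i) x * ?s)"
  proof (rule walks_sum_step)
    show "{x. edge m n (Row i) x \<and> turn_ok m n Q (Row i) (Row i) x} = {White (i, n)}"
      using i by (auto simp: edge_def h_edge_iff v_edge_iff turn_ok_def)
    show "walks_sum Q j (Row i) x ?s" if "x \<in> {White (i, n)}" for x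
    proof -
      have "walks_sum Q j (Row i) (White (i, n)) ?s"
        using mn by (intro walks_sum_horizontal below i) (auto simp: v_edge_iff)
      with that show ?thesis by simp
    qed
  qed simp_all
  moreover have "t_op (i, n) * (t_inv_op (i, n) * x) = x" for x
    using shift_inverse[OF c q, of 1] by (simp flip: mult.assoc)
  ultimately show ?thesis
    by (simp add: path_sum_def edge_op_def sum_distrib_left mult.assoc)
qed

lemma Gamma_eq_walks:
  "Gamma m n t (i, j) = walks m n (\<lambda>a. \<not> coord_less (nth_coord m n t) a) j (Row i) (Row i)"
proof -
  let ?Q = "\<lambda>a. \<not> coord_less (nth_coord m n t) a"
  have "turns_ok m n ?Q (Row i # p) = turns_ok m n ?Q p" if "p \<noteq> []" "hd p = Row i" for p
    using that by (cases p rule: remdups_adj.cases) (auto simp: turn_ok_def)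
  then show ?thesis
    unfolding Gamma_def walks_def dipaths_def
    by (auto simp: turns_ok_iff walk_distinct edge_def[abs_def])
qed

end

section \<open>From operators back to elements of the presented algebras\<close>

lemma (in faithful_presentation) finsum_B:
  assumes "finite F" "\<And>p. p \<in> F \<Longrightarrow> f p \<in> img E X" "\<And>p. p \<in> F \<Longrightarrow> g p = cls E X (f p)"
  shows "(\<Sum>p\<in>F. f p) \<in> img E X \<and> finsum B g F = cls E X (\<Sum>p\<in>F. f p)"
  using assms
proof (induction F rule: finite_induct)
  case empty
  then show ?case by (simp add: abelian_monoid.finsum_empty ring_B ring.is_abelian_group
      abelian_group.axioms(1) zero_B img_closed)
next
  case (insert p F)
  interpret RB: ring B by (rule ring_B)
  have g: "g \<in> F \<rightarrow> carrier B" "g p \<in> carrier B"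
    using insert.prems by (auto simp: carrier_B)
  have IH: "(\<Sum>p\<in>F. f p) \<in> img E X" "finsum B g F = cls E X (\<Sum>p\<in>F. f p)"
    using insert by auto
  have "finsum B g (insert p F) = g p \<oplus>\<^bsub>B\<^esub> finsum B g F"
    using insert.hyps g by (simp add: RB.finsum_insert)
  with IH insert show ?case
    by (simp add: add_B img_closed)
qed

lemma coord_less_iff: "coord_less a b \<longleftrightarrow> a < b"
  by (cases a; cases b) (auto simp: coord_less_def)

text \<open>Ranks are strictly increasing and lie between 1 and \<open>m * n\<close>, so by counting
  each number is the rank of exactly one coordinate and the definite description is
  meaningful.\<close>

lemma nth_coord_in_coords:
  assumes "t \<in> {1..m * n}"
  shows "nth_coord m n t \<in> coords m n"
proof -
  define rank where "rank a = Suc (card {b \<in> coords m n. coord_less b a})" for a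
  have fin: "finite (coords m n)" by (simp add: coords_def)
  have less: "rank a < rank b" if "a \<in> coords m n" "a < b" for a b
    unfolding rank_def coord_less_iff Suc_less_eq
    using that fin by (intro psubset_card_mono) (auto simp: less_le_trans)
  have inj: "inj_on rank (coords m n)"
    using less by (intro inj_onI) (metis less_irrefl linorder_less_linear)
  have "rank ` coords m n \<subseteq> {1..m * n}"
  proof
    fix x assume "x \<in> rank ` coords m n"
    then obtain a where a: "a \<in> coords m n" "x = rank a" by blast
    have "card {b \<in> coords m n. coord_less b a} < card (coords m n)"
      using a(1) fin by (intro psubset_card_mono) (auto simp: coord_less_iff)
    then show "x \<in> {1..m * n}"
      by (simp add: a(2) rank_def coords_def)
  qed
  moreover have "card (rank ` coords m n) = card {1..m * n}"
    using inj by (simp add: card_image coords_def)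
  ultimately have "rank ` coords m n = {1..m * n}"
    by (intro card_subset_eq) auto
  then obtain a where a: "a \<in> coords m n" "rank a = t"
    using assms by (metis imageE)
  have "nth_coord m n t = (THE a. a \<in> coords m n \<and> rank a = t)"
    by (simp add: nth_coord_def rank_def)
  also have "\<dots> = a"
    using a inj by (intro the_equality) (auto simp: inj_on_def)
  finally show ?thesis using a(1) by simp
qed

context torus_ideal
begin

sublocale tor: faithful_presentation "torus_letters m n" "torus_rels m n q" "torus_op m n q"
  by (rule torus_faithful)

abbreviation "torus_cls \<equiv> cls (torus_op m n q) (torus_letters m n)"
abbreviation "torus_img \<equiv> img (torus_op m n q) (torus_letters m n)"

lemma t_op_img:
  assumes "a \<in> coords m n"
  shows "t_op a \<in> torus_img" "t_inv_op a \<in> torus_img"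
  using img_closed(7)[of "T a" "torus_letters m n" "torus_op m n q"]
    img_closed(7)[of "T_inv a" "torus_letters m n" "torus_op m n q"] assms
  by (simp_all add: torus_op_def)

lemma torus_gen_cls:
  assumes "a \<in> coords m n"
  shows "torus_gen m n q (T a) = torus_cls (t_op a)" "torus_gen m n q (T_inv a) = torus_cls (t_inv_op a)"
  using tor.presented_gen_B[of "T a"] tor.presented_gen_B[of "T_inv a"] assms
  by (simp_all add: torus_gen_def torus_op_def)

lemma edge_weight_cls:
  assumes "edge m n u v"
  shows "edge_op u v \<in> torus_img \<and> edge_weight m n q u v = torus_cls (edge_op u v)"
proof (cases u)
  case (White a)
  obtain i l where a: "a = (i, l)" by force
  from assms White consider "(i, l) \<in> coords m n" "2 \<le> l" "v = White (i, l - 1)" | "v = down m (i, l)"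
    by (auto simp: edge_def h_edge_iff v_edge_iff a)
  then show ?thesis
  proof cases
    case 1
    then have "(i, l - 1) \<in> coords m n" by (auto simp: coords_def)
    with 1 show ?thesis
      by (simp add: White a edge_op_def edge_weight_def torus_gen_cls torus_alg_def tor.mult_B t_op_img img_closed)
  next
    case 2
    then show ?thesis
      by (simp add: White a edge_op_def edge_weight_def down_def torus_alg_def tor.one_B img_closed)
  qed
next
  case (Row i)
  then have "1 \<le> i" "i \<le> m" "v = White (i, n)"
    using assms by (auto simp: edge_def h_edge_iff v_edge_iff)
  then show ?thesis
    using mn by (simp add: Row edge_op_def edge_weight_def torus_gen_cls t_op_img coords_def)
next
  case (Col j)
  then show ?thesis using assms by (simp add: edge_def h_edge_iff v_edge_iff)
qed

lemma path_weight_cls: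
  "successively (edge m n) p \<Longrightarrow> path_op p \<in> torus_img \<and> path_weight m n q p = torus_cls (path_op p)"
proof (induction p rule: path_op.induct)
  case (1 u v p)
  then have "path_weight m n q (u # v # p) = edge_weight m n q u v \<otimes>\<^bsub>tor.B\<^esub> path_weight m n q (v # p)"
    by (simp add: path_weight_def torus_alg_def)
  with 1 edge_weight_cls[of u v] show ?case
    by (simp add: tor.mult_B img_closed)
qed (simp_all add: path_weight_def torus_alg_def tor.one_B img_closed)

text \<open>The weight of each path is the fibre over its operator, and a finite sum of fibres is
  the fibre over the sum; this sum is the one computed by the recursion over rows.\<close>

lemma A_gen_cls:
  assumes "(i, j) \<in> coords m n" "nth_coord m n t = (r, s)"
  shows "path_sum (below r s) (i, j) \<in> torus_img"
    and "A_gen m n q t (i, j) = torus_cls (path_sum (below r s) (i, j))"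
proof -
  let ?G = "Gamma m n t (i, j)"
  have "(\<lambda>a. \<not> coord_less (nth_coord m n t) a) = below r s"
    by (auto simp: assms(2) below_def coord_less_def fun_eq_iff)
  then have G: "?G = walks m n (below r s) j (Row i) (Row i)"
    by (simp add: Gamma_eq_walks)
  have w: "successively (edge m n) p" if "p \<in> ?G" for p
    using that by (simp add: G walks_def)
  have sum: "(\<Sum>p\<in>?G. path_op p) = path_sum (below r s) (i, j)"
    using walks_sum_Row[OF assms(1), of "below r s"] by (simp add: G walks_sum_def)
  have "(\<Sum>p\<in>?G. path_op p) \<in> torus_img \<and>
      finsum tor.B (path_weight m n q) ?G = torus_cls (\<Sum>p\<in>?G. path_op p)"
    using path_weight_cls[OF w] by (intro tor.finsum_B finite_Gamma) auto
  then show "path_sum (below r s) (i, j) \<in> torus_img"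
    "A_gen m n q t (i, j) = torus_cls (path_sum (below r s) (i, j))"
    by (simp_all add: sum A_gen_def torus_alg_def)
qed

end

theorem corollary3p2p5:
  fixes q :: "'k::field" and m n t :: nat
  assumes "infinite (UNIV :: 'k set)"
    and "m \<ge> 2" and "n \<ge> 2"
    and "q \<noteq> 0" and "\<forall>k::nat. k > 0 \<longrightarrow> q ^ k \<noteq> 1"
    and "t \<in> {1..m * n}"
  shows "\<exists>\<phi>. \<phi> \<in> alg_iso (R_alg m n q t) (A_alg m n q t)
    \<and> (\<forall>i \<in> {1..m}. \<forall>j \<in> {1..n}. \<phi> (R_gen m n q t (i, j)) = A_gen m n q t (i, j))"
proof -
  obtain r s where rs: "nth_coord m n t = (r, s)" by force
  then have r: "1 \<le> r" "r \<le> m" "s \<le> n"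
    using nth_coord_in_coords[OF assms(6)] by (auto simp: coords_def)
  interpret torus_ideal m n q
    using assms by unfold_locales
  interpret M: matrix_ideal m n q "below r s"
    using assms by unfold_locales
  have "(\<lambda>p. \<not> coord_less (nth_coord m n t) p) = below r s"
    by (auto simp: rs below_def coord_less_def fun_eq_iff)
  then have rels: "R_rels m n q t = q_relations m n q (below r s) letter"
    by (simp add: R_rels_def)
  \<comment> \<open>Restoration up to the pivot \<open>(r, s)\<close> supplies both requirements,
    the relations of the presentation and the leading terms.\<close>
  have R: "faithful_presentation (coords m n) (R_rels m n q t) (path_sum (below r s))"
    unfolding rels using admissible_below[OF r] by (intro M.matrix_faithful) (auto simp: admissible_def)
  have "\<exists>\<phi>. \<phi> \<in> alg_iso (presented_alg (coords m n) (R_rels m n q t))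
        (gen_subalg (presented_alg (torus_letters m n) (torus_rels m n q)) (A_gen m n q t ` coords m n))
      \<and> (\<forall>a\<in>coords m n. \<phi> (presented_gen (coords m n) (R_rels m n q t) a) = A_gen m n q t a)"
  proof (rule presented_alg_iso_gen_subalg[OF R torus_faithful])
    fix a assume "a \<in> coords m n"
    then show "path_sum (below r s) a \<in> torus_img" "A_gen m n q t a = torus_cls (path_sum (below r s) a)"
      using A_gen_cls[OF _ rs] by (cases a; simp)+
  qed
  then show ?thesis
    by (auto simp: R_alg_def A_alg_def torus_alg_def R_gen_def coords_def)
qed



end
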